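(* Fix $\alpha>0$. Consider the independent non-homogeneous set-up described in the context, suppose that assumptions (E1), (E2) and (E3) stated there hold, and let $\pi$ be a prior density on $\Theta$ which is positive and continuous at $\theta_g$ and has finite expectation. Then the expected $R^{(\alpha)}$-posterior estimator $\widehat\theta^{E}_{n,\alpha}=\int\theta\,\pi_R^{(\alpha)}(\theta|X_1,\dots,X_n)\,d\theta$ satisfies the following. (a) $\sqrt n\left(\widehat\theta^{E}_{n,\alpha}-\widehat\theta_{n,\alpha}\right)\to0$ in probability as $n\to\infty$. (b) If, further, $\Sigma_n(\theta_g)^{-1/2}\sqrt n\left(\widehat\theta_{n,\alpha}-\theta_g\right)\to N_p(0,I_p)$ in distribution for some positive definite matrix $\Sigma_n(\theta_g)$, then $\Sigma_n(\theta_g)^{-1/2}\sqrt n\left(\widehat\theta^{E}_{n,\alpha}-\theta_g\right)\to N_p(0,I_p)$ in distribution.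
   Context: Set-up. $X_1,X_2,\dots$ are independent random variables on a common probability space; $X_i$ has distribution $G_i$ with density $g_i$ with respect to a common dominating $\sigma$-finite measure $\lambda$. The distribution $G_i$ is modelled by a parametric family $\{F_{i,\theta}:\theta\in\Theta\}$, $\Theta\subseteq\mathbb{R}^p$, with densities $f_{i,\theta}$ with respect to $\lambda$; the parameter $\theta$ is common to all $i$. Unmarked integrals of densities are with respect to $\lambda$. Probabilities and convergence refer to the true distribution of the data. $\alpha$-likelihood: $Q_n^{(\alpha)}(\theta)=\sum_{i=1}^n\left[\frac1\alpha f_{i,\theta}^{\alpha}(X_i)-\frac{1}{1+\alpha}\int f_{i,\theta}^{1+\alpha}-\frac1\alpha\right]$. Put $V_i(x,\theta)=\int f_{i,\theta}^{1+\alpha}-(1+\frac1\alpha)f_{i,\theta}^{\alpha}(x)$, so that, up to an additive constant not depending on $\theta$, $Q_n^{(\alpha)}(\theta)=-\frac{1}{1+\alpha}\sum_{i=1}^nV_i(X_i,\theta)$. $R^{(\alpha)}$-posterior for a prior (probability) density $\pi$ on $\Theta$: $\pi_R^{(\alpha)}(\theta|X_1,\dots,X_n)=\exp(Q_n^{(\alpha)}(\theta))\pi(\theta)\big/\int\exp(Q_n^{(\alpha)}(\theta'))\pi(\theta')\,d\theta'$. Minimum density power divergence estimator (MDPDE): $\widehat\theta_{n,\alpha}$ is a maximizer over $\Theta$ of $Q_n^{(\alpha)}$ (equivalently a minimizer of $\sum_iV_i(X_i,\theta)$), with estimating equation $\nabla Q_n^{(\alpha)}(\theta)=0$. Best fitting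 parameter: it is assumed that there is $\theta_g\in\Theta$, independent of $i$, which minimizes over $\theta\in\Theta$ the divergence $d_\alpha(g_i,f_{i,\theta})=\int\left[f_{i,\theta}^{1+\alpha}-(1+\frac1\alpha)f_{i,\theta}^{\alpha}g_i+\frac1\alpha g_i^{1+\alpha}\right]d\lambda$ for every $i$. Notation: $\nabla,\nabla^2$ are the gradient and Hessian in $\theta$; $\nabla_j,\nabla_{jk},\nabla_{jkl}$ are partial derivatives in $\theta$; $|A|$ is the determinant of a matrix $A$; $\Psi_{n,\alpha}(\theta)=\frac{1}{1+\alpha}\frac1n\sum_{i=1}^nE_{g_i}[\nabla^2V_i(X_i,\theta)]$. Assumptions. (E1) The following regularity conditions hold (they are the conditions under which $\widehat\theta_{n,\alpha}$ is consistent for $\theta_g$, i.e. $\widehat\theta_{n,\alpha}\to\theta_g$ in probability): (A1) the support $\{x:f_{i,\theta}(x)>0\}$ does not depend on $i$ or $\theta$, and every $G_i$ is supported on the same set $\chi$; (A2) there is an open subset $\omega$ of $\Theta$ containing $\theta_g$, and for almost all $x\in\chi$, all $\theta\in\Theta$ and all $i$, $f_{i,\theta}(x)$ is three times differentiable in $\theta$ with continuous third partial derivatives; (A3) for every $i$, the integrals $\int f_{i,\theta}^{1+\alpha}$ and $\int f_{i,\theta}^{\alpha}g_i$ are three times differentiable in $\theta$ and the derivatives can be taken under the integral sign; (A4) $\inf_{n\ge1}[\text{minimum eigenvalue of }\Psi_{n,\alpha}(\theta_g)]>0$; (A5) for all $j,k,l$ and $i$ there are functions $M^{(i)}_{jkl}$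 with $|\nabla_{jkl}V_i(x,\theta)|\le M^{(i)}_{jkl}(x)$ for all $\theta\in\Theta$ and all $i$, and $\frac1n\sum_{i=1}^nE_{g_i}[M^{(i)}_{jkl}(X_i)]=O(1)$; (A6) for all $j,k$, at $\theta=\theta_g$, $\lim_{N\to\infty}\sup_{n>1}\frac1n\sum_{i=1}^nE_{g_i}\big[|\nabla_jV_i(X_i,\theta)|\,I(|\nabla_jV_i(X_i,\theta)|>N)\big]=0$ and $\lim_{N\to\infty}\sup_{n>1}\frac1n\sum_{i=1}^nE_{g_i}\big[|D_{i,jk}|\,I(|D_{i,jk}|>N)\big]=0$, where $D_{i,jk}=\nabla_{jk}V_i(X_i,\theta)-E_{g_i}[\nabla_{jk}V_i(X_i,\theta)]$. (E2) For any $\delta>0$ there is $\epsilon>0$ such that, with probability tending to one as $n\to\infty$, $\sup_{\|\theta-\theta_g\|>\delta}\frac1n\left[Q_n^{(\alpha)}(\theta)-Q_n^{(\alpha)}(\theta_g)\right]<-\epsilon$. (E3) $0<|\Psi_{n,\alpha}(\theta)|<\infty$ for all sufficiently large $n$ and all $\theta\in\Theta$ with $\|\theta\|_2<\infty$.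
   Formalization: In (E3), |Ψ_n(θ)|<∞ is read as boundedness of |Ψ_n(θ)| along all large n for each θ, and in (b) the smallest eigenvalue of the positive definite matrices Σ_n(θ_g) is assumed bounded away from 0; without these the claims fail. *)

theory Defs
  imports "HOL-Probability.Probability"
begin

text \<open>
  Measurability is part of the two convergence notions, since \<^const>\<open>measure\<close> and the Bochner
  integral take default values on non-measurable arguments.
\<close>

definition tendsto_in_prob ::
  "'w measure \<Rightarrow> (nat \<Rightarrow> 'w \<Rightarrow> 'b::{metric_space, second_countable_topology}) \<Rightarrow> 'b \<Rightarrow> bool" where
  "tendsto_in_prob M Z c \<longleftrightarrow>
     (\<forall>n. Z n \<in> borel_measurable M) \<and>
     (\<forall>\<epsilon>>0. (\<lambda>n. measure M {w \<in> space M. \<epsilon> < dist (Z n w) c}) \<longlonglongrightarrow> 0)"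

definition tendsto_in_distr ::
  "'w measure \<Rightarrow> (nat \<Rightarrow> 'w \<Rightarrow> 'b::topological_space) \<Rightarrow> 'b measure \<Rightarrow> bool" where
  "tendsto_in_distr M Z N \<longleftrightarrow>
     (\<forall>n. Z n \<in> borel_measurable M) \<and>
     (\<forall>\<phi>::'b \<Rightarrow> real. continuous_on UNIV \<phi> \<and> bounded (range \<phi>) \<longrightarrow>
        (\<lambda>n. \<integral>w. \<phi> (Z n w) \<partial>M) \<longlonglongrightarrow> (\<integral>x. \<phi> x \<partial>N))"

text \<open>
  The event in question may be an uncountable intersection, so it is only asked to contain
  measurable events whose probability tends to one.
\<close>

definition with_prob_tending_to_one :: "'w measure \<Rightarrow> (nat \<Rightarrow> 'w \<Rightarrow> bool) \<Rightarrow> bool" where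
  "with_prob_tending_to_one M P \<longleftrightarrow>
     (\<exists>A. (\<forall>n. A n \<in> sets M \<and> (\<forall>w\<in>A n. P n w)) \<and> (\<lambda>n. measure M (A n)) \<longlonglongrightarrow> 1)"

definition std_normal_vec :: "(real ^ 'p) measure" where
  "std_normal_vec = density lborel (\<lambda>x. ennreal (\<Prod>j\<in>UNIV. std_normal_density (x $ j)))"

definition eigenvalues :: "real ^ 'p ^ 'p \<Rightarrow> real set" where
  "eigenvalues A = {c. \<exists>v. v \<noteq> 0 \<and> A *v v = c *\<^sub>R v}"

definition min_eigenvalue :: "real ^ 'p ^ 'p \<Rightarrow> real" where
  "min_eigenvalue A = Min (eigenvalues A)"

definition pos_definite :: "real ^ 'p ^ 'p \<Rightarrow> bool" where
  "pos_definite A \<longleftrightarrow> transpose A = A \<and> (\<forall>v. v \<noteq> 0 \<longrightarrow> 0 < v \<bullet> (A *v v))"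

text \<open>The power \<open>-1/2\<close> of a positive definite matrix, through its positive definite square root.\<close>

definition inv_sqrt_matrix :: "real ^ 'p ^ 'p \<Rightarrow> real ^ 'p ^ 'p" where
  "inv_sqrt_matrix A = matrix_inv (THE B. pos_definite B \<and> B ** B = A)"

text \<open>
  The parameter set \<open>T\<close> need not be open, and functions of the parameter carry no information outside
  it, so derivatives are taken within \<open>T\<close>; at interior points they are the ordinary ones.
\<close>

definition partial :: "(real ^ 'p) set \<Rightarrow> 'p \<Rightarrow> (real ^ 'p \<Rightarrow> real) \<Rightarrow> real ^ 'p \<Rightarrow> real" where
  "partial T j h \<theta> = frechet_derivative h (at \<theta> within T) (axis j 1)"

abbreviation partial2 ::
  "(real ^ 'p) set \<Rightarrow> 'p \<Rightarrow> 'p \<Rightarrow> (real ^ 'p \<Rightarrow> real) \<Rightarrow> real ^ 'p \<Rightarrow> real" where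
  "partial2 T j k h \<equiv> partial T j (partial T k h)"

abbreviation partial3 ::
  "(real ^ 'p) set \<Rightarrow> 'p \<Rightarrow> 'p \<Rightarrow> 'p \<Rightarrow> (real ^ 'p \<Rightarrow> real) \<Rightarrow> real ^ 'p \<Rightarrow> real" where
  "partial3 T j k l h \<equiv> partial T j (partial T k (partial T l h))"

definition thrice_differentiable_on :: "(real ^ 'p \<Rightarrow> real) \<Rightarrow> (real ^ 'p) set \<Rightarrow> bool" where
  "thrice_differentiable_on h T \<longleftrightarrow>
     h differentiable_on T \<and>
     (\<forall>j. partial T j h differentiable_on T) \<and>
     (\<forall>j k. partial2 T j k h differentiable_on T)"

definition thrice_differentiable_under_integral ::
  "'a measure \<Rightarrow> (real ^ 'p) set \<Rightarrow> (real ^ 'p \<Rightarrow> 'a \<Rightarrow> real) \<Rightarrow> bool" where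
  "thrice_differentiable_under_integral lam T h \<longleftrightarrow>
     thrice_differentiable_on (\<lambda>\<theta>. \<integral>x. h \<theta> x \<partial>lam) T \<and>
     (\<forall>\<theta>\<in>T. integrable lam (h \<theta>) \<and>
       (\<forall>j. integrable lam (\<lambda>x. partial T j (\<lambda>\<theta>. h \<theta> x) \<theta>) \<and>
            partial T j (\<lambda>\<theta>. \<integral>x. h \<theta> x \<partial>lam) \<theta> = (\<integral>x. partial T j (\<lambda>\<theta>. h \<theta> x) \<theta> \<partial>lam)) \<and>
       (\<forall>j k. integrable lam (\<lambda>x. partial2 T j k (\<lambda>\<theta>. h \<theta> x) \<theta>) \<and>
            partial2 T j k (\<lambda>\<theta>. \<integral>x. h \<theta> x \<partial>lam) \<theta> = (\<integral>x. partial2 T j k (\<lambda>\<theta>. h \<theta> x) \<theta> \<partial>lam)) \<and>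
       (\<forall>j k l. integrable lam (\<lambda>x. partial3 T j k l (\<lambda>\<theta>. h \<theta> x) \<theta>) \<and>
            partial3 T j k l (\<lambda>\<theta>. \<integral>x. h \<theta> x \<partial>lam) \<theta> =
              (\<integral>x. partial3 T j k l (\<lambda>\<theta>. h \<theta> x) \<theta> \<partial>lam)))"

text \<open>
  Throughout, \<open>M\<close> is the underlying probability space, \<open>lam\<close> the dominating measure, \<open>X i\<close> the
  \<open>i\<close>-th observation (\<open>i \<ge> 1\<close>) with density \<open>g i\<close>, \<open>f i \<theta>\<close> the model density, \<open>T\<close> the
  parameter set and \<open>\<theta>g\<close> the best fitting parameter.
\<close>

definition is_density :: "'a measure \<Rightarrow> ('a \<Rightarrow> real) \<Rightarrow> bool" where
  "is_density lam h \<longleftrightarrow>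
     h \<in> borel_measurable lam \<and> (\<forall>x\<in>space lam. 0 \<le> h x) \<and> (\<integral>\<^sup>+x. ennreal (h x) \<partial>lam) = 1"

definition true_model ::
  "'w measure \<Rightarrow> 'a measure \<Rightarrow> (nat \<Rightarrow> 'w \<Rightarrow> 'a) \<Rightarrow> (nat \<Rightarrow> 'a \<Rightarrow> real) \<Rightarrow> bool" where
  "true_model M lam X g \<longleftrightarrow>
     prob_space M \<and> sigma_finite_measure lam \<and>
     (\<forall>i\<ge>1. is_density lam (g i) \<and> distributed M lam (X i) (\<lambda>x. ennreal (g i x))) \<and>
     prob_space.indep_vars M (\<lambda>_. lam) X {1..}"

text \<open>
  Joint measurability in \<open>(\<theta>, x)\<close> is what makes integrals against a prior of functions of
  \<open>f i \<theta> (X i w)\<close> random variables.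
\<close>

definition parametric_family ::
  "'a measure \<Rightarrow> (real ^ 'p) set \<Rightarrow> (nat \<Rightarrow> real ^ 'p \<Rightarrow> 'a \<Rightarrow> real) \<Rightarrow> bool" where
  "parametric_family lam T f \<longleftrightarrow>
     T \<in> sets borel \<and>
     (\<forall>i\<ge>1. (\<lambda>(\<theta>, x). f i \<theta> x) \<in> borel_measurable (restrict_space borel T \<Otimes>\<^sub>M lam)) \<and>
     (\<forall>i\<ge>1. \<forall>\<theta>\<in>T. is_density lam (f i \<theta>))"

text \<open>
  The distribution with density \<open>h\<close>. Derivatives in \<open>\<theta>\<close> are only assumed to exist for almost every
  \<open>x\<close>, so they are measurable in \<open>x\<close> only up to null sets; completing the measure makes their
  integrals insensitive to the exceptional set (and changes nothing for measurable integrands).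
\<close>

definition law :: "'a measure \<Rightarrow> ('a \<Rightarrow> real) \<Rightarrow> 'a measure" where
  "law lam h = completion (density lam (\<lambda>x. ennreal (h x)))"

text \<open>
  The integrand of the divergence is non-negative by Young's inequality, hence the
  extended non-negative integral.
\<close>

definition dpd :: "real \<Rightarrow> 'a measure \<Rightarrow> ('a \<Rightarrow> real) \<Rightarrow> ('a \<Rightarrow> real) \<Rightarrow> ennreal" where
  "dpd \<alpha> lam g f =
     (\<integral>\<^sup>+x. ennreal (f x powr (1 + \<alpha>) - (1 + 1 / \<alpha>) * f x powr \<alpha> * g x
                 + 1 / \<alpha> * g x powr (1 + \<alpha>)) \<partial>lam)"

definition best_fitting ::
  "real \<Rightarrow> 'a measure \<Rightarrow> (nat \<Rightarrow> 'a \<Rightarrow> real) \<Rightarrow> (nat \<Rightarrow> real ^ 'p \<Rightarrow> 'a \<Rightarrow> real) \<Rightarrow>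
   (real ^ 'p) set \<Rightarrow> real ^ 'p \<Rightarrow> bool" where
  "best_fitting \<alpha> lam g f T \<theta>g \<longleftrightarrow>
     \<theta>g \<in> T \<and> (\<forall>i\<ge>1. \<forall>\<theta>\<in>T. dpd \<alpha> lam (g i) (f i \<theta>g) \<le> dpd \<alpha> lam (g i) (f i \<theta>))"

definition alpha_lik ::
  "real \<Rightarrow> 'a measure \<Rightarrow> (nat \<Rightarrow> real ^ 'p \<Rightarrow> 'a \<Rightarrow> real) \<Rightarrow> (nat \<Rightarrow> 'w \<Rightarrow> 'a) \<Rightarrow>
   nat \<Rightarrow> 'w \<Rightarrow> real ^ 'p \<Rightarrow> real" where
  "alpha_lik \<alpha> lam f X n w \<theta> =
     (\<Sum>i=1..n. 1 / \<alpha> * f i \<theta> (X i w) powr \<alpha>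
               - 1 / (1 + \<alpha>) * (\<integral>x. f i \<theta> x powr (1 + \<alpha>) \<partial>lam) - 1 / \<alpha>)"

definition V ::
  "real \<Rightarrow> 'a measure \<Rightarrow> (nat \<Rightarrow> real ^ 'p \<Rightarrow> 'a \<Rightarrow> real) \<Rightarrow> nat \<Rightarrow> 'a \<Rightarrow> real ^ 'p \<Rightarrow> real" where
  "V \<alpha> lam f i x \<theta> =
     (\<integral>y. f i \<theta> y powr (1 + \<alpha>) \<partial>lam) - (1 + 1 / \<alpha>) * f i \<theta> x powr \<alpha>"

definition Psi ::
  "real \<Rightarrow> 'a measure \<Rightarrow> (nat \<Rightarrow> 'a \<Rightarrow> real) \<Rightarrow> (nat \<Rightarrow> real ^ 'p \<Rightarrow> 'a \<Rightarrow> real) \<Rightarrow>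
   (real ^ 'p) set \<Rightarrow> nat \<Rightarrow> real ^ 'p \<Rightarrow> real ^ 'p ^ 'p" where
  "Psi \<alpha> lam g f T n \<theta> =
     (\<chi> j k. 1 / (1 + \<alpha>) * (1 / real n) *
        (\<Sum>i=1..n. \<integral>x. partial2 T j k (V \<alpha> lam f i x) \<theta> \<partial>law lam (g i)))"

definition is_mdpde ::
  "real \<Rightarrow> 'w measure \<Rightarrow> 'a measure \<Rightarrow> (nat \<Rightarrow> real ^ 'p \<Rightarrow> 'a \<Rightarrow> real) \<Rightarrow> (nat \<Rightarrow> 'w \<Rightarrow> 'a) \<Rightarrow>
   (real ^ 'p) set \<Rightarrow> (nat \<Rightarrow> 'w \<Rightarrow> real ^ 'p) \<Rightarrow> bool" where
  "is_mdpde \<alpha> M lam f X T \<theta>hat \<longleftrightarrow>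
     (\<forall>n\<ge>1. \<theta>hat n \<in> borel_measurable M \<and>
        (AE w in M. \<theta>hat n w \<in> T \<and>
           (\<forall>\<theta>\<in>T. alpha_lik \<alpha> lam f X n w \<theta> \<le> alpha_lik \<alpha> lam f X n w (\<theta>hat n w))))"

definition prior_density :: "(real ^ 'p) set \<Rightarrow> (real ^ 'p \<Rightarrow> real) \<Rightarrow> bool" where
  "prior_density T \<pi> \<longleftrightarrow>
     (\<forall>\<theta>\<in>T. 0 \<le> \<pi> \<theta>) \<and> set_integrable lborel T \<pi> \<and> (LINT \<theta>:T|lborel. \<pi> \<theta>) = 1"

definition R_posterior ::
  "real \<Rightarrow> 'a measure \<Rightarrow> (nat \<Rightarrow> real ^ 'p \<Rightarrow> 'a \<Rightarrow> real) \<Rightarrow> (nat \<Rightarrow> 'w \<Rightarrow> 'a) \<Rightarrow>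
   (real ^ 'p) set \<Rightarrow> (real ^ 'p \<Rightarrow> real) \<Rightarrow> nat \<Rightarrow> 'w \<Rightarrow> real ^ 'p \<Rightarrow> real" where
  "R_posterior \<alpha> lam f X T \<pi> n w \<theta> =
     exp (alpha_lik \<alpha> lam f X n w \<theta>) * \<pi> \<theta>
       / (LINT \<theta>':T|lborel. exp (alpha_lik \<alpha> lam f X n w \<theta>') * \<pi> \<theta>')"

definition expected_R_posterior ::
  "real \<Rightarrow> 'a measure \<Rightarrow> (nat \<Rightarrow> real ^ 'p \<Rightarrow> 'a \<Rightarrow> real) \<Rightarrow> (nat \<Rightarrow> 'w \<Rightarrow> 'a) \<Rightarrow>
   (real ^ 'p) set \<Rightarrow> (real ^ 'p \<Rightarrow> real) \<Rightarrow> nat \<Rightarrow> 'w \<Rightarrow> real ^ 'p" where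
  "expected_R_posterior \<alpha> lam f X T \<pi> n w =
     (LINT \<theta>:T|lborel. R_posterior \<alpha> lam f X T \<pi> n w \<theta> *\<^sub>R \<theta>)"

definition cond_A1 ::
  "'a measure \<Rightarrow> (nat \<Rightarrow> 'a \<Rightarrow> real) \<Rightarrow> (nat \<Rightarrow> real ^ 'p \<Rightarrow> 'a \<Rightarrow> real) \<Rightarrow>
   (real ^ 'p) set \<Rightarrow> 'a set \<Rightarrow> bool" where
  "cond_A1 lam g f T S \<longleftrightarrow>
     (\<forall>i\<ge>1. \<forall>\<theta>\<in>T. {x \<in> space lam. 0 < f i \<theta> x} = S) \<and>
     (\<forall>i\<ge>1. AE x in law lam (g i). x \<in> S)"

definition cond_A2 ::
  "'a measure \<Rightarrow> (nat \<Rightarrow> real ^ 'p \<Rightarrow> 'a \<Rightarrow> real) \<Rightarrow> (real ^ 'p) set \<Rightarrow> 'a set \<Rightarrow> real ^ 'p \<Rightarrow> bool" where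
  "cond_A2 lam f T S \<theta>g \<longleftrightarrow>
     (\<exists>\<omega>. open \<omega> \<and> \<omega> \<subseteq> T \<and> \<theta>g \<in> \<omega>) \<and>
     (AE x in lam. x \<in> S \<longrightarrow>
        (\<forall>i\<ge>1. thrice_differentiable_on (\<lambda>\<theta>. f i \<theta> x) T \<and>
               (\<forall>j k l. continuous_on T (partial3 T j k l (\<lambda>\<theta>. f i \<theta> x)))))"

definition cond_A3 ::
  "real \<Rightarrow> 'a measure \<Rightarrow> (nat \<Rightarrow> 'a \<Rightarrow> real) \<Rightarrow> (nat \<Rightarrow> real ^ 'p \<Rightarrow> 'a \<Rightarrow> real) \<Rightarrow>
   (real ^ 'p) set \<Rightarrow> bool" where
  "cond_A3 \<alpha> lam g f T \<longleftrightarrow>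
     (\<forall>i\<ge>1. thrice_differentiable_under_integral (completion lam) T (\<lambda>\<theta> x. f i \<theta> x powr (1 + \<alpha>)) \<and>
             thrice_differentiable_under_integral (completion lam) T (\<lambda>\<theta> x. f i \<theta> x powr \<alpha> * g i x))"

definition cond_A4 ::
  "real \<Rightarrow> 'a measure \<Rightarrow> (nat \<Rightarrow> 'a \<Rightarrow> real) \<Rightarrow> (nat \<Rightarrow> real ^ 'p \<Rightarrow> 'a \<Rightarrow> real) \<Rightarrow>
   (real ^ 'p) set \<Rightarrow> real ^ 'p \<Rightarrow> bool" where
  "cond_A4 \<alpha> lam g f T \<theta>g \<longleftrightarrow>
     0 < (INF n\<in>{1..}. ereal (min_eigenvalue (Psi \<alpha> lam g f T n \<theta>g)))"

definition cond_A5 ::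
  "real \<Rightarrow> 'a measure \<Rightarrow> (nat \<Rightarrow> 'a \<Rightarrow> real) \<Rightarrow> (nat \<Rightarrow> real ^ 'p \<Rightarrow> 'a \<Rightarrow> real) \<Rightarrow>
   (real ^ 'p) set \<Rightarrow> 'a set \<Rightarrow> bool" where
  "cond_A5 \<alpha> lam g f T S \<longleftrightarrow>
     (\<forall>j k l. \<exists>B :: nat \<Rightarrow> 'a \<Rightarrow> real.
        (\<forall>i\<ge>1. integrable (law lam (g i)) (B i) \<and>
           (AE x in lam. x \<in> S \<longrightarrow> (\<forall>\<theta>\<in>T. \<bar>partial3 T j k l (V \<alpha> lam f i x) \<theta>\<bar> \<le> B i x))) \<and>
        (\<lambda>n. 1 / real n * (\<Sum>i=1..n. \<integral>x. B i x \<partial>law lam (g i))) \<in> O(\<lambda>_. 1))"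

text \<open>
  \<open>Y i\<close> is a function on the sample space, evaluated at an observation with density \<open>g i\<close>.
\<close>

definition averaged_tails_vanish ::
  "'a measure \<Rightarrow> (nat \<Rightarrow> 'a \<Rightarrow> real) \<Rightarrow> (nat \<Rightarrow> 'a \<Rightarrow> real) \<Rightarrow> bool" where
  "averaged_tails_vanish lam g Y \<longleftrightarrow>
     ((\<lambda>N::real. SUP n\<in>{1<..}.
         (\<Sum>i=1..n. \<integral>\<^sup>+x. ennreal (\<bar>Y i x\<bar> * indicator {y. \<bar>Y i y\<bar> > N} x) \<partial>law lam (g i))
           / ennreal (real n)) \<longlongrightarrow> 0) at_top"

definition cond_A6 ::
  "real \<Rightarrow> 'a measure \<Rightarrow> (nat \<Rightarrow> 'a \<Rightarrow> real) \<Rightarrow> (nat \<Rightarrow> real ^ 'p \<Rightarrow> 'a \<Rightarrow> real) \<Rightarrow>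
   (real ^ 'p) set \<Rightarrow> real ^ 'p \<Rightarrow> bool" where
  "cond_A6 \<alpha> lam g f T \<theta>g \<longleftrightarrow>
     (\<forall>j. averaged_tails_vanish lam g (\<lambda>i x. partial T j (V \<alpha> lam f i x) \<theta>g)) \<and>
     (\<forall>j k. averaged_tails_vanish lam g
        (\<lambda>i x. partial2 T j k (V \<alpha> lam f i x) \<theta>g
               - (\<integral>y. partial2 T j k (V \<alpha> lam f i y) \<theta>g \<partial>law lam (g i))))"

definition cond_E1 ::
  "real \<Rightarrow> 'a measure \<Rightarrow> (nat \<Rightarrow> 'a \<Rightarrow> real) \<Rightarrow> (nat \<Rightarrow> real ^ 'p \<Rightarrow> 'a \<Rightarrow> real) \<Rightarrow>
   (real ^ 'p) set \<Rightarrow> real ^ 'p \<Rightarrow> bool" where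
  "cond_E1 \<alpha> lam g f T \<theta>g \<longleftrightarrow>
     (\<exists>S. cond_A1 lam g f T S \<and> cond_A2 lam f T S \<theta>g \<and> cond_A3 \<alpha> lam g f T \<and>
          cond_A4 \<alpha> lam g f T \<theta>g \<and> cond_A5 \<alpha> lam g f T S \<and> cond_A6 \<alpha> lam g f T \<theta>g)"

text \<open>The supremum is extended-real, so it is \<open>-\<infinity>\<close> when no parameter is \<open>\<delta>\<close>-far from \<open>\<theta>g\<close>.\<close>

definition cond_E2 ::
  "real \<Rightarrow> 'w measure \<Rightarrow> 'a measure \<Rightarrow> (nat \<Rightarrow> real ^ 'p \<Rightarrow> 'a \<Rightarrow> real) \<Rightarrow> (nat \<Rightarrow> 'w \<Rightarrow> 'a) \<Rightarrow>
   (real ^ 'p) set \<Rightarrow> real ^ 'p \<Rightarrow> bool" where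
  "cond_E2 \<alpha> M lam f X T \<theta>g \<longleftrightarrow>
     (\<forall>\<delta>>0. \<exists>\<epsilon>>0. with_prob_tending_to_one M (\<lambda>n w.
        (SUP \<theta>\<in>{\<theta>\<in>T. norm (\<theta> - \<theta>g) > \<delta>}.
           ereal (1 / real n * (alpha_lik \<alpha> lam f X n w \<theta> - alpha_lik \<alpha> lam f X n w \<theta>g)))
        < ereal (- \<epsilon>)))"

text \<open>
  The determinant of a real matrix is finite for each single \<open>n\<close>; the finiteness requirement is
  therefore imposed on the sequence, for each fixed parameter. Without it the determinant at \<open>\<theta>g\<close>
  may grow exponentially in \<open>n\<close>, and then far parameter values can dominate the posterior in
  spite of the exponential bound in \<open>cond_E2\<close>.
\<close>

definition cond_E3 ::
  "real \<Rightarrow> 'a measure \<Rightarrow> (nat \<Rightarrow> 'a \<Rightarrow> real) \<Rightarrow> (nat \<Rightarrow> real ^ 'p \<Rightarrow> 'a \<Rightarrow> real) \<Rightarrow>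
   (real ^ 'p) set \<Rightarrow> bool" where
  "cond_E3 \<alpha> lam g f T \<longleftrightarrow>
     (\<exists>n0. \<forall>\<theta>\<in>T. (\<forall>n\<ge>n0. 0 < det (Psi \<alpha> lam g f T n \<theta>)) \<and>
                  (SUP n\<in>{n0..}. ereal (det (Psi \<alpha> lam g f T n \<theta>))) < \<infinity>)"

text \<open>
  A sequence of positive definite matrices that does not degenerate. If the smallest eigenvalue may
  tend to zero, a remainder of order \<open>o(1)\<close> need not be negligible after normalisation.
\<close>

definition pos_definite_seq :: "(nat \<Rightarrow> real ^ 'p ^ 'p) \<Rightarrow> bool" where
  "pos_definite_seq Sig \<longleftrightarrow>
     (\<forall>n\<ge>1. pos_definite (Sig n)) \<and> 0 < (INF n\<in>{1..}. ereal (min_eigenvalue (Sig n)))"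

end

theory Submission
  imports Defs "HOL-Real_Asymp.Real_Asymp"
begin

text \<open>
  On the scale \<open>1 / sqrt n\<close> the mean of the posterior cannot be told apart from the maximizer \<open>\<theta>hat\<close>
  of the likelihood: seen from \<open>\<theta>hat\<close> and magnified by \<open>sqrt n\<close>, the posterior is close to a centred Gaussian with
  precision matrix \<open>Psi\<close> at \<open>\<theta>g\<close>, and a centred Gaussian has mean zero.

  Only first moments matter, and they can be estimated directly. Put \<open>h = \<theta> - \<theta>hat\<close>,
  \<open>b = Q(\<theta>) - Q(\<theta>hat)\<close> and \<open>q(h) = (h \<bullet> Psi h) / 2\<close>, where \<open>Q\<close> is the likelihood. The difference of the
  two estimators is the integral of \<open>h * exp b * \<pi>\<close> divided by the integral of \<open>exp b * \<pi>\<close>. The integral of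
  \<open>h * exp (- n * q(h))\<close> over a ball about \<open>0\<close> vanishes, because \<open>q\<close> is even; subtracting it from the
  numerator leaves only the errors of the approximations \<open>b \<approx> - n * q(h)\<close> and \<open>\<pi>(\<theta>) \<approx> \<pi>(\<theta>g)\<close>. If
  \<open>\<bar>b + n * q(h)\<bar> \<le> n * \<eta> * \<bar>h\<bar>\<^sup>2\<close> on the ball and \<open>\<pi>\<close> varies there by at most \<open>\<eta>'\<close>, the numerator is
  \<open>O((\<eta> + \<eta>') * n powr (- (p + 1) / 2))\<close> up to the part outside the ball, which is exponentially
  small as the prior has finite expectation, and the denominator is at least a constant times \<open>n powr (- p / 2)\<close>. Both bounds are explicit
  (\<open>laplace_first_moment_bound\<close>) and hold at a fixed sample point, so it suffices to exhibit, for each accuracy,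
  events of probability close to one on which they apply (\<open>posterior_mean_close_on_good_event\<close>).

  On such an event four things hold. By (E2), parameters away from \<open>\<theta>g\<close> have a smaller likelihood than
  \<open>\<theta>g\<close>; this bounds the exterior part and also places the maximizer near \<open>\<theta>g\<close>, so that the gradient
  vanishes there. By (A6), the averaged Hessian of the \<open>V i\<close> at \<open>\<theta>g\<close> is close to its expectation
  (\<open>weak_law_averaged_tails\<close>). By (A5) and Markov's inequality, the averaged third derivatives are bounded,
  so the Hessian stays close to \<open>- n * Psi\<close> throughout a small ball (\<open>quadratic_expansion_at_maximizer\<close>).
  Finally the forms \<open>q\<close> are elliptic uniformly in \<open>n\<close>: (A4) bounds the eigenvalues of \<open>Psi\<close> below, and
  since (E3) bounds their product, they are also bounded above (\<open>Psi_uniformly_elliptic\<close>).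

  The second part is Slutsky's theorem in the form \<open>tendsto_in_distr_add_vanishing\<close>, because the inverse
  square roots of the matrices \<open>Sig n\<close> have uniformly bounded norms.
\<close>

section \<open>Symmetric matrices\<close>

text \<open>
  The minimum of \<open>x \<bullet> f x\<close> over the unit sphere of an invariant subspace is attained at an
  eigenvector: the first-order condition at the minimizer says that the residual \<open>f v - c v\<close> is zero. The
  bound for all other \<open>x\<close> is what identifies \<open>c\<close> as the smallest eigenvalue.
\<close>

lemma self_adjoint_min_eigenvector:
  fixes f :: "'v::euclidean_space \<Rightarrow> 'v"
  assumes lin: "linear f" and S: "subspace S" "f ` S \<subseteq> S" "S \<noteq> {0}"
    and sa: "\<And>x y. x \<in> S \<Longrightarrow> y \<in> S \<Longrightarrow> f x \<bullet> y = x \<bullet> f y"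
  obtains v c where "v \<in> S" "norm v = 1" "f v = c *\<^sub>R v" "\<And>x. x \<in> S \<Longrightarrow> c * (x \<bullet> x) \<le> x \<bullet> f x"
proof -
  let ?K = "S \<inter> sphere 0 1"
  have "compact ?K"
    by (simp add: closed_subspace S closed_Int_compact)
  moreover have "?K \<noteq> {}"
  proof -
    obtain x where x: "x \<in> S" "x \<noteq> 0" using S subspace_0 by blast
    then have "(1 / norm x) *\<^sub>R x \<in> ?K" using S by (auto simp: subspace_scale)
    then show ?thesis by blast
  qed
  moreover have "continuous_on ?K (\<lambda>x. x \<bullet> f x)"
    using lin by (intro continuous_intros linear_continuous_on) (simp add: linear_conv_bounded_linear)
  ultimately obtain v where v: "v \<in> ?K" "\<And>y. y \<in> ?K \<Longrightarrow> v \<bullet> f v \<le> y \<bullet> f y"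
    using continuous_attains_inf by metis
  define c where "c = v \<bullet> f v"
  have vS: "v \<in> S" and nv: "norm v = 1" using v by auto
  have lower: "c * (x \<bullet> x) \<le> x \<bullet> f x" if "x \<in> S" for x
  proof (cases "x = 0")
    case True then show ?thesis by simp
  next
    case False
    define y where "y = (1 / norm x) *\<^sub>R x"
    have "y \<in> ?K" using that S False by (auto simp: y_def subspace_scale)
    then have "c \<le> y \<bullet> f y" using v(2) c_def by auto
    also have "\<dots> = (x \<bullet> f x) / (norm x)^2"
      using lin by (simp add: y_def linear_cmul power2_eq_square)
    finally show ?thesis using False by (simp add: pos_le_divide_eq power2_norm_eq_inner)
  qed
  define w where "w = f v - c *\<^sub>R v"
  have wS: "w \<in> S" using S vS by (auto simp: w_def intro!: subspace_diff subspace_scale)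
  have vv: "v \<bullet> v = 1" using nv by (simp add: dot_square_norm)
  \<comment> \<open>The form minus its minimum is non-negative and zero at \<open>v\<close>; look in the direction of the residual.\<close>
  have quad: "0 \<le> 2 * t * (w \<bullet> w) + t^2 * (w \<bullet> f w - c * (w \<bullet> w))" for t
  proof -
    have "v + t *\<^sub>R w \<in> S" using S vS wS by (auto intro!: subspace_add subspace_scale)
    from lower[OF this] have "0 \<le> (v + t *\<^sub>R w) \<bullet> f (v + t *\<^sub>R w) - c * ((v + t *\<^sub>R w) \<bullet> (v + t *\<^sub>R w))"
      by simp
    also have "f (v + t *\<^sub>R w) = f v + t *\<^sub>R f w" using lin by (simp add: linear_add linear_cmul)
    also have "(v + t *\<^sub>R w) \<bullet> (f v + t *\<^sub>R f w) - c * ((v + t *\<^sub>R w) \<bullet> (v + t *\<^sub>R w))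
       = 2 * t * (w \<bullet> (f v - c *\<^sub>R v)) + t^2 * (w \<bullet> f w - c * (w \<bullet> w))"
      using sa[OF vS wS] vv
      by (simp add: inner_simps c_def[symmetric] algebra_simps power2_eq_square inner_commute)
    finally show ?thesis by (simp add: w_def[symmetric])
  qed
  have "w \<bullet> w = 0"
  proof (rule ccontr)
    assume "w \<bullet> w \<noteq> 0"
    then have pos: "0 < w \<bullet> w" by (simp add: order_less_le)
    define a where "a = w \<bullet> f w - c * (w \<bullet> w)"
    define t where "t = - (w \<bullet> w) / (\<bar>a\<bar> + 1)"
    have "0 \<le> t * (2 * (w \<bullet> w) + t * a)" using quad[of t] by (simp add: a_def algebra_simps power2_eq_square)
    moreover have "t < 0" using pos by (simp add: t_def divide_neg_pos)
    moreover have "\<bar>t * a\<bar> \<le> w \<bullet> w"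
    proof -
      have "\<bar>t * a\<bar> = (w \<bullet> w) * (\<bar>a\<bar> / (\<bar>a\<bar> + 1))" using pos by (simp add: t_def abs_mult)
      also have "\<dots> \<le> (w \<bullet> w) * 1" using pos by (intro mult_left_mono) auto
      finally show ?thesis by simp
    qed
    ultimately show False using pos by (smt (verit) zero_le_mult_iff)
  qed
  then have "f v = c *\<^sub>R v" by (simp add: w_def)
  then show thesis using that vS nv lower by blast
qed

text \<open>
  The spectral theorem, by induction on the dimension: the orthogonal complement of an eigenvector
  is again invariant.
\<close>

lemma self_adjoint_orthonormal_eigenbasis:
  fixes f :: "'v::euclidean_space \<Rightarrow> 'v"
  assumes lin: "linear f" and S: "subspace S" "f ` S \<subseteq> S"
    and sa: "\<And>x y. x \<in> S \<Longrightarrow> y \<in> S \<Longrightarrow> f x \<bullet> y = x \<bullet> f y"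
  obtains B where "finite B" "span B = S" "pairwise orthogonal B"
    "\<And>b. b \<in> B \<Longrightarrow> norm b = 1" "\<And>b. b \<in> B \<Longrightarrow> \<exists>c. f b = c *\<^sub>R b"
  using S sa
proof (induction "dim S" arbitrary: S thesis rule: less_induct)
  case less
  show ?case
  proof (cases "S = {0}")
    case True
    then show ?thesis using less.prems(1)[of "{}"] by simp
  next
    case False
    obtain v c where v: "v \<in> S" "norm v = 1" "f v = c *\<^sub>R v"
      using self_adjoint_min_eigenvector[OF lin less.prems(2,3) False less.prems(4)] by metis
    define S' where "S' = {x \<in> S. x \<bullet> v = 0}"
    have sub: "subspace S'"
      using less.prems(2) unfolding S'_def subspace_def by (auto simp: inner_simps)
    have inv: "f ` S' \<subseteq> S'"
    proof
      fix y assume "y \<in> f ` S'"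
      then obtain x where x: "x \<in> S'" "y = f x" by auto
      then have "f x \<bullet> v = x \<bullet> f v" using less.prems(4) v(1) by (auto simp: S'_def)
      then show "y \<in> S'" using x v less.prems(3) by (auto simp: S'_def)
    qed
    have vv: "v \<bullet> v = 1" using v by (simp add: dot_square_norm)
    have "S' \<subset> S" using v vv unfolding S'_def by force
    then have dim: "dim S' < dim S"
      using sub less.prems(2) by (metis dim_psubset span_eq_iff)
    obtain B where B: "finite B" "span B = S'" "pairwise orthogonal B"
      "\<And>b. b \<in> B \<Longrightarrow> norm b = 1" "\<And>b. b \<in> B \<Longrightarrow> \<exists>c. f b = c *\<^sub>R b"
      using less.hyps[OF dim _ sub inv] less.prems(4) unfolding S'_def by blast
    have orth: "b \<bullet> v = 0" if "b \<in> B" for b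
      using that B(2) span_base unfolding S'_def by blast
    show ?thesis
    proof (rule less.prems(1)[of "insert v B"])
      show "span (insert v B) = S"
      proof
        show "span (insert v B) \<subseteq> S"
          using v(1) B(2) less.prems(2) span_superset[of B]
          by (intro span_minimal) (auto simp: S'_def)
        show "S \<subseteq> span (insert v B)"
        proof
          fix x assume x: "x \<in> S"
          have "x - (x \<bullet> v) *\<^sub>R v \<in> S'"
            using x v less.prems(2) vv unfolding S'_def
            by (auto simp: inner_simps subspace_diff subspace_scale)
          then show "x \<in> span (insert v B)" unfolding span_breakdown_eq B(2)[symmetric] by blast
        qed
      qed
      show "pairwise orthogonal (insert v B)"
        using B(3) orth by (auto simp: pairwise_insert orthogonal_def inner_commute)
    qed (use B v in auto)
  qed
qed

lemma symmetric_matrix_inner: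
  fixes A :: "real ^ 'p ^ 'p"
  assumes "transpose A = A"
  shows "(A *v x) \<bullet> y = x \<bullet> (A *v y)"
  by (metis assms dot_lmul_matrix transpose_matrix_vector vector_transpose_matrix)

text \<open>
  Eigenvectors to distinct eigenvalues are orthogonal, hence independent. Finiteness is what makes
  \<open>Min\<close> meaningful in the definition of \<^const>\<open>min_eigenvalue\<close>.
\<close>

lemma finite_eigenvalues_symmetric:
  fixes A :: "real ^ 'p ^ 'p"
  assumes sym: "transpose A = A"
  shows "finite (eigenvalues A)"
proof -
  define e where "e c = (SOME v. v \<noteq> 0 \<and> A *v v = c *\<^sub>R v)" for c
  have e: "e c \<noteq> 0" "A *v e c = c *\<^sub>R e c" if "c \<in> eigenvalues A" for c
    using that someI_ex[of "\<lambda>v. v \<noteq> 0 \<and> A *v v = c *\<^sub>R v"] unfolding eigenvalues_def e_def by auto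
  have orth: "e c \<bullet> e d = 0" if "c \<in> eigenvalues A" "d \<in> eigenvalues A" "c \<noteq> d" for c d
    using symmetric_matrix_inner[OF sym, of "e c" "e d"] e[OF that(1)] e[OF that(2)] that(3)
    by auto
  have inj: "inj_on e (eigenvalues A)"
    using orth e(1) by (intro inj_onI) (metis inner_eq_zero_iff)
  have "pairwise orthogonal (e ` eigenvalues A)"
    using orth by (auto simp: pairwise_def orthogonal_def)
  moreover have "0 \<notin> e ` eigenvalues A" using e(1) by auto
  ultimately have "independent (e ` eigenvalues A)" by (rule pairwise_orthogonal_independent)
  then show ?thesis using inj finite_imageD independent_imp_finite by blast
qed

lemma min_eigenvalue_le_quadratic_form:
  fixes A :: "real ^ 'p ^ 'p"
  assumes sym: "transpose A = A"
  shows "min_eigenvalue A * (x \<bullet> x) \<le> x \<bullet> (A *v x)"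
proof -
  have ne: "(UNIV :: (real^'p) set) \<noteq> {0}"
    by (metis UNIV_I axis_eq_0_iff singletonD zero_neq_one)
  obtain v c where v: "norm v = 1" "A *v v = c *\<^sub>R v" "\<And>x. c * (x \<bullet> x) \<le> x \<bullet> (A *v x)"
    using self_adjoint_min_eigenvector[of "(*v) A" UNIV] ne symmetric_matrix_inner[OF sym] by auto
  have "v \<noteq> 0" using v(1) by auto
  then have "c \<in> eigenvalues A" using v(2) unfolding eigenvalues_def by blast
  then have "min_eigenvalue A \<le> c" using finite_eigenvalues_symmetric[OF sym] by (simp add: min_eigenvalue_def)
  then have "min_eigenvalue A * (x \<bullet> x) \<le> c * (x \<bullet> x)" by (intro mult_right_mono) auto
  then show ?thesis using v(3)[of x] by simp
qed

text \<open>
  The eigenbasis indexed by the coordinate type, so that it can be used as the columns of a matrix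
  and in products over all eigenvalues.
\<close>

lemma symmetric_matrix_eigenbasis:
  fixes A :: "real ^ 'p ^ 'p"
  assumes sym: "transpose A = A"
  obtains e :: "'p \<Rightarrow> real ^ 'p" and d :: "'p \<Rightarrow> real"
  where "\<And>i j. e i \<bullet> e j = (if i = j then 1 else 0)" "\<And>i. A *v e i = d i *\<^sub>R e i"
    "\<And>x. x = (\<Sum>i\<in>UNIV. (x \<bullet> e i) *\<^sub>R e i)"
proof -
  obtain B where B: "finite B" "span B = UNIV" "pairwise orthogonal B"
    "\<And>b. b \<in> B \<Longrightarrow> norm b = 1" "\<And>b. b \<in> B \<Longrightarrow> \<exists>c. A *v b = c *\<^sub>R b"
    using self_adjoint_orthonormal_eigenbasis[of "(*v) A" UNIV] symmetric_matrix_inner[OF sym] by auto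
  have "0 \<notin> B" using B(4) by force
  then have "independent B" using B(3) pairwise_orthogonal_independent by blast
  then have "card B = CARD('p)"
    using B(2) by (metis basis_card_eq_dim dim_UNIV DIM_cart DIM_real mult.right_neutral subset_UNIV)
  then obtain e :: "'p \<Rightarrow> real ^ 'p" where e: "bij_betw e UNIV B"
    using B(1) by (metis finite_class.finite_UNIV finite_same_card_bij)
  have eB: "e i \<in> B" for i using e by (auto simp: bij_betw_def)
  have ortho: "e i \<bullet> e j = (if i = j then 1 else 0)" for i j
  proof (cases "i = j")
    case True then show ?thesis using B(4)[OF eB[of i]] by (simp add: dot_square_norm)
  next
    case False
    then have "e i \<noteq> e j" using bij_betw_imp_inj_on[OF e] by (auto simp: inj_on_def)
    then show ?thesis using B(3) eB False by (auto simp: pairwise_def orthogonal_def)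
  qed
  have expand: "x = (\<Sum>i\<in>UNIV. (x \<bullet> e i) *\<^sub>R e i)" for x
    using orthonormal_basis_expand[OF B(3,4), of x] B(1,2)
      sum.reindex_bij_betw[OF e, of "\<lambda>b. (x \<bullet> b) *\<^sub>R b"] by simp
  define d where "d i = (SOME c. A *v e i = c *\<^sub>R e i)" for i
  have "A *v e i = d i *\<^sub>R e i" for i
    unfolding d_def by (rule someI_ex[OF B(5)[OF eB]])
  then show thesis using that ortho expand by blast
qed

lemma inner_matrix_eigenbasis:
  fixes A :: "real ^ 'p ^ 'p" and e :: "'p \<Rightarrow> real ^ 'p"
  assumes "\<And>i. A *v e i = d i *\<^sub>R e i" and "\<And>x. x = (\<Sum>i\<in>UNIV. (x \<bullet> e i) *\<^sub>R e i)"
  shows "x \<bullet> (A *v x) = (\<Sum>i\<in>UNIV. d i * (x \<bullet> e i)^2)" "x \<bullet> x = (\<Sum>i\<in>UNIV. (x \<bullet> e i)^2)"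
proof -
  have "A *v x = A *v (\<Sum>i\<in>UNIV. (x \<bullet> e i) *\<^sub>R e i)" using assms(2)[of x] by simp
  also have "\<dots> = (\<Sum>i\<in>UNIV. (x \<bullet> e i) *\<^sub>R (d i *\<^sub>R e i))"
    by (simp add: linear_sum[OF matrix_vector_mul_linear] matrix_vector_mult_scaleR assms(1))
  finally show "x \<bullet> (A *v x) = (\<Sum>i\<in>UNIV. d i * (x \<bullet> e i)^2)"
    by (simp add: inner_sum_right power2_eq_square algebra_simps)
  have "x \<bullet> x = x \<bullet> (\<Sum>i\<in>UNIV. (x \<bullet> e i) *\<^sub>R e i)" using assms(2)[of x] by simp
  then show "x \<bullet> x = (\<Sum>i\<in>UNIV. (x \<bullet> e i)^2)"
    by (simp add: inner_sum_right power2_eq_square algebra_simps)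
qed

lemma det_eigenbasis:
  fixes A :: "real ^ 'p ^ 'p" and e :: "'p \<Rightarrow> real ^ 'p"
  assumes ortho: "\<And>i j. e i \<bullet> e j = (if i = j then 1 else 0)" and eig: "\<And>i. A *v e i = d i *\<^sub>R e i"
  shows "det A = (\<Prod>i\<in>UNIV. d i)"
proof -
  define P :: "real ^ 'p ^ 'p" where "P = (\<chi> i j. e j $ i)"
  define D :: "real ^ 'p ^ 'p" where "D = (\<chi> i j. if i = j then d j else 0)"
  have "transpose P ** P = mat 1"
  proof -
    have "(\<Sum>k\<in>UNIV. e i $ k * e j $ k) = (if i = j then 1 else 0)" for i j
      using ortho[of i j] by (simp add: inner_vec_def)
    then show ?thesis by (simp add: vec_eq_iff P_def matrix_matrix_mult_def transpose_def mat_def)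
  qed
  then have "det P \<noteq> 0"
    by (metis det_I det_mul mult_eq_0_iff zero_neq_one)
  moreover have "A ** P = P ** D"
  proof -
    have "(A ** P) $ i $ j = (P ** D) $ i $ j" for i j
    proof -
      have "(A ** P) $ i $ j = (A *v e j) $ i"
        by (simp add: matrix_matrix_mult_def matrix_vector_mult_def P_def)
      also have "\<dots> = d j * e j $ i" by (simp add: eig)
      also have "\<dots> = (P ** D) $ i $ j"
        by (simp add: matrix_matrix_mult_def P_def D_def if_distrib[of "\<lambda>x. _ * x"] cong: if_cong)
      finally show ?thesis .
    qed
    then show ?thesis by (simp add: vec_eq_iff)
  qed
  then have "det A * det P = det P * det D" by (metis det_mul)
  moreover have "det D = (\<Prod>i\<in>UNIV. d i)"
    by (subst det_diagonal) (auto simp: D_def)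
  ultimately show ?thesis by simp
qed

text \<open>
  The determinant is the product of the eigenvalues. If all of them are at least \<open>c\<close>, each single
  one is at most \<open>det A\<close> divided by \<open>c\<close> to the number of the others.
\<close>

lemma quadratic_form_le_det_bound:
  fixes A :: "real ^ 'p ^ 'p"
  assumes sym: "transpose A = A" and lower: "\<And>x. c * (x \<bullet> x) \<le> x \<bullet> (A *v x)" and "0 < c"
  shows "x \<bullet> (A *v x) \<le> det A / c ^ (CARD('p) - 1) * (x \<bullet> x)"
proof -
  obtain e :: "'p \<Rightarrow> real ^ 'p" and d :: "'p \<Rightarrow> real" where ed: "\<And>i j. e i \<bullet> e j = (if i = j then 1 else 0)" "\<And>i. A *v e i = d i *\<^sub>R e i"
    "\<And>x. x = (\<Sum>i\<in>UNIV. (x \<bullet> e i) *\<^sub>R e i)"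
    using symmetric_matrix_eigenbasis[OF sym] by blast
  have c: "c \<le> d i" for i using lower[of "e i"] ed(1)[of i i] by (simp add: ed(2))
  have d: "d i \<le> det A / c ^ (CARD('p) - 1)" for i
  proof -
    have "d i * c ^ (CARD('p) - 1) = d i * (\<Prod>j\<in>UNIV - {i}. c)" by simp
    also have "\<dots> \<le> d i * (\<Prod>j\<in>UNIV - {i}. d j)"
      using c \<open>0 < c\<close> by (intro mult_left_mono prod_mono) (auto intro: order_trans[OF less_imp_le])
    also have "\<dots> = det A" unfolding det_eigenbasis[OF ed(1,2)]
      by (simp add: prod.remove[of UNIV i])
    finally show ?thesis using \<open>0 < c\<close> by (simp add: pos_le_divide_eq)
  qed
  have "x \<bullet> (A *v x) = (\<Sum>i\<in>UNIV. d i * (x \<bullet> e i)^2)" by (rule inner_matrix_eigenbasis(1)[OF ed(2,3)])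
  also have "\<dots> \<le> (\<Sum>i\<in>UNIV. det A / c ^ (CARD('p) - 1) * (x \<bullet> e i)^2)"
    by (intro sum_mono mult_right_mono d) auto
  also have "\<dots> = det A / c ^ (CARD('p) - 1) * (x \<bullet> x)"
    by (simp add: inner_matrix_eigenbasis(2)[OF ed(2,3)] sum_distrib_left)
  finally show ?thesis .
qed

lemma pos_definite_sqrt_exists:
  fixes A :: "real ^ 'p ^ 'p"
  assumes "pos_definite A"
  obtains B where "pos_definite B" "B ** B = A"
proof -
  have sym: "transpose A = A" and pos: "\<And>v. v \<noteq> 0 \<Longrightarrow> 0 < v \<bullet> (A *v v)"
    using assms by (auto simp: pos_definite_def)
  obtain e :: "'p \<Rightarrow> real ^ 'p" and d :: "'p \<Rightarrow> real" where ed: "\<And>i j. e i \<bullet> e j = (if i = j then 1 else 0)" "\<And>i. A *v e i = d i *\<^sub>R e i"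
    "\<And>x. x = (\<Sum>i\<in>UNIV. (x \<bullet> e i) *\<^sub>R e i)"
    using symmetric_matrix_eigenbasis[OF sym] by blast
  have d: "0 < d i" for i
    using pos[of "e i"] ed(1)[of i i] by (force simp: ed(2))
  define B where "B = matrix (\<lambda>x. \<Sum>i\<in>UNIV. (sqrt (d i) * (x \<bullet> e i)) *\<^sub>R e i)"
  have Bv: "B *v x = (\<Sum>i\<in>UNIV. (sqrt (d i) * (x \<bullet> e i)) *\<^sub>R e i)" for x
  proof -
    have "linear (\<lambda>x. \<Sum>i\<in>UNIV. (sqrt (d i) * (x \<bullet> e i)) *\<^sub>R e i)"
      by (rule linearI) (simp_all add: inner_simps algebra_simps sum.distrib scaleR_sum_right)
    then show ?thesis unfolding B_def by (simp add: matrix_works linear_def scalar_mult_eq_scaleR[abs_def] matrix_vector_mul(1)[symmetric])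
  qed
  have Be: "B *v e i = sqrt (d i) *\<^sub>R e i" for i
    by (simp add: Bv ed(1) if_distrib[of "\<lambda>x. _ * x"] if_distrib[of "\<lambda>x. x *\<^sub>R _"] cong: if_cong)
  have symB: "(B *v x) \<bullet> y = x \<bullet> (B *v y)" for x y
    by (simp add: Bv inner_sum_left inner_sum_right inner_commute mult_ac)
  have "transpose B = B"
    by (metis symB vector_eq_ldot matrix_eq dot_lmul_matrix transpose_matrix_vector vector_transpose_matrix)
  moreover have "0 < v \<bullet> (B *v v)" if "v \<noteq> 0" for v
  proof -
    have eq: "v \<bullet> (B *v v) = (\<Sum>i\<in>UNIV. sqrt (d i) * (v \<bullet> e i)^2)"
      by (rule inner_matrix_eigenbasis(1)[OF Be ed(3)])
    have "\<exists>i. v \<bullet> e i \<noteq> 0"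
    proof (rule ccontr)
      assume "\<not> ?thesis"
      then have "(\<Sum>i\<in>UNIV. (v \<bullet> e i) *\<^sub>R e i) = 0" by simp
      then show False using that ed(3)[of v] by simp
    qed
    then obtain i where "v \<bullet> e i \<noteq> 0" by blast
    then show ?thesis unfolding eq using d
      by (intro sum_pos2[of _ i]) (auto intro!: mult_nonneg_nonneg less_imp_le[OF d])
  qed
  moreover have "B ** B = A"
  proof -
    have "(B ** B) *v x = A *v x" for x
    proof -
      have "(B ** B) *v e i = A *v e i" for i
        using d[of i] by (simp add: matrix_vector_mul_assoc[symmetric] Be matrix_vector_mult_scaleR ed(2))
      then have "(B ** B) *v (\<Sum>i\<in>UNIV. (x \<bullet> e i) *\<^sub>R e i) = A *v (\<Sum>i\<in>UNIV. (x \<bullet> e i) *\<^sub>R e i)"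
        by (simp add: linear_sum[OF matrix_vector_mul_linear] matrix_vector_mult_scaleR)
      then show ?thesis using ed(3)[of x] by simp
    qed
    then show ?thesis by (simp add: matrix_eq)
  qed
  ultimately show thesis using that unfolding pos_definite_def by blast
qed

text \<open>
  Let \<open>e\<close> be an eigenvector of \<open>B - C\<close> with eigenvalue \<open>d\<close>. Since
  \<open>B\<^sup>2 - C\<^sup>2 = B (B - C) + (B - C) C\<close>, it follows that \<open>0 = d * (e \<bullet> B e + e \<bullet> C e)\<close>. The bracket is positive, so
  \<open>d = 0\<close>.
\<close>

lemma pos_definite_sqrt_unique:
  fixes B C :: "real ^ 'p ^ 'p"
  assumes B: "pos_definite B" and C: "pos_definite C" and eq: "B ** B = C ** C"
  shows "B = C"
proof -
  have symB: "transpose B = B" and symC: "transpose C = C"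
    using assms by (auto simp: pos_definite_def)
  then have "transpose (B - C) = B - C" by (simp add: transpose_def vec_eq_iff)
  then obtain e :: "'p \<Rightarrow> real ^ 'p" and d :: "'p \<Rightarrow> real" where ed: "\<And>i j. e i \<bullet> e j = (if i = j then 1 else 0)" "\<And>i. (B - C) *v e i = d i *\<^sub>R e i"
    "\<And>x. x = (\<Sum>i\<in>UNIV. (x \<bullet> e i) *\<^sub>R e i)"
    using symmetric_matrix_eigenbasis[of "B - C"] by blast
  have "d i = 0" for i
  proof -
    have Be: "B *v e i = C *v e i + d i *\<^sub>R e i"
      using ed(2)[of i] by (simp add: matrix_vector_mult_diff_rdistrib algebra_simps)
    have "e i \<bullet> (B *v (B *v e i)) = e i \<bullet> (C *v (C *v e i))"
      by (simp add: matrix_vector_mul_assoc eq)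
    moreover have "e i \<bullet> (B *v (B *v e i)) = e i \<bullet> (B *v (C *v e i)) + d i * (e i \<bullet> (B *v e i))"
      using arg_cong[OF Be, of "\<lambda>y. e i \<bullet> (B *v y)"]
      by (simp add: matrix_vector_right_distrib matrix_vector_mult_scaleR inner_simps)
    moreover have "e i \<bullet> (B *v (C *v e i)) = (B *v e i) \<bullet> (C *v e i)"
      by (rule symmetric_matrix_inner[OF symB, symmetric])
    moreover have "(B *v e i) \<bullet> (C *v e i) = e i \<bullet> (C *v (C *v e i)) + d i * (e i \<bullet> (C *v e i))"
      by (simp add: Be inner_simps symmetric_matrix_inner[OF symC])
    ultimately have "d i * (e i \<bullet> (B *v e i) + e i \<bullet> (C *v e i)) = 0"
      by (simp add: algebra_simps)
    moreover have "e i \<noteq> 0" using ed(1)[of i i] by auto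
    ultimately show ?thesis using B C unfolding pos_definite_def by (smt (verit) mult_eq_0_iff)
  qed
  then have "(B - C) *v (\<Sum>i\<in>UNIV. (x \<bullet> e i) *\<^sub>R e i) = 0" for x
    by (simp add: linear_sum[OF matrix_vector_mul_linear] matrix_vector_mult_scaleR ed(2))
  then have "(B - C) *v x = 0" for x using ed(3)[of x] by metis
  then show ?thesis
    by (metis eq_iff_diff_eq_0 matrix_eq matrix_vector_mult_0)
qed

text \<open>
  The square root \<open>B\<close> satisfies \<open>\<bar>B y\<bar>\<^sup>2 = y \<bullet> A y \<ge> c * \<bar>y\<bar>\<^sup>2\<close>; apply this to \<open>y = B\<^sup>-\<^sup>1 x\<close>.
\<close>

lemma norm_inv_sqrt_matrix_le:
  fixes A :: "real ^ 'p ^ 'p"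
  assumes A: "pos_definite A" and c: "0 < c" "c \<le> min_eigenvalue A"
  shows "norm (inv_sqrt_matrix A *v x) \<le> norm x / sqrt c"
proof -
  define B where "B = (THE B. pos_definite B \<and> B ** B = A)"
  obtain B' where "pos_definite B'" "B' ** B' = A" using pos_definite_sqrt_exists[OF A] .
  then have "\<exists>!B. pos_definite B \<and> B ** B = A" using pos_definite_sqrt_unique by metis
  from theI'[OF this] have B: "pos_definite B" "B ** B = A" unfolding B_def by auto
  have "inj ((*v) B)"
    using B(1) unfolding pos_definite_def
    by (intro linear_injective_0[THEN iffD2] matrix_vector_mul_linear) force
  then have "invertible B" by (metis matrix_left_invertible_injective invertible_left_inverse)
  then have "B ** matrix_inv B = mat 1"
    unfolding invertible_def matrix_inv_def by (rule someI2_ex) blast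
  then have inv: "B *v (matrix_inv B *v x) = x"
    by (simp add: matrix_vector_mul_assoc)
  define y where "y = matrix_inv B *v x"
  have "c * (norm y)^2 \<le> min_eigenvalue A * (y \<bullet> y)"
    using c by (simp add: power2_norm_eq_inner mult_right_mono)
  also have "\<dots> \<le> y \<bullet> (A *v y)"
    using A by (intro min_eigenvalue_le_quadratic_form) (simp add: pos_definite_def)
  also have "\<dots> = (B *v y) \<bullet> (B *v y)"
    using B by (simp add: symmetric_matrix_inner pos_definite_def matrix_vector_mul_assoc)
  also have "\<dots> = (norm x)^2" unfolding y_def inv by (simp add: power2_norm_eq_inner)
  finally have "(sqrt c * norm y)^2 \<le> (norm x)^2" using c by (simp add: power_mult_distrib)
  then have "sqrt c * norm y \<le> norm x" using norm_ge_zero power2_le_imp_le by blast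
  then show ?thesis using c
    by (simp add: inv_sqrt_matrix_def B_def[symmetric] y_def[symmetric] pos_le_divide_eq mult.commute)
qed

section \<open>Partial derivatives\<close>

lemma partial_eq_has_derivative:
  assumes "open U" "\<theta> \<in> U" "(h has_derivative h') (at \<theta>)"
  shows "partial U j h \<theta> = h' (axis j 1)"
  unfolding partial_def at_within_open[OF assms(2,1)] frechet_derivative_at[OF assms(3), symmetric] ..

lemma linear_eq_sum_axis:
  fixes h' :: "real ^ 'p \<Rightarrow> real"
  assumes "linear h'"
  shows "h' v = (\<Sum>j\<in>UNIV. v $ j * h' (axis j 1))"
proof -
  have "h' v = h' (\<Sum>j\<in>UNIV. v $ j *s axis j 1)" unfolding basis_expansion ..
  also have "\<dots> = (\<Sum>j\<in>UNIV. v $ j * h' (axis j 1))"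
    by (simp add: linear_sum[OF assms] linear_cmul[OF assms] scalar_mult_eq_scaleR)
  finally show ?thesis .
qed

lemma sum_axis_mult:
  fixes c :: "'p::finite \<Rightarrow> real"
  shows "(\<Sum>i\<in>UNIV. axis j 1 $ i * c i) = c j"
proof -
  have "axis j 1 $ i * c i = (if i = j then c i else 0)" for i by (simp add: axis_def)
  then show ?thesis by (simp only: sum.delta[OF finite] UNIV_I if_True)
qed

lemma has_derivative_partial:
  assumes "open U" "\<theta> \<in> U" "h differentiable_on U"
  shows "(h has_derivative (\<lambda>v. \<Sum>j\<in>UNIV. v $ j * partial U j h \<theta>)) (at \<theta>)"
proof -
  have "h differentiable (at \<theta>)" using differentiable_on_eq_differentiable_at[OF assms(1), of h] assms(2,3) by blast
  then have h': "(h has_derivative frechet_derivative h (at \<theta>)) (at \<theta>)"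
    by (simp only: frechet_derivative_works)
  have "(\<lambda>v. \<Sum>j\<in>UNIV. v $ j * partial U j h \<theta>) = frechet_derivative h (at \<theta>)"
    unfolding partial_eq_has_derivative[OF assms(1,2) h']
    by (rule ext) (rule linear_eq_sum_axis[OF has_derivative_linear[OF h'], symmetric])
  then show ?thesis using h' by (simp only:)
qed

lemma has_derivative_cong_open:
  assumes "open U" "\<theta> \<in> U" "\<And>\<eta>. \<eta> \<in> U \<Longrightarrow> h \<eta> = k \<eta>" "(h has_derivative h') (at \<theta>)"
  shows "(k has_derivative h') (at \<theta>)"
  using has_derivative_transform_within_open[OF assms(4,1,2)] assms(3) by auto

lemma partial_cong:
  fixes h k :: "real ^ 'p \<Rightarrow> real"
  assumes "open U" "\<theta> \<in> U" "\<And>\<eta>. \<eta> \<in> U \<Longrightarrow> h \<eta> = k \<eta>"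
  shows "partial U j h \<theta> = partial U j k \<theta>"
proof -
  have "(h has_derivative h') (at \<theta>) \<longleftrightarrow> (k has_derivative h') (at \<theta>)" for h'
    by (rule iffI; erule has_derivative_cong_open[OF assms(1,2), rotated]) (simp_all only: assms(3))
  then have "frechet_derivative h (at \<theta>) = frechet_derivative k (at \<theta>)"
    unfolding frechet_derivative_def by (simp only:)
  then show ?thesis unfolding partial_def at_within_open[OF assms(2,1)] by (simp only:)
qed

text \<open>
  Derivatives within the parameter set agree with those within any open part of it. This allows all
  calculus below to be done on an open ball about \<open>\<theta>g\<close>, where partial derivatives are unambiguous.
\<close>

lemma partial_open_subset:
  assumes "open U" "U \<subseteq> T" "\<theta> \<in> U"
  shows "partial T j h \<theta> = partial U j h \<theta>"
proof -
  have "at \<theta> within T = at \<theta>" 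
    using assms interiorI by (intro at_within_interior) blast
  then show ?thesis unfolding partial_def at_within_open[OF assms(3,1)] by (simp only:)
qed

lemma partial2_open_subset:
  assumes "open U" "U \<subseteq> T" "\<theta> \<in> U"
  shows "partial2 T j k h \<theta> = partial2 U j k h \<theta>"
  unfolding partial_open_subset[OF assms]
  by (rule partial_cong[OF assms(1,3)]) (rule partial_open_subset[OF assms(1,2)])

lemma partial3_open_subset:
  assumes "open U" "U \<subseteq> T" "\<theta> \<in> U"
  shows "partial3 T j k l h \<theta> = partial3 U j k l h \<theta>"
  unfolding partial_open_subset[OF assms]
  by (rule partial_cong[OF assms(1,3)]) (rule partial2_open_subset[OF assms(1,2)])

text \<open>
  The order is a parameter so that closure under products and powers follows by induction. Order three is \<^const>\<open>thrice_differentiable_on\<close>.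
\<close>

primrec times_differentiable_on :: "nat \<Rightarrow> (real ^ 'p \<Rightarrow> real) \<Rightarrow> (real ^ 'p) set \<Rightarrow> bool" where
  "times_differentiable_on 0 h U \<longleftrightarrow> True"
| "times_differentiable_on (Suc n) h U \<longleftrightarrow>
     h differentiable_on U \<and> (\<forall>j. times_differentiable_on n (partial U j h) U)"

lemma differentiable_on_cong_open:
  fixes h k :: "real ^ 'p \<Rightarrow> real"
  assumes "open U" "h differentiable_on U" "\<And>\<eta>. \<eta> \<in> U \<Longrightarrow> h \<eta> = k \<eta>"
  shows "k differentiable_on U"
  unfolding differentiable_on_eq_differentiable_at[OF assms(1)]
proof
  fix \<theta> assume \<theta>: "\<theta> \<in> U"
  then have "h differentiable (at \<theta>)"
    using assms(2) differentiable_on_eq_differentiable_at[OF assms(1)] by blast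
  then have "(h has_derivative frechet_derivative h (at \<theta>)) (at \<theta>)"
    by (simp only: frechet_derivative_works)
  from has_derivative_cong_open[OF assms(1) \<theta> assms(3) this]
  show "k differentiable (at \<theta>)" by (rule differentiableI)
qed

lemma times_differentiable_on_cong:
  assumes "open U" "times_differentiable_on n h U" "\<And>\<eta>. \<eta> \<in> U \<Longrightarrow> h \<eta> = k \<eta>"
  shows "times_differentiable_on n k U"
  using assms(2,3)
proof (induction n arbitrary: h k)
  case (Suc n)
  have h: "h differentiable_on U" "times_differentiable_on n (partial U j h) U" for j
    using Suc.prems(1) unfolding times_differentiable_on.simps(2) by blast+
  have "times_differentiable_on n (partial U j k) U" for j
    by (rule Suc.IH[OF h(2)]) (rule partial_cong[OF assms(1) _ Suc.prems(2)])
  moreover have "k differentiable_on U"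
    by (rule differentiable_on_cong_open[OF assms(1) h(1) Suc.prems(2)])
  ultimately show ?case unfolding times_differentiable_on.simps(2) by blast
qed simp

lemma times_differentiable_on_lower:
  "times_differentiable_on (Suc n) h U \<Longrightarrow> times_differentiable_on n h U"
proof (induction n arbitrary: h)
  case (Suc n)
  have "times_differentiable_on n (partial U j h) U" for j
    using Suc.prems unfolding times_differentiable_on.simps(2)[of "Suc n"] by (intro Suc.IH) blast
  then show ?case using Suc.prems unfolding times_differentiable_on.simps(2) by blast
qed simp

lemma thrice_differentiable_iff_times:
  "thrice_differentiable_on h U \<longleftrightarrow> times_differentiable_on 3 h U"
  by (auto simp: thrice_differentiable_on_def numeral_3_eq_3)

lemma times_differentiable_on_const:
  assumes "open U" shows "times_differentiable_on n (\<lambda>_. c) U"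
proof (induction n arbitrary: c)
  case (Suc n)
  have "0 = partial U j (\<lambda>_. c) \<theta>" if "\<theta> \<in> U" for j \<theta>
    using partial_eq_has_derivative[OF assms that has_derivative_const[of c], of j] by (rule sym)
  then have "times_differentiable_on n (partial U j (\<lambda>_. c)) U" for j
    by (intro times_differentiable_on_cong[OF assms Suc.IH[of 0]])
  then show ?case
    unfolding times_differentiable_on.simps(2) by (intro conjI differentiable_on_const allI)
qed simp

lemma partial_add:
  fixes h k :: "real ^ 'p \<Rightarrow> real"
  assumes "open U" "\<theta> \<in> U" "h differentiable_on U" "k differentiable_on U"
  shows "partial U j (\<lambda>\<theta>. h \<theta> + k \<theta>) \<theta> = partial U j h \<theta> + partial U j k \<theta>"
  using partial_eq_has_derivative[OF assms(1,2) has_derivative_add[OF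
      has_derivative_partial[OF assms(1,2,3)] has_derivative_partial[OF assms(1,2,4)]], of j]
  unfolding sum_axis_mult .

lemma partial_mult:
  fixes h k :: "real ^ 'p \<Rightarrow> real"
  assumes "open U" "\<theta> \<in> U" "h differentiable_on U" "k differentiable_on U"
  shows "partial U j (\<lambda>\<theta>. h \<theta> * k \<theta>) \<theta> = h \<theta> * partial U j k \<theta> + partial U j h \<theta> * k \<theta>"
  using partial_eq_has_derivative[OF assms(1,2) has_derivative_mult[OF
      has_derivative_partial[OF assms(1,2,3)] has_derivative_partial[OF assms(1,2,4)]], of j]
  unfolding sum_axis_mult .

lemma partial_cmult:
  fixes h :: "real ^ 'p \<Rightarrow> real"
  assumes "open U" "\<theta> \<in> U" "h differentiable_on U"
  shows "partial U j (\<lambda>\<theta>. c * h \<theta>) \<theta> = c * partial U j h \<theta>"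
  using partial_eq_has_derivative[OF assms(1,2) has_derivative_mult_right[OF
      has_derivative_partial[OF assms(1,2,3)]], of j]
  unfolding sum_axis_mult .

lemma times_differentiable_on_add:
  assumes "open U" "times_differentiable_on n h U" "times_differentiable_on n k U"
  shows "times_differentiable_on n (\<lambda>\<theta>. h \<theta> + k \<theta>) U"
  using assms(2,3)
proof (induction n arbitrary: h k)
  case (Suc n)
  have hk: "h differentiable_on U" "k differentiable_on U" using Suc.prems by auto
  have "partial U j h \<theta> + partial U j k \<theta> = partial U j (\<lambda>\<theta>. h \<theta> + k \<theta>) \<theta>" if "\<theta> \<in> U" for j \<theta>
    by (rule partial_add[OF assms(1) that hk, symmetric])
  moreover have "times_differentiable_on n (\<lambda>\<theta>. partial U j h \<theta> + partial U j k \<theta>) U" for j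
    using Suc.prems unfolding times_differentiable_on.simps(2) by (intro Suc.IH) blast+
  ultimately have "times_differentiable_on n (partial U j (\<lambda>\<theta>. h \<theta> + k \<theta>)) U" for j
    using times_differentiable_on_cong[OF assms(1)] by blast
  then show ?case using hk by (simp add: differentiable_on_def differentiable_add)
qed simp

lemma times_differentiable_on_mult:
  assumes "open U" "times_differentiable_on n h U" "times_differentiable_on n k U"
  shows "times_differentiable_on n (\<lambda>\<theta>. h \<theta> * k \<theta>) U"
  using assms(2,3)
proof (induction n arbitrary: h k)
  case (Suc n)
  have hk: "h differentiable_on U" "k differentiable_on U" using Suc.prems by auto
  have "h \<theta> * partial U j k \<theta> + partial U j h \<theta> * k \<theta> = partial U j (\<lambda>\<theta>. h \<theta> * k \<theta>) \<theta>" if "\<theta> \<in> U" for j \<theta>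
    by (rule partial_mult[OF assms(1) that hk, symmetric])
  moreover have "times_differentiable_on n (\<lambda>\<theta>. h \<theta> * partial U j k \<theta> + partial U j h \<theta> * k \<theta>) U" for j
    using Suc.prems Suc.prems[THEN times_differentiable_on_lower] unfolding times_differentiable_on.simps(2)
    by (intro times_differentiable_on_add[OF assms(1)] Suc.IH) blast+
  ultimately have "times_differentiable_on n (partial U j (\<lambda>\<theta>. h \<theta> * k \<theta>)) U" for j
    using times_differentiable_on_cong[OF assms(1)] by blast
  then show ?case using hk by (simp add: differentiable_on_def differentiable_mult)
qed simp

text \<open>
  The exponent is universally quantified in the induction because differentiating lowers it by one.
\<close>

lemma times_differentiable_on_powr:
  assumes "open U" "times_differentiable_on n h U" "\<And>\<theta>. \<theta> \<in> U \<Longrightarrow> 0 < h \<theta>"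
  shows "times_differentiable_on n (\<lambda>\<theta>. h \<theta> powr a) U"
  using assms(2)
proof (induction n arbitrary: a)
  case (Suc n)
  have hk: "h differentiable_on U" using Suc.prems by auto
  have D: "((\<lambda>\<theta>. h \<theta> powr a) has_derivative
       (\<lambda>v. (\<Sum>j\<in>UNIV. v $ j * partial U j h \<theta>) * (a * h \<theta> powr (a - 1)))) (at \<theta>)" if "\<theta> \<in> U" for \<theta>
    using DERIV_compose_FDERIV[OF has_real_derivative_powr has_derivative_partial[OF assms(1) that hk]]
      assms(3)[OF that] by auto
  have "(a * h \<theta> powr (a - 1)) * partial U j h \<theta> = partial U j (\<lambda>\<theta>. h \<theta> powr a) \<theta>" if "\<theta> \<in> U" for j \<theta>
    using partial_eq_has_derivative[OF assms(1) that D[OF that], of j]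
    unfolding sum_axis_mult by (simp only: mult.commute)
  moreover have "times_differentiable_on n (\<lambda>\<theta>. (a * h \<theta> powr (a - 1)) * partial U j h \<theta>) U" for j
    using Suc.prems times_differentiable_on_lower[OF Suc.prems] unfolding times_differentiable_on.simps(2)
    by (intro times_differentiable_on_mult[OF assms(1)] times_differentiable_on_const[OF assms(1)] Suc.IH) blast+
  ultimately have "times_differentiable_on n (partial U j (\<lambda>\<theta>. h \<theta> powr a)) U" for j
    using times_differentiable_on_cong[OF assms(1)] by blast
  moreover have "(\<lambda>\<theta>. h \<theta> powr a) differentiable_on U"
    unfolding differentiable_on_eq_differentiable_at[OF assms(1)] differentiable_def using D by blast
  ultimately show ?case by simp
qed simp

lemma times_differentiable_on_open_subset:
  assumes "open U" "U \<subseteq> T" "times_differentiable_on n h T"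
  shows "times_differentiable_on n h U"
  using assms(3)
proof (induction n arbitrary: h)
  case (Suc n)
  have h: "h differentiable_on T" "times_differentiable_on n (partial T j h) T" for j
    using Suc.prems unfolding times_differentiable_on.simps(2) by blast+
  have "times_differentiable_on n (partial U j h) U" for j
    by (rule times_differentiable_on_cong[OF assms(1) Suc.IH[OF h(2)] partial_open_subset[OF assms(1,2)]])
  then show ?case
    unfolding times_differentiable_on.simps(2) using differentiable_on_subset[OF h(1) assms(2)] by blast
qed simp

text \<open>
  Two applications of the mean value theorem, first in direction \<open>j\<close> and then in direction \<open>k\<close>. The
  left-hand side is symmetric in the two directions, which is the source of the symmetry of the Hessian.
\<close>

lemma second_difference_mean_value:
  fixes h :: "real ^ 'p \<Rightarrow> real"
  assumes "open U" and h: "h differentiable_on U" "partial U j h differentiable_on U" and s: "0 < s"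
    and sub: "\<And>a b. 0 \<le> a \<Longrightarrow> a \<le> s \<Longrightarrow> 0 \<le> b \<Longrightarrow> b \<le> s \<Longrightarrow> \<theta> + a *\<^sub>R axis j 1 + b *\<^sub>R axis k 1 \<in> U"
  shows "\<exists>a b. 0 \<le> a \<and> a \<le> s \<and> 0 \<le> b \<and> b \<le> s \<and>
    h (\<theta> + s *\<^sub>R axis j 1 + s *\<^sub>R axis k 1) - h (\<theta> + s *\<^sub>R axis j 1) - h (\<theta> + s *\<^sub>R axis k 1) + h \<theta>
      = s * s * partial2 U k j h (\<theta> + a *\<^sub>R axis j 1 + b *\<^sub>R axis k 1)"
proof -
  have line: "((\<lambda>t. q (p + t *\<^sub>R axis i 1)) has_real_derivative partial U i q (p + t *\<^sub>R axis i 1)) (at t)"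
    if "q differentiable_on U" "p + t *\<^sub>R axis i 1 \<in> U" for q :: "real ^ 'p \<Rightarrow> real" and p t i
  proof -
    have "((\<lambda>t. p + t *\<^sub>R axis i 1) has_derivative (\<lambda>t. t *\<^sub>R axis i 1)) (at t)"
      by (auto intro!: derivative_eq_intros)
    from has_derivative_compose[OF this has_derivative_partial[OF assms(1) that(2,1)]]
    show ?thesis unfolding has_field_derivative_def
      by (rule has_derivative_eq_rhs)
        (simp add: mult.assoc sum_distrib_left[symmetric] sum_axis_mult mult.commute[of _ "partial U i q _"])
  qed
  define \<phi> where "\<phi> a = h ((\<theta> + s *\<^sub>R axis k 1) + a *\<^sub>R axis j 1) - h (\<theta> + a *\<^sub>R axis j 1)" for a
  have mem1: "(\<theta> + s *\<^sub>R axis k 1) + a *\<^sub>R axis j 1 \<in> U" "\<theta> + a *\<^sub>R axis j 1 \<in> U" if "0 \<le> a" "a \<le> s" for a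
    using sub[of a s] sub[of a 0] that s by (auto simp: algebra_simps)
  have "(\<phi> has_real_derivative partial U j h ((\<theta> + s *\<^sub>R axis k 1) + a *\<^sub>R axis j 1)
           - partial U j h (\<theta> + a *\<^sub>R axis j 1)) (at a)" if "0 \<le> a" "a \<le> s" for a
    unfolding \<phi>_def by (intro DERIV_diff line h mem1 that)
  from MVT2[OF s this] obtain a where a: "0 < a" "a < s"
    "\<phi> s - \<phi> 0 = s * (partial U j h ((\<theta> + s *\<^sub>R axis k 1) + a *\<^sub>R axis j 1) - partial U j h (\<theta> + a *\<^sub>R axis j 1))"
    by auto
  have mem2: "(\<theta> + a *\<^sub>R axis j 1) + b *\<^sub>R axis k 1 \<in> U" if "0 \<le> b" "b \<le> s" for b
    using sub[of a b] that a by auto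
  have "((\<lambda>b. partial U j h ((\<theta> + a *\<^sub>R axis j 1) + b *\<^sub>R axis k 1)) has_real_derivative
      partial2 U k j h ((\<theta> + a *\<^sub>R axis j 1) + b *\<^sub>R axis k 1)) (at b)" if "0 \<le> b" "b \<le> s" for b
    by (intro line h mem2 that)
  from MVT2[OF s this] obtain b where b: "0 < b" "b < s"
    "partial U j h ((\<theta> + a *\<^sub>R axis j 1) + s *\<^sub>R axis k 1) - partial U j h (\<theta> + a *\<^sub>R axis j 1)
      = s * partial2 U k j h ((\<theta> + a *\<^sub>R axis j 1) + b *\<^sub>R axis k 1)" by auto
  have "\<phi> s - \<phi> 0 = s * s * partial2 U k j h (\<theta> + a *\<^sub>R axis j 1 + b *\<^sub>R axis k 1)"
    using a(3) b(3) by (simp add: algebra_simps)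
  then show ?thesis using a b by (intro exI[of _ a] exI[of _ b]) (simp add: \<phi>_def algebra_simps)
qed

lemma partial2_symmetric:
  fixes h :: "real ^ 'p \<Rightarrow> real"
  assumes U: "open U" "\<theta> \<in> U" and h: "thrice_differentiable_on h U"
  shows "partial2 U j k h \<theta> = partial2 U k j h \<theta>"
proof -
  have d1: "h differentiable_on U" "\<And>j. partial U j h differentiable_on U"
    and d2: "\<And>j k. isCont (partial2 U j k h) \<theta>"
    using h U unfolding thrice_differentiable_on_def
    by (auto intro: differentiable_imp_continuous_within simp: differentiable_on_eq_differentiable_at)
  have "\<bar>partial2 U j k h \<theta> - partial2 U k j h \<theta>\<bar> \<le> e" if e: "e > 0" for e
  proof -
    obtain r where r: "r > 0" "ball \<theta> r \<subseteq> U" using U openE by blast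
    obtain d where d: "d > 0" "\<And>\<eta>. dist \<eta> \<theta> < d \<Longrightarrow> \<bar>partial2 U j k h \<eta> - partial2 U j k h \<theta>\<bar> < e / 2"
      using d2[of j k, unfolded continuous_at_eps_delta dist_real_def, rule_format, of "e / 2"] e by auto
    obtain d' where d': "d' > 0" "\<And>\<eta>. dist \<eta> \<theta> < d' \<Longrightarrow> \<bar>partial2 U k j h \<eta> - partial2 U k j h \<theta>\<bar> < e / 2"
      using d2[of k j, unfolded continuous_at_eps_delta dist_real_def, rule_format, of "e / 2"] e by auto
    define s where "s = min r (min d d') / 3"
    have s: "s > 0" using r d d' by (simp add: s_def)
    have near: "dist (\<theta> + a *\<^sub>R axis i 1 + b *\<^sub>R axis l 1) \<theta> < min r (min d d')"
      if "0 \<le> a" "a \<le> s" "0 \<le> b" "b \<le> s" for a b and i l :: 'p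
    proof -
      have "dist (\<theta> + a *\<^sub>R axis i 1 + b *\<^sub>R axis l 1) \<theta> = norm (a *\<^sub>R axis i 1 + b *\<^sub>R axis l (1::real))"
        by (simp add: dist_norm algebra_simps)
      also have "\<dots> \<le> norm (a *\<^sub>R axis i (1::real)) + norm (b *\<^sub>R axis l (1::real))" by (rule norm_triangle_ineq)
      also have "\<dots> = a + b" using that by simp
      also have "\<dots> < min r (min d d')" using that s by (simp add: s_def)
      finally show ?thesis .
    qed
    have mem: "\<theta> + a *\<^sub>R axis i 1 + b *\<^sub>R axis l 1 \<in> U"
      if "0 \<le> a" "a \<le> s" "0 \<le> b" "b \<le> s" for a b and i l :: 'p
      using near[OF that, of i l] r(2) by (auto simp: dist_commute)
    obtain a b where ab: "0 \<le> a" "a \<le> s" "0 \<le> b" "b \<le> s"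
      "h (\<theta> + s *\<^sub>R axis j 1 + s *\<^sub>R axis k 1) - h (\<theta> + s *\<^sub>R axis j 1) - h (\<theta> + s *\<^sub>R axis k 1) + h \<theta>
      = s * s * partial2 U k j h (\<theta> + a *\<^sub>R axis j 1 + b *\<^sub>R axis k 1)"
      using second_difference_mean_value[OF U(1) d1 s mem] by blast
    obtain a' b' where ab': "0 \<le> a'" "a' \<le> s" "0 \<le> b'" "b' \<le> s"
      "h (\<theta> + s *\<^sub>R axis k 1 + s *\<^sub>R axis j 1) - h (\<theta> + s *\<^sub>R axis k 1) - h (\<theta> + s *\<^sub>R axis j 1) + h \<theta>
      = s * s * partial2 U j k h (\<theta> + a' *\<^sub>R axis k 1 + b' *\<^sub>R axis j 1)"
      using second_difference_mean_value[OF U(1) d1 s mem] by blast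
    have "s * s * partial2 U k j h (\<theta> + a *\<^sub>R axis j 1 + b *\<^sub>R axis k 1)
        = s * s * partial2 U j k h (\<theta> + a' *\<^sub>R axis k 1 + b' *\<^sub>R axis j 1)"
    proof -
      have eq: "\<theta> + s *\<^sub>R axis k 1 + s *\<^sub>R axis j 1 = \<theta> + s *\<^sub>R axis j 1 + s *\<^sub>R axis k (1::real)"
        by (simp add: algebra_simps)
      show ?thesis using ab(5) ab'(5)[unfolded eq] by linarith
    qed
    with s have "partial2 U k j h (\<theta> + a *\<^sub>R axis j 1 + b *\<^sub>R axis k 1)
        = partial2 U j k h (\<theta> + a' *\<^sub>R axis k 1 + b' *\<^sub>R axis j 1)" by simp
    moreover have "\<bar>partial2 U k j h (\<theta> + a *\<^sub>R axis j 1 + b *\<^sub>R axis k 1) - partial2 U k j h \<theta>\<bar> < e / 2"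
      using near[OF ab(1-4), of j k] d'(2) by simp
    moreover have "\<bar>partial2 U j k h (\<theta> + a' *\<^sub>R axis k 1 + b' *\<^sub>R axis j 1) - partial2 U j k h \<theta>\<bar> < e / 2"
      using near[OF ab'(1-4), of k j] d(2) by simp
    ultimately show ?thesis by linarith
  qed
  then have "\<bar>partial2 U j k h \<theta> - partial2 U k j h \<theta>\<bar> \<le> 0" by (rule field_le_epsilon) simp
  then show ?thesis by simp
qed

text \<open>
  The gradient \<open>G\<close> and the Hessian \<open>H\<close> are arbitrary functions here, so that the lemma applies to
  sums over the observations without rewriting their partial derivatives.
\<close>

lemma taylor2_convex:
  fixes Q :: "real ^ 'p \<Rightarrow> real"
  assumes U: "convex U" "a \<in> U" "b \<in> U"
    and Q: "\<And>\<theta>. \<theta> \<in> U \<Longrightarrow> (Q has_derivative (\<lambda>v. \<Sum>k\<in>UNIV. v $ k * G k \<theta>)) (at \<theta>)"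
    and G: "\<And>k \<theta>. \<theta> \<in> U \<Longrightarrow> (G k has_derivative (\<lambda>v. \<Sum>j\<in>UNIV. v $ j * H j k \<theta>)) (at \<theta>)"
  shows "\<exists>\<xi>\<in>U. Q b = Q a + (\<Sum>k\<in>UNIV. (b - a) $ k * G k a)
     + (\<Sum>k\<in>UNIV. \<Sum>j\<in>UNIV. (b - a) $ k * (b - a) $ j * H j k \<xi>) / 2"
proof -
  define v where "v = b - a"
  have mem: "a + t *\<^sub>R v \<in> U" if "0 \<le> t" "t \<le> 1" for t
  proof -
    have "(1 - t) *\<^sub>R a + t *\<^sub>R b \<in> U" using U that by (intro convexD) auto
    then show ?thesis by (simp add: v_def algebra_simps)
  qed
  have path: "((\<lambda>t. a + t *\<^sub>R v) has_derivative (\<lambda>t. t *\<^sub>R v)) (at t)" for t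
    by (auto intro!: derivative_eq_intros)
  define diff where "diff m t = (if m = 0 then Q (a + t *\<^sub>R v)
     else if m = 1 then (\<Sum>k\<in>UNIV. v $ k * G k (a + t *\<^sub>R v))
     else (\<Sum>k\<in>UNIV. v $ k * (\<Sum>j\<in>UNIV. v $ j * H j k (a + t *\<^sub>R v))))" for m :: nat and t
  have D: "DERIV (diff m) t :> diff (Suc m) t" if "m < 2" "0 \<le> t" "t \<le> 1" for m t
  proof (cases "m = 0")
    case True
    have "((\<lambda>t. Q (a + t *\<^sub>R v)) has_real_derivative (\<Sum>k\<in>UNIV. v $ k * G k (a + t *\<^sub>R v))) (at t)"
      unfolding has_field_derivative_def
      using has_derivative_compose[OF path Q[OF mem[OF that(2,3)]]]
      by (rule has_derivative_eq_rhs) (auto simp: sum_distrib_left sum_distrib_right mult_ac)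
    then show ?thesis using True by (simp add: diff_def[abs_def])
  next
    case False
    then have m: "m = 1" using that by simp
    have "((\<lambda>t. G k (a + t *\<^sub>R v)) has_real_derivative (\<Sum>j\<in>UNIV. v $ j * H j k (a + t *\<^sub>R v))) (at t)" for k
      unfolding has_field_derivative_def
      using has_derivative_compose[OF path G[OF mem[OF that(2,3)]]]
      by (rule has_derivative_eq_rhs) (auto simp: sum_distrib_left sum_distrib_right mult_ac)
    then have "((\<lambda>t. \<Sum>k\<in>UNIV. v $ k * G k (a + t *\<^sub>R v)) has_real_derivative
       (\<Sum>k\<in>UNIV. v $ k * (\<Sum>j\<in>UNIV. v $ j * H j k (a + t *\<^sub>R v)))) (at t)"
      by (intro DERIV_sum DERIV_cmult)
    then show ?thesis using m by (simp add: diff_def[abs_def])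
  qed
  obtain t where t: "0 < t" "t < 1" "diff 0 1 = (\<Sum>m<2. diff m 0 / fact m * 1 ^ m) + diff 2 t / fact 2 * 1 ^ 2"
    using Maclaurin[of 1 2 diff "diff 0"] D by auto
  have "Q b = Q a + (\<Sum>k\<in>UNIV. v $ k * G k a) + (\<Sum>k\<in>UNIV. \<Sum>j\<in>UNIV. v $ k * v $ j * H j k (a + t *\<^sub>R v)) / 2"
    using t(3) by (simp add: diff_def numeral_2_eq_2 v_def sum_distrib_left mult_ac)
  then show ?thesis using mem[of t] t unfolding v_def by (intro bexI[of _ "a + t *\<^sub>R (b - a)"]) auto
qed

lemma bounded_gradient_lipschitz:
  fixes h :: "real ^ 'p \<Rightarrow> real"
  assumes U: "convex U" "a \<in> U" "b \<in> U"
    and h: "\<And>\<theta>. \<theta> \<in> U \<Longrightarrow> (h has_derivative (\<lambda>v. \<Sum>j\<in>UNIV. v $ j * K j \<theta>)) (at \<theta>)"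
    and K: "\<And>j \<theta>. \<theta> \<in> U \<Longrightarrow> \<bar>K j \<theta>\<bar> \<le> C j"
  shows "\<bar>h b - h a\<bar> \<le> (\<Sum>j\<in>UNIV. C j) * norm (b - a)"
proof -
  have "norm (h b - h a) \<le> (\<Sum>j\<in>UNIV. C j) * norm (b - a)"
  proof (rule differentiable_bound[OF U(1) _ _ U(3,2)])
    fix \<theta> assume \<theta>: "\<theta> \<in> U"
    show "(h has_derivative (\<lambda>v. \<Sum>j\<in>UNIV. v $ j * K j \<theta>)) (at \<theta> within U)"
      using h[OF \<theta>] has_derivative_at_withinI by blast
    show "onorm (\<lambda>v. \<Sum>j\<in>UNIV. v $ j * K j \<theta>) \<le> (\<Sum>j\<in>UNIV. C j)"
    proof (rule onorm_le)
      fix v :: "real ^ 'p"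
      have "norm (\<Sum>j\<in>UNIV. v $ j * K j \<theta>) \<le> (\<Sum>j\<in>UNIV. norm v * C j)"
        by (rule sum_norm_le) (auto simp: abs_mult intro!: mult_mono K[OF \<theta>] component_le_norm_cart)
      then show "norm (\<Sum>j\<in>UNIV. v $ j * K j \<theta>) \<le> (\<Sum>j\<in>UNIV. C j) * norm v"
        by (simp add: sum_distrib_left mult.commute)
    qed
  qed
  then show ?thesis by simp
qed

section \<open>Gaussian bounds for posterior means\<close>

text \<open>
  The integrand is a product of one-dimensional Gaussian densities.
\<close>

lemma integrable_exp_neg_norm_square:
  assumes "0 < a"
  shows "integrable lborel (\<lambda>u :: 'e::euclidean_space. exp (- a * (norm u)^2))"
proof (rule integrableI_nonneg)
  have one: "integrable lborel (\<lambda>x :: real. exp (- a * x^2))"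
  proof -
    define \<sigma> where "\<sigma> = sqrt (1 / (2 * a))"
    have "2 * \<sigma>^2 = 1 / a" "\<sigma> > 0" using assms by (simp_all add: \<sigma>_def)
    then have "exp (- a * x^2) = sqrt (2 * pi * \<sigma>^2) * normal_density 0 \<sigma> x" for x
      using assms by (simp add: normal_density_def field_simps)
    moreover have "integrable lborel (\<lambda>x. sqrt (2 * pi * \<sigma>^2) * normal_density 0 \<sigma> x)"
      using \<open>\<sigma> > 0\<close> by (intro integrable_mult_right integrable_normal_density)
    ultimately show ?thesis by simp
  qed
  have "(\<integral>\<^sup>+u. ennreal (exp (- a * (norm (u::'e))^2)) \<partial>lborel)
     = (\<integral>\<^sup>+u. (\<Prod>b\<in>Basis. ennreal (exp (- a * ((u::'e) \<bullet> b)^2))) \<partial>lborel)"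
  proof (rule nn_integral_cong)
    fix u :: 'e
    have "(norm u)^2 = (\<Sum>b\<in>Basis. (u \<bullet> b)^2)"
      unfolding power2_norm_eq_inner euclidean_inner[of u u] by (simp only: power2_eq_square)
    then show "ennreal (exp (- a * (norm u)^2)) = (\<Prod>b\<in>Basis. ennreal (exp (- a * (u \<bullet> b)^2)))"
      by (simp add: prod_ennreal exp_sum[symmetric] sum_distrib_left sum_negf)
  qed
  also have "\<dots> = (\<Prod>b\<in>(Basis::'e set). \<integral>\<^sup>+x. ennreal (exp (- a * x^2)) \<partial>lborel)"
    by (rule nn_integral_lborel_prod) auto
  also have "\<dots> < \<infinity>"
  proof -
    have "(\<integral>\<^sup>+x. ennreal (exp (- a * x^2)) \<partial>lborel) = ennreal (\<integral>x. exp (- a * x^2) \<partial>lborel)"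
      by (rule nn_integral_eq_integral[OF one]) auto
    then show ?thesis by (simp add: ennreal_power power_less_top_ennreal)
  qed
  finally show "(\<integral>\<^sup>+u. ennreal (exp (- a * (norm (u::'e))^2)) \<partial>lborel) < \<infinity>" .
qed auto

text \<open>
  A Gaussian factor with the polynomial \<open>(1 + \<bar>u\<bar>\<^sup>2)\<^sup>2\<close>, which dominates both \<open>\<bar>u\<bar>\<close> and \<open>\<bar>u\<bar>\<^sup>3\<close>, the two
  powers that arise in the first-moment estimate.
\<close>

definition gauss_weight :: "real \<Rightarrow> 'e::euclidean_space \<Rightarrow> real" where
  "gauss_weight a u = (1 + (norm u)^2)^2 * exp (- a * (norm u)^2)"

lemma gauss_weight_nonneg: "0 \<le> gauss_weight a u"
  by (simp add: gauss_weight_def)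

lemma borel_measurable_gauss_weight [measurable]: "gauss_weight a \<in> borel_measurable borel"
  unfolding gauss_weight_def[abs_def] by measurable

lemma integrable_gauss_weight:
  assumes "0 < a"
  shows "integrable lborel (gauss_weight a :: 'e::euclidean_space \<Rightarrow> real)"
proof (rule Bochner_Integration.integrable_bound)
  show "integrable lborel (\<lambda>u::'e. ((4 / a)^2 * exp (a / 2)) * exp (- (a / 2) * (norm u)^2))"
    using integrable_exp_neg_norm_square[of "a / 2"] assms by simp
  show "AE u::'e in lborel. norm (gauss_weight a u)
      \<le> norm (((4 / a)^2 * exp (a / 2)) * exp (- (a / 2) * (norm u)^2))"
  proof (rule AE_I2)
    fix u :: 'e
    define t where "t = (norm u)^2"
    have t: "0 \<le> t" by (simp add: t_def)
    \<comment> \<open>Half of the Gaussian decay absorbs the polynomial factor.\<close>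
    have "a / 4 * (1 + t) \<le> exp (a / 4 * (1 + t))"
      using exp_ge_add_one_self[of "a / 4 * (1 + t)"] by linarith
    then have "1 + t \<le> 4 / a * exp (a / 4 * (1 + t))" using assms by (simp add: field_simps)
    then have "(1 + t)^2 \<le> (4 / a * exp (a / 4 * (1 + t)))^2" using t by (intro power_mono) auto
    also have "\<dots> = (4 / a)^2 * exp (a / 2 * (1 + t))"
      by (simp add: power_mult_distrib exp_double[symmetric] power_divide)
    finally have "(1 + t)^2 * exp (- a * t) \<le> (4 / a)^2 * exp (a / 2 * (1 + t)) * exp (- a * t)"
      by (intro mult_right_mono) auto
    also have "\<dots> = ((4 / a)^2 * exp (a / 2)) * exp (- (a / 2) * t)"
    proof -
      have "exp (a / 2 * (1 + t)) * exp (- a * t) = exp (a / 2) * exp (- (a / 2) * t)"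
        unfolding mult_exp_exp by (rule arg_cong[of _ _ exp]) (simp add: field_simps)
      then show ?thesis by (simp only: mult.assoc)
    qed
    finally show "norm (gauss_weight a u) \<le> norm (((4 / a)^2 * exp (a / 2)) * exp (- (a / 2) * (norm u)^2))"
      using t by (simp add: gauss_weight_def t_def[symmetric] abs_mult)
  qed
qed simp

lemma integral_lborel_affine:
  fixes F :: "'e::euclidean_space \<Rightarrow> 'b::{banach, second_countable_topology}"
  assumes [measurable]: "F \<in> borel_measurable borel" and c: "c \<noteq> 0"
  shows "(\<integral>x. F x \<partial>lborel) = \<bar>c\<bar> ^ DIM('e) *\<^sub>R (\<integral>x. F (t + c *\<^sub>R x) \<partial>lborel)"
proof -
  have "(\<integral>x. F x \<partial>lborel)
      = (\<integral>x. F x \<partial>density (distr lborel borel (\<lambda>x::'e. t + c *\<^sub>R x)) (\<lambda>_. ennreal (\<bar>c\<bar>^DIM('e))))"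
    by (subst lborel_affine[OF c, of t]) (simp add: ennreal_power)
  also have "\<dots> = (\<integral>x. \<bar>c\<bar>^DIM('e) *\<^sub>R F x \<partial>distr lborel borel (\<lambda>x::'e. t + c *\<^sub>R x))"
    by (subst integral_density) auto
  also have "\<dots> = (\<integral>x. \<bar>c\<bar>^DIM('e) *\<^sub>R F (t + c *\<^sub>R x) \<partial>lborel)"
    by (subst integral_distr) auto
  finally show ?thesis by simp
qed

lemma integral_odd_about:
  fixes F :: "'e::euclidean_space \<Rightarrow> 'b::{banach, second_countable_topology}"
  assumes [measurable]: "F \<in> borel_measurable borel" and odd: "\<And>x. F (2 *\<^sub>R a - x) = - F x"
  shows "(\<integral>x. F x \<partial>lborel) = 0"
proof -
  have "(\<integral>x. F x \<partial>lborel) = (\<integral>x. F (2 *\<^sub>R a + (-1) *\<^sub>R x) \<partial>lborel)"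
    using integral_lborel_affine[OF assms(1), of "-1" "2 *\<^sub>R a"] by simp
  also have "\<dots> = - (\<integral>x. F x \<partial>lborel)" using odd by simp
  finally have "(\<integral>x. F x \<partial>lborel) + (\<integral>x. F x \<partial>lborel) = 0" by (simp only: add.left_inverse eq_neg_iff_add_eq_0)
  then have "2 *\<^sub>R (\<integral>x. F x \<partial>lborel) = 0" by (simp only: scaleR_2)
  then show ?thesis by simp
qed

text \<open>
  This substitution produces the factor \<open>s powr (- p)\<close>, with \<open>s = sqrt n\<close>, that the numerator and the
  denominator of the posterior mean share.
\<close>

lemma gauss_weight_scaled_integral:
  fixes \<theta>0 :: "'e::euclidean_space"
  assumes "0 < a" "0 < s"
  shows "integrable lborel (\<lambda>x. gauss_weight a (s *\<^sub>R (x - \<theta>0)))"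
    "(\<integral>x. gauss_weight a (s *\<^sub>R (x - \<theta>0)) \<partial>lborel) = (integral\<^sup>L lborel (gauss_weight a :: 'e \<Rightarrow> real)) / s ^ DIM('e)"
proof -
  have sub: "s *\<^sub>R (x - \<theta>0) = - (s *\<^sub>R \<theta>0) + s *\<^sub>R x" for x by (simp add: algebra_simps)
  have "(integral\<^sup>L lborel (gauss_weight a :: 'e \<Rightarrow> real)) = s ^ DIM('e) * (\<integral>x. gauss_weight a (s *\<^sub>R (x - \<theta>0)) \<partial>lborel)"
    unfolding sub using integral_lborel_affine[of "gauss_weight a :: 'e \<Rightarrow> real" s "- (s *\<^sub>R \<theta>0)"] assms by simp
  then show "(\<integral>x. gauss_weight a (s *\<^sub>R (x - \<theta>0)) \<partial>lborel) = (integral\<^sup>L lborel (gauss_weight a :: 'e \<Rightarrow> real)) / s ^ DIM('e)"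
    using assms by simp
  have "(\<integral>\<^sup>+x. ennreal (gauss_weight a (s *\<^sub>R (x - \<theta>0))) \<partial>lborel) < \<infinity>"
  proof -
    have "(\<integral>\<^sup>+u. ennreal (gauss_weight a (u::'e)) \<partial>lborel) < \<infinity>"
      using integrable_gauss_weight[OF assms(1), where 'e='e] gauss_weight_nonneg
      by (subst nn_integral_eq_integral) auto
    also have "(\<integral>\<^sup>+u. ennreal (gauss_weight a (u::'e)) \<partial>lborel)
       = (\<integral>\<^sup>+u. ennreal (gauss_weight a u) \<partial>density (distr lborel borel (\<lambda>x::'e. - (s *\<^sub>R \<theta>0) + s *\<^sub>R x)) (\<lambda>_. ennreal (s^DIM('e))))"
      using assms by (subst lborel_affine[of s "- (s *\<^sub>R \<theta>0)"]) (simp_all add: ennreal_power)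
    also have "\<dots> = ennreal (s^DIM('e)) * (\<integral>\<^sup>+x. ennreal (gauss_weight a (s *\<^sub>R (x - \<theta>0))) \<partial>lborel)"
      unfolding sub by (simp add: nn_integral_density nn_integral_distr nn_integral_cmult)
    finally show ?thesis using assms by (auto simp: ennreal_mult_less_top less_top)
  qed
  then show "integrable lborel (\<lambda>x. gauss_weight a (s *\<^sub>R (x - \<theta>0)))"
    by (intro integrableI_nonneg) (auto simp: gauss_weight_nonneg)
qed

lemma abs_exp_diff_le:
  fixes x y z :: real
  assumes "x \<le> z" "y \<le> z"
  shows "\<bar>exp x - exp y\<bar> \<le> exp z * \<bar>x - y\<bar>"
proof -
  have *: "exp u - exp v \<le> exp u * (u - v)" for u v :: real
  proof -
    have "exp u * (1 + (v - u)) \<le> exp u * exp (v - u)"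
      by (intro mult_left_mono exp_ge_add_one_self) auto
    then show ?thesis by (simp add: exp_diff algebra_simps)
  qed
  show ?thesis
  proof (cases "y \<le> x")
    case True
    then have "\<bar>exp x - exp y\<bar> \<le> exp x * (x - y)" using *[of x y] by simp
    also have "\<dots> \<le> exp z * (x - y)" using assms True by (intro mult_right_mono) auto
    finally show ?thesis using True by simp
  next
    case False
    then have "\<bar>exp x - exp y\<bar> \<le> exp y * (y - x)" using *[of y x] by simp
    also have "\<dots> \<le> exp z * (y - x)" using assms False by (intro mult_right_mono) auto
    finally show ?thesis using False by simp
  qed
qed

text \<open>
  Laplace's method for the normalizer and the first moment of \<open>exp b * p\<close> about a maximizer \<open>a\<close>
  of \<open>b\<close>, with explicit constants. For the moment, an integrand that is odd about \<open>a\<close> is subtracted; what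
  remains on the ball is controlled by \<open>\<bar>exp x - exp y\<bar> \<le> exp (max x y) * \<bar>x - y\<bar>\<close>, and \<open>\<eta> \<le> c / 2\<close> leaves
  half of the Gaussian decay in that maximum. For the normalizer, a ball of radius of order \<open>1 / s\<close> suffices.
\<close>

lemma laplace_first_moment_bound:
  fixes p b q :: "'e::euclidean_space \<Rightarrow> real" and a :: 'e
  assumes [measurable]: "b \<in> borel_measurable borel" "q \<in> borel_measurable borel"
    and p: "integrable lborel p" "integrable lborel (\<lambda>\<theta>. p \<theta> *\<^sub>R \<theta>)" "\<And>\<theta>. 0 \<le> p \<theta>" "(\<integral>\<theta>. p \<theta> \<partial>lborel) \<le> 1"
    and b: "\<And>\<theta>. b \<theta> \<le> 0"
    and local: "\<And>\<theta>. norm (\<theta> - a) \<le> \<delta> \<Longrightarrow> \<bar>b \<theta> + s^2 * q (\<theta> - a)\<bar> \<le> s^2 * (\<eta> * (norm (\<theta> - a))^2)"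
    and q: "\<And>h. q (- h) = q h" "\<And>h. c * (norm h)^2 \<le> q h" "\<And>h. q h \<le> K * (norm h)^2"
    and const: "0 < c" "0 \<le> \<eta>" "\<eta> \<le> c / 2" "c \<le> K" "0 < s" "1 / (s * sqrt (2 * K)) \<le> \<delta>"
    and prior: "\<And>\<theta>. norm (\<theta> - a) \<le> \<delta> \<Longrightarrow> \<bar>p \<theta> - p0\<bar> \<le> \<eta>'" "\<eta>' \<le> p0 / 2" "0 < p0"
    and far: "\<And>\<theta>. \<delta> < norm (\<theta> - a) \<Longrightarrow> p \<theta> = 0 \<or> b \<theta> \<le> - e"
  shows "integrable lborel (\<lambda>\<theta>. exp (b \<theta>) * p \<theta>)"
    and "integrable lborel (\<lambda>\<theta>. (exp (b \<theta>) * p \<theta>) *\<^sub>R (\<theta> - a))"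
    and "exp (- 1) * (p0 / 2) * (unit_ball_vol (DIM('e)) / (sqrt (2 * K)) ^ DIM('e)) / s ^ DIM('e)
           \<le> (\<integral>\<theta>. exp (b \<theta>) * p \<theta> \<partial>lborel)"
    and "norm (\<integral>\<theta>. (exp (b \<theta>) * p \<theta>) *\<^sub>R (\<theta> - a) \<partial>lborel)
           \<le> (2 * p0 * \<eta> + \<eta>') * (integral\<^sup>L lborel (gauss_weight (c / 2) :: 'e \<Rightarrow> real)) / s ^ Suc (DIM('e))
             + exp (- e) * ((\<integral>\<theta>. p \<theta> * norm \<theta> \<partial>lborel) + norm a)"
proof -
  have [measurable]: "p \<in> borel_measurable borel" using borel_measurable_integrable[OF p(1)] by simp
  have exp1: "exp (b \<theta>) \<le> 1" for \<theta> using b by simp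
  show int0: "integrable lborel (\<lambda>\<theta>. exp (b \<theta>) * p \<theta>)"
    by (rule Bochner_Integration.integrable_bound[OF p(1)])
      (use exp1 p(3) in \<open>auto simp: abs_mult intro!: mult_left_le_one_le\<close>)
  have intn: "integrable lborel (\<lambda>\<theta>. p \<theta> * norm \<theta>)"
    using integrable_norm[OF p(2)] p(3) by simp
  have intd: "integrable lborel (\<lambda>\<theta>. p \<theta> * norm (\<theta> - a))"
  proof (rule Bochner_Integration.integrable_bound)
    show "integrable lborel (\<lambda>\<theta>. p \<theta> * norm \<theta> + p \<theta> * norm a)" using intn p(1) by simp
    have "p \<theta> * norm (\<theta> - a) \<le> p \<theta> * norm \<theta> + p \<theta> * norm a" for \<theta>
      using mult_left_mono[OF norm_triangle_ineq4[of \<theta> a] p(3)[of \<theta>]] by (simp add: algebra_simps)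
    then show "AE \<theta> in lborel. norm (p \<theta> * norm (\<theta> - a)) \<le> norm (p \<theta> * norm \<theta> + p \<theta> * norm a)"
      using p(3) by (simp add: abs_mult)
  qed simp
  show int1: "integrable lborel (\<lambda>\<theta>. (exp (b \<theta>) * p \<theta>) *\<^sub>R (\<theta> - a))"
    by (rule Bochner_Integration.integrable_bound[OF intd])
      (use exp1 p(3) in \<open>auto simp: abs_mult intro!: mult_right_mono mult_left_le_one_le\<close>)
  let ?d = "DIM('e)" and ?J = "integral\<^sup>L lborel (gauss_weight (c / 2) :: 'e \<Rightarrow> real)"
  have K: "0 < K" using const by simp
  have p_near: "p0 / 2 \<le> p \<theta>" "p \<theta> \<le> 2 * p0" if "norm (\<theta> - a) \<le> \<delta>" for \<theta>
    using prior(1)[OF that] prior(2,3) by (auto simp: abs_le_iff)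

  \<comment> \<open>Since \<open>\<eta> \<le> K\<close>, on the ball of radius \<open>1 / (s * sqrt (2 * K))\<close> the exponent is at least \<open>-1\<close>.\<close>
  define r where "r = 1 / (s * sqrt (2 * K))"
  have r: "0 < r" "r \<le> \<delta>" using const K by (auto simp: r_def)
  have small: "exp (- 1) * (p0 / 2) \<le> exp (b \<theta>) * p \<theta>" if "\<theta> \<in> cball a r" for \<theta>
  proof -
    have n: "norm (\<theta> - a) \<le> r" using that by (simp add: dist_norm norm_minus_commute)
    have "\<bar>b \<theta> + s^2 * q (\<theta> - a)\<bar> \<le> s^2 * (\<eta> * (norm (\<theta> - a))^2)" using local n r by simp
    moreover have "s^2 * q (\<theta> - a) \<le> s^2 * (K * (norm (\<theta> - a))^2)" using q(3) by (intro mult_left_mono) auto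
    ultimately have "- (s^2 * (K * (norm (\<theta> - a))^2)) - s^2 * (\<eta> * (norm (\<theta> - a))^2) \<le> b \<theta>" by (simp add: abs_le_iff)
    moreover have "s^2 * (\<eta> * (norm (\<theta> - a))^2) \<le> s^2 * (K * (norm (\<theta> - a))^2)"
      using const by (intro mult_left_mono mult_right_mono) auto
    moreover have "s^2 * (K * (norm (\<theta> - a))^2) \<le> s^2 * (K * r^2)"
      using n K by (intro mult_left_mono power_mono) auto
    moreover have "s^2 * (K * r^2) = 1 / 2"
      using const K by (simp add: r_def power_divide power_mult_distrib)
    ultimately have "- 1 \<le> b \<theta>" by linarith
    then show ?thesis using p_near[of \<theta>] n r prior(3) by (intro mult_mono) auto
  qed
  have vol: "measure lborel (cball a r) = unit_ball_vol ?d * r ^ ?d"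
    using r by (simp add: content_cball)
  have "exp (- 1) * (p0 / 2) * (unit_ball_vol ?d / (sqrt (2 * K)) ^ ?d) / s ^ ?d
     = (\<integral>\<theta>. (exp (- 1) * (p0 / 2)) * indicator (cball a r) \<theta> \<partial>lborel)"
    using vol by (simp add: r_def power_divide power_mult_distrib)
  also have "\<dots> \<le> (\<integral>\<theta>. exp (b \<theta>) * p \<theta> \<partial>lborel)"
  proof (rule integral_mono[OF _ int0])
    show "integrable lborel (\<lambda>\<theta>. (exp (- 1) * (p0 / 2)) * indicator (cball a r) \<theta> :: real)"
      by (intro integrable_mult_right integrable_real_indicator) (use r in \<open>auto simp: emeasure_cball\<close>)
    show "exp (- 1) * (p0 / 2) * indicator (cball a r) \<theta> \<le> exp (b \<theta>) * p \<theta>" for \<theta>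
      using small[of \<theta>] p(3) by (cases "\<theta> \<in> cball a r") auto
  qed
  finally show "exp (- 1) * (p0 / 2) * (unit_ball_vol ?d / (sqrt (2 * K)) ^ ?d) / s ^ ?d
     \<le> (\<integral>\<theta>. exp (b \<theta>) * p \<theta> \<partial>lborel)" .

  \<comment> \<open>The local comparison integrand is odd about \<open>a\<close>, so its integral is zero.\<close>
  define G where "G \<theta> = (indicator (cball a \<delta>) \<theta> * exp (- (s^2 * q (\<theta> - a))) * p0) *\<^sub>R (\<theta> - a)" for \<theta>
  have [measurable]: "cball a \<delta> \<in> sets borel" by (rule borel_closed) simp
  have [measurable]: "(\<lambda>\<theta>. q (\<theta> - a)) \<in> borel_measurable borel"
    by (rule measurable_compose[OF _ assms(2)]) simp
  have [measurable]: "G \<in> borel_measurable borel" unfolding G_def[abs_def] by measurable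
  have G0: "(\<integral>\<theta>. G \<theta> \<partial>lborel) = 0"
  proof (rule integral_odd_about[where a=a])
    fix x
    have x: "2 *\<^sub>R a - x - a = - (x - a)" by (simp add: scaleR_2)
    have "norm (2 *\<^sub>R a - x - a) = norm (x - a)" unfolding x by (rule norm_minus_cancel)
    then have "2 *\<^sub>R a - x \<in> cball a \<delta> \<longleftrightarrow> x \<in> cball a \<delta>"
      by (simp add: dist_norm norm_minus_commute[of a])
    then show "G (2 *\<^sub>R a - x) = - G x"
      unfolding G_def x q(1) by (simp add: indicator_def del: minus_diff_eq)
  qed simp
  have bound: "norm ((exp (b \<theta>) * p \<theta>) *\<^sub>R (\<theta> - a) - G \<theta>)
     \<le> (2 * p0 * \<eta> + \<eta>') / s * gauss_weight (c / 2) (s *\<^sub>R (\<theta> - a)) + exp (- e) * (p \<theta> * norm (\<theta> - a))" for \<theta>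
  proof (cases "norm (\<theta> - a) \<le> \<delta>")
    case True
    define t where "t = norm (\<theta> - a)"
    have t: "0 \<le> t" by (simp add: t_def)
    have eta': "0 \<le> \<eta>'" using prior(1)[OF True] by linarith
    have mem: "\<theta> \<in> cball a \<delta>" using True by (simp add: dist_norm norm_minus_commute)
    have loc: "\<bar>b \<theta> + s^2 * q (\<theta> - a)\<bar> \<le> s^2 * (\<eta> * t^2)" using local[OF True] by (simp add: t_def)
    have ql: "s^2 * (c * t^2) \<le> s^2 * q (\<theta> - a)" using q(2) by (intro mult_left_mono) (auto simp: t_def)
    have eta: "s^2 * (\<eta> * t^2) \<le> s^2 * (c / 2 * t^2)"
      using const by (intro mult_left_mono mult_right_mono) auto
    have Cnn: "0 \<le> s^2 * (c / 2 * t^2)" using const(1) by simp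
    have half: "s^2 * (c * t^2) = 2 * (s^2 * (c / 2 * t^2))" by simp
    have up: "b \<theta> \<le> - (s^2 * (c / 2 * t^2))" "- (s^2 * q (\<theta> - a)) \<le> - (s^2 * (c / 2 * t^2))"
      using abs_le_D1[OF loc] ql eta half Cnn by linarith+
    have "\<bar>exp (b \<theta>) * p \<theta> - exp (- (s^2 * q (\<theta> - a))) * p0\<bar>
       = \<bar>(exp (b \<theta>) - exp (- (s^2 * q (\<theta> - a)))) * p \<theta> + exp (- (s^2 * q (\<theta> - a))) * (p \<theta> - p0)\<bar>"
      by (simp add: algebra_simps)
    also have "\<dots> \<le> \<bar>exp (b \<theta>) - exp (- (s^2 * q (\<theta> - a)))\<bar> * p \<theta> + exp (- (s^2 * q (\<theta> - a))) * \<bar>p \<theta> - p0\<bar>"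
      using p(3)[of \<theta>] by (intro order_trans[OF abs_triangle_ineq]) (simp add: abs_mult)
    also have "\<dots> \<le> (exp (- (s^2 * (c / 2 * t^2))) * (s^2 * (\<eta> * t^2))) * (2 * p0) + exp (- (s^2 * (c / 2 * t^2))) * \<eta>'"
    proof (intro add_mono mult_mono)
      show "\<bar>exp (b \<theta>) - exp (- (s^2 * q (\<theta> - a)))\<bar> \<le> exp (- (s^2 * (c / 2 * t^2))) * (s^2 * (\<eta> * t^2))"
        using loc by (intro order_trans[OF abs_exp_diff_le[OF up]] mult_left_mono) simp_all
      show "p \<theta> \<le> 2 * p0" by (rule p_near[OF True])
      show "\<bar>p \<theta> - p0\<bar> \<le> \<eta>'" by (rule prior(1)[OF True])
      show "exp (- (s^2 * q (\<theta> - a))) \<le> exp (- (s^2 * (c / 2 * t^2)))" using up(2) by simp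
    qed (use p(3) const t in auto)
    finally have "\<bar>exp (b \<theta>) * p \<theta> - exp (- (s^2 * q (\<theta> - a))) * p0\<bar> * t
      \<le> ((exp (- (s^2 * (c / 2 * t^2))) * (s^2 * (\<eta> * t^2))) * (2 * p0) + exp (- (s^2 * (c / 2 * t^2))) * \<eta>') * t"
      by (rule mult_right_mono[OF _ t])
    also have "\<dots> = (2 * p0 * \<eta> * (s * t)^3 + \<eta>' * (s * t)) / s * exp (- (c / 2) * (s * t)^2)"
      using const by (simp add: field_simps power2_eq_square power3_eq_cube)
    also have "\<dots> \<le> (2 * p0 * \<eta> * (1 + (s * t)^2)^2 + \<eta>' * (1 + (s * t)^2)^2) / s * exp (- (c / 2) * (s * t)^2)"
    proof -
      define y where "y = s * t"
      have y: "0 \<le> y" using t const by (simp add: y_def)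
      have y1: "y \<le> 1 + y^2"
        using zero_le_power2[of "y - 1/2"] by (simp add: power2_eq_square algebra_simps)
      have y2: "y \<le> (1 + y^2)^2"
        using y1 mult_left_mono[of 1 "1 + y^2" "1 + y^2"] by (simp add: power2_eq_square[of "1 + y^2"])
      have "y * y^2 \<le> (1 + y^2) * (1 + y^2)" using y y1 by (intro mult_mono) auto
      then have y3: "y^3 \<le> (1 + y^2)^2" by (simp add: power3_eq_cube power2_eq_square mult.assoc)
      show ?thesis unfolding y_def[symmetric] using y2 y3 const prior(3) eta'
        by (intro mult_right_mono divide_right_mono add_mono mult_left_mono) auto
    qed
    also have "\<dots> = (2 * p0 * \<eta> + \<eta>') / s * gauss_weight (c / 2) (s *\<^sub>R (\<theta> - a))"
    proof -
      have "norm (s *\<^sub>R (\<theta> - a)) = s * t" using const(5) by (simp only: norm_scaleR t_def abs_of_pos)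
      then show ?thesis unfolding gauss_weight_def by (simp only: distrib_right times_divide_eq_left mult.assoc)
    qed
    finally have main: "\<bar>exp (b \<theta>) * p \<theta> - exp (- (s^2 * q (\<theta> - a))) * p0\<bar> * t
      \<le> (2 * p0 * \<eta> + \<eta>') / s * gauss_weight (c / 2) (s *\<^sub>R (\<theta> - a))" .
    have "(exp (b \<theta>) * p \<theta>) *\<^sub>R (\<theta> - a) - G \<theta> = (exp (b \<theta>) * p \<theta> - exp (- (s^2 * q (\<theta> - a))) * p0) *\<^sub>R (\<theta> - a)"
      using mem by (simp add: G_def scaleR_diff_left)
    then have "norm ((exp (b \<theta>) * p \<theta>) *\<^sub>R (\<theta> - a) - G \<theta>) = \<bar>exp (b \<theta>) * p \<theta> - exp (- (s^2 * q (\<theta> - a))) * p0\<bar> * t"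
      by (simp add: t_def)
    moreover have "0 \<le> exp (- e) * (p \<theta> * norm (\<theta> - a))" using p(3) by simp
    ultimately show ?thesis using main by linarith
  next
    case False
    have eta': "0 \<le> \<eta>'" using prior(1)[of a] r by simp
    have "\<theta> \<notin> cball a \<delta>" using False by (simp add: dist_norm norm_minus_commute)
    then have "norm ((exp (b \<theta>) * p \<theta>) *\<^sub>R (\<theta> - a) - G \<theta>) = exp (b \<theta>) * (p \<theta> * norm (\<theta> - a))"
      using p(3) by (simp add: G_def abs_mult)
    also have "\<dots> \<le> exp (- e) * (p \<theta> * norm (\<theta> - a))"
    proof (cases "p \<theta> = 0")
      case False
      then have "b \<theta> \<le> - e" using far[of \<theta>] \<open>\<not> norm (\<theta> - a) \<le> \<delta>\<close> by linarith
      then show ?thesis using p(3) by (intro mult_right_mono) simp_all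
    qed simp
    also have "\<dots> \<le> (2 * p0 * \<eta> + \<eta>') / s * gauss_weight (c / 2) (s *\<^sub>R (\<theta> - a)) + exp (- e) * (p \<theta> * norm (\<theta> - a))"
      using const prior(3) eta' gauss_weight_nonneg[of "c / 2" "s *\<^sub>R (\<theta> - a)"] by simp
    finally show ?thesis .
  qed
  let ?R = "\<lambda>\<theta>. (2 * p0 * \<eta> + \<eta>') / s * gauss_weight (c / 2) (s *\<^sub>R (\<theta> - a)) + exp (- e) * (p \<theta> * norm (\<theta> - a))"
  have c2: "0 < c / 2" using const by simp
  have intR: "integrable lborel ?R"
    using gauss_weight_scaled_integral(1)[OF c2 const(5), of a] intd by simp
  have intDiff: "integrable lborel (\<lambda>\<theta>. (exp (b \<theta>) * p \<theta>) *\<^sub>R (\<theta> - a) - G \<theta>)"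
    by (rule Bochner_Integration.integrable_bound[OF intR])
      (use bound order_trans[OF bound abs_ge_self] in simp_all)
  then have intG: "integrable lborel G"
    using Bochner_Integration.integrable_diff[OF int1 intDiff] by simp
  have "(\<integral>\<theta>. (exp (b \<theta>) * p \<theta>) *\<^sub>R (\<theta> - a) \<partial>lborel) = (\<integral>\<theta>. (exp (b \<theta>) * p \<theta>) *\<^sub>R (\<theta> - a) - G \<theta> \<partial>lborel)"
    using int1 intG G0 by simp
  also have "norm \<dots> \<le> (\<integral>\<theta>. ?R \<theta> \<partial>lborel)"
    by (intro order_trans[OF Bochner_Integration.integral_norm_bound]
        integral_mono[OF integrable_norm[OF intDiff] intR bound])
  also have "\<dots> = (2 * p0 * \<eta> + \<eta>') / s * (?J / s ^ ?d) + exp (- e) * (\<integral>\<theta>. p \<theta> * norm (\<theta> - a) \<partial>lborel)"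
    using gauss_weight_scaled_integral[OF c2 const(5), of a] intd by simp
  also have "\<dots> \<le> (2 * p0 * \<eta> + \<eta>') / s * (?J / s ^ ?d) + exp (- e) * ((\<integral>\<theta>. p \<theta> * norm \<theta> \<partial>lborel) + norm a)"
  proof (intro add_left_mono mult_left_mono)
    have "(\<integral>\<theta>. p \<theta> * norm (\<theta> - a) \<partial>lborel) \<le> (\<integral>\<theta>. p \<theta> * norm \<theta> + norm a * p \<theta> \<partial>lborel)"
    proof (rule integral_mono[OF intd])
      show "integrable lborel (\<lambda>\<theta>. p \<theta> * norm \<theta> + norm a * p \<theta>)" using intn p(1) by simp
      show "p \<theta> * norm (\<theta> - a) \<le> p \<theta> * norm \<theta> + norm a * p \<theta>" for \<theta>
        using mult_left_mono[OF norm_triangle_ineq4[of \<theta> a] p(3)[of \<theta>]] by (simp add: algebra_simps)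
    qed
    also have "\<dots> = (\<integral>\<theta>. p \<theta> * norm \<theta> \<partial>lborel) + norm a * (\<integral>\<theta>. p \<theta> \<partial>lborel)" using intn p(1) by simp
    also have "\<dots> \<le> (\<integral>\<theta>. p \<theta> * norm \<theta> \<partial>lborel) + norm a" using p(4) mult_left_le[of _ "norm a"] by simp
    finally show "(\<integral>\<theta>. p \<theta> * norm (\<theta> - a) \<partial>lborel) \<le> (\<integral>\<theta>. p \<theta> * norm \<theta> \<partial>lborel) + norm a" .
  qed simp
  finally show "norm (\<integral>\<theta>. (exp (b \<theta>) * p \<theta>) *\<^sub>R (\<theta> - a) \<partial>lborel)
           \<le> (2 * p0 * \<eta> + \<eta>') * ?J / s ^ Suc ?d
             + exp (- e) * ((\<integral>\<theta>. p \<theta> * norm \<theta> \<partial>lborel) + norm a)" by simp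
qed

section \<open>A weak law of large numbers\<close>

text \<open>
  Independence removes the mixed terms, so the second moment grows only linearly in \<open>n\<close>.
\<close>

lemma (in prob_space) second_moment_indep_sum_le:
  fixes Z :: "nat \<Rightarrow> 'a \<Rightarrow> real"
  assumes indep: "indep_vars (\<lambda>_. borel) Z {1..}"
    and bound: "\<And>i w. 1 \<le> i \<Longrightarrow> w \<in> space M \<Longrightarrow> \<bar>Z i w\<bar> \<le> B" and mean: "\<And>i. 1 \<le> i \<Longrightarrow> expectation (Z i) = 0"
  shows "integrable M (\<lambda>w. (\<Sum>i=1..n. Z i w)^2)" "expectation (\<lambda>w. (\<Sum>i=1..n. Z i w)^2) \<le> real n * B^2"
proof -
  have meas: "Z i \<in> borel_measurable M" if "1 \<le> i" for i
    using indep that by (auto simp: indep_vars_def)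
  have int: "integrable M (Z i)" if "1 \<le> i" for i
    using bound[OF that] meas[OF that] by (intro integrable_const_bound[of _ B]) auto
  have prod: "integrable M (\<lambda>w. Z i w * Z j w) \<and> expectation (\<lambda>w. Z i w * Z j w) \<le> (if i = j then B^2 else 0)"
    if ij: "1 \<le> i" "1 \<le> j" for i j
  proof (cases "i = j")
    case True
    have b: "\<bar>Z i w * Z i w\<bar> \<le> B^2" if "w \<in> space M" for w
    proof -
      have "\<bar>Z i w\<bar>^2 \<le> B^2" using bound[OF ij(1) that] by (intro power_mono) auto
      then show ?thesis by (simp add: power2_eq_square)
    qed
    have int2: "integrable M (\<lambda>w. Z i w * Z i w)"
      using b meas[OF ij(1)] by (intro integrable_const_bound[of _ "B^2"]) auto
    have "expectation (\<lambda>w. Z i w * Z i w) \<le> expectation (\<lambda>w. B^2)"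
      using b by (intro integral_mono int2) (auto simp: abs_le_iff)
    then show ?thesis using int2 True by (simp add: prob_space)
  next
    case False
    have ind: "indep_vars (\<lambda>_. borel) Z {i, j}" using indep ij by (rule_tac indep_vars_subset) auto
    have "integrable M (\<lambda>w. \<Prod>k\<in>{i,j}. Z k w)"
      by (rule indep_vars_integrable[OF _ ind]) (use int ij in auto)
    moreover have "expectation (\<lambda>w. \<Prod>k\<in>{i,j}. Z k w) = (\<Prod>k\<in>{i,j}. expectation (Z k))"
      by (rule indep_vars_lebesgue_integral[OF _ ind]) (use int ij in auto)
    ultimately show ?thesis using False mean[OF ij(1)] by simp
  qed
  have sq: "(\<Sum>i=1..n. Z i w)^2 = (\<Sum>i=1..n. \<Sum>j=1..n. Z i w * Z j w)" for w
    by (simp add: power2_eq_square sum_product)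
  show "integrable M (\<lambda>w. (\<Sum>i=1..n. Z i w)^2)"
    unfolding sq using prod by (intro Bochner_Integration.integrable_sum) auto
  have "expectation (\<lambda>w. (\<Sum>i=1..n. Z i w)^2) = (\<Sum>i=1..n. \<Sum>j=1..n. expectation (\<lambda>w. Z i w * Z j w))"
    unfolding sq using prod by (subst Bochner_Integration.integral_sum) (auto intro!: sum.cong Bochner_Integration.integrable_sum)
  also have "\<dots> \<le> (\<Sum>i=1..n. \<Sum>j=1..n. (if i = j then B^2 else 0))"
    using prod by (intro sum_mono) auto
  also have "\<dots> = real n * B^2" by simp
  finally show "expectation (\<lambda>w. (\<Sum>i=1..n. Z i w)^2) \<le> real n * B^2" .
qed

text \<open>
  Truncation at a level \<open>N\<close>. The truncated and recentred variables are bounded, and Chebyshev's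
  inequality applies to their sum; the rest has mean absolute value at most twice the averaged tail beyond
  \<open>N\<close>, which is small by hypothesis, uniformly in \<open>n\<close>.
\<close>

lemma (in prob_space) weak_law_averaged_tails:
  fixes Y :: "nat \<Rightarrow> 'a \<Rightarrow> real"
  assumes indep: "indep_vars (\<lambda>_. borel) Y {1..}"
    and int: "\<And>i. 1 \<le> i \<Longrightarrow> integrable M (Y i)" and mean: "\<And>i. 1 \<le> i \<Longrightarrow> expectation (Y i) = 0"
    and tails: "((\<lambda>N::real. SUP n\<in>{1<..}.
         (\<Sum>i=1..n. \<integral>\<^sup>+w. ennreal (\<bar>Y i w\<bar> * indicator {y. \<bar>y\<bar> > N} (Y i w)) \<partial>M) / ennreal (real n)) \<longlongrightarrow> 0) at_top"
    and \<epsilon>: "0 < \<epsilon>"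
  shows "(\<lambda>n. prob {w \<in> space M. \<epsilon> < \<bar>(\<Sum>i=1..n. Y i w) / real n\<bar>}) \<longlonglongrightarrow> 0"
proof (rule LIMSEQ_I)
  fix \<rho> :: real assume \<rho>: "0 < \<rho>"
  \<comment> \<open>Markov's inequality turns the tail bound \<open>\<tau>\<close> into the probability \<open>4 * \<tau> / \<epsilon> = \<rho> / 4\<close>.\<close>
  define \<tau> where "\<tau> = \<rho> * \<epsilon> / 16"
  have \<tau>: "0 < \<tau>" using \<rho> \<epsilon> by (simp add: \<tau>_def)
  have "eventually (\<lambda>N::real. (SUP n\<in>{1<..}.
         (\<Sum>i=1..n. \<integral>\<^sup>+w. ennreal (\<bar>Y i w\<bar> * indicator {y. \<bar>y\<bar> > N} (Y i w)) \<partial>M) / ennreal (real n)) < ennreal \<tau>) at_top"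
    using order_tendstoD(2)[OF tails, of "ennreal \<tau>"] \<tau> by simp
  then obtain N where N: "0 \<le> N" "(SUP n\<in>{1<..}.
         (\<Sum>i=1..n. \<integral>\<^sup>+w. ennreal (\<bar>Y i w\<bar> * indicator {y. \<bar>y\<bar> > N} (Y i w)) \<partial>M) / ennreal (real n)) < ennreal \<tau>"
    using eventually_conj[OF _ eventually_ge_at_top[of 0]] eventually_happens'[OF trivial_limit_at_top_linorder] by (smt (verit))
  have meas: "Y i \<in> borel_measurable M" if "1 \<le> i" for i using int[OF that] by simp
  define t where "t y = (if \<bar>y\<bar> \<le> N then y else 0)" for y :: real
  have [measurable]: "t \<in> borel_measurable borel" unfolding t_def[abs_def] by measurable
  have tN: "\<bar>t y\<bar> \<le> N" for y using N(1) by (simp add: t_def)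
  define R where "R i w = Y i w - t (Y i w)" for i w
  define m where "m i = expectation (\<lambda>w. t (Y i w))" for i
  define Z where "Z i w = t (Y i w) - m i" for i w
  have intt: "integrable M (\<lambda>w. t (Y i w))" if "1 \<le> i" for i
    using tN meas[OF that] by (intro integrable_const_bound[of _ N]) auto
  have intR: "integrable M (R i)" if "1 \<le> i" for i
    unfolding R_def[abs_def] using int[OF that] intt[OF that] by simp
  have mR: "m i = - expectation (R i)" if "1 \<le> i" for i
    unfolding m_def R_def[abs_def] using int[OF that] intt[OF that] mean[OF that] by simp
  have mN: "\<bar>m i\<bar> \<le> N" if "1 \<le> i" for i
  proof -
    have "\<bar>m i\<bar> \<le> expectation (\<lambda>w. \<bar>t (Y i w)\<bar>)"
      unfolding m_def by (rule integral_abs_bound)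
    also have "\<dots> \<le> expectation (\<lambda>w. N)" using intt[OF that] tN by (intro integral_mono) auto
    finally show ?thesis by (simp add: prob_space)
  qed
  have Zindep: "indep_vars (\<lambda>_. borel) Z {1..}"
    unfolding Z_def[abs_def] by (rule indep_vars_compose2[OF indep]) measurable
  have Zbound: "\<bar>Z i w\<bar> \<le> 2 * N" if "1 \<le> i" for i w
    using tN[of "Y i w"] mN[OF that] unfolding Z_def by linarith
  have Zmean: "expectation (Z i) = 0" if "1 \<le> i" for i
    unfolding Z_def[abs_def] using intt[OF that] by (simp add: m_def prob_space)
  have Zmeas [measurable]: "Z i \<in> borel_measurable M" if "1 \<le> i" for i
    using Zindep that by (auto simp: indep_vars_def)
  have decomp: "Y i w = Z i w + (R i w + m i)" for i w by (simp add: Z_def R_def)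
  define S1 where "S1 n w = (\<Sum>i=1..n. Z i w)" for n w
  define S2 where "S2 n w = (\<Sum>i=1..n. \<bar>R i w + m i\<bar>)" for n w
  have [measurable]: "S1 n \<in> borel_measurable M" "S2 n \<in> borel_measurable M" for n
    unfolding S1_def[abs_def] S2_def[abs_def] using intR by (auto intro!: borel_measurable_sum)
  have tail: "(\<Sum>i=1..n. expectation (\<lambda>w. \<bar>R i w\<bar>)) \<le> \<tau> * real n" if n: "1 < n" for n
  proof -
    have eq: "\<bar>Y i w\<bar> * indicator {y. \<bar>y\<bar> > N} (Y i w) = \<bar>R i w\<bar>" for i w
      by (simp add: R_def t_def indicator_def)
    have "(\<Sum>i=1..n. \<integral>\<^sup>+w. ennreal (\<bar>Y i w\<bar> * indicator {y. \<bar>y\<bar> > N} (Y i w)) \<partial>M) / ennreal (real n) \<le> ennreal \<tau>"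
      using order_trans[OF SUP_upper less_imp_le[OF N(2)]] n by blast
    moreover have "(\<Sum>i=1..n. \<integral>\<^sup>+w. ennreal (\<bar>Y i w\<bar> * indicator {y. \<bar>y\<bar> > N} (Y i w)) \<partial>M)
       = (\<Sum>i=1..n. ennreal (expectation (\<lambda>w. \<bar>R i w\<bar>)))"
      unfolding eq using intR by (intro sum.cong refl nn_integral_eq_integral) auto
    ultimately have "ennreal (\<Sum>i=1..n. expectation (\<lambda>w. \<bar>R i w\<bar>)) / ennreal (real n) \<le> ennreal \<tau>"
      by (simp add: sum_ennreal)
    then have "ennreal ((\<Sum>i=1..n. expectation (\<lambda>w. \<bar>R i w\<bar>)) / real n) \<le> ennreal \<tau>"
      using n by (simp add: divide_ennreal sum_nonneg)
    then have "(\<Sum>i=1..n. expectation (\<lambda>w. \<bar>R i w\<bar>)) / real n \<le> \<tau>" using \<tau> by (simp add: ennreal_le_iff)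
    then show ?thesis using n by (simp add: pos_divide_le_eq)
  qed
  have P2: "prob {w \<in> space M. \<epsilon> / 2 * real n \<le> S2 n w} \<le> 4 * \<tau> / \<epsilon>" if n: "1 < n" for n
  proof -
    have int2: "integrable M (S2 n)" unfolding S2_def[abs_def]
      using intR by (intro Bochner_Integration.integrable_sum integrable_abs Bochner_Integration.integrable_add) auto
    have "expectation (S2 n) = (\<Sum>i=1..n. expectation (\<lambda>w. \<bar>R i w + m i\<bar>))"
      unfolding S2_def[abs_def] using intR by (subst Bochner_Integration.integral_sum) auto
    also have "\<dots> \<le> (\<Sum>i=1..n. 2 * expectation (\<lambda>w. \<bar>R i w\<bar>))"
    proof (rule sum_mono)
      fix i assume "i \<in> {1..n}"
      then have i: "1 \<le> i" by simp
      have "expectation (\<lambda>w. \<bar>R i w + m i\<bar>) \<le> expectation (\<lambda>w. \<bar>R i w\<bar> + \<bar>m i\<bar>)"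
        using intR[OF i] by (intro integral_mono) auto
      also have "\<dots> = expectation (\<lambda>w. \<bar>R i w\<bar>) + \<bar>expectation (R i)\<bar>"
        using intR[OF i] mR[OF i] by (simp add: prob_space)
      also have "\<dots> \<le> 2 * expectation (\<lambda>w. \<bar>R i w\<bar>)"
        using integral_abs_bound[of M "R i"] by simp
      finally show "expectation (\<lambda>w. \<bar>R i w + m i\<bar>) \<le> 2 * expectation (\<lambda>w. \<bar>R i w\<bar>)" .
    qed
    also have "\<dots> \<le> 2 * (\<tau> * real n)" using tail[OF n] by (simp add: sum_distrib_left[symmetric])
    finally have E: "expectation (S2 n) \<le> 2 * (\<tau> * real n)" .
    have "prob {w \<in> space M. \<epsilon> / 2 * real n \<le> S2 n w} \<le> expectation (S2 n) / (\<epsilon> / 2 * real n)"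
      using \<epsilon> n by (intro integral_Markov_inequality_measure[OF int2 sets.empty_sets]) (auto simp: S2_def sum_nonneg)
    also have "\<dots> \<le> 2 * (\<tau> * real n) / (\<epsilon> / 2 * real n)" using E \<epsilon> by (intro divide_right_mono) auto
    also have "\<dots> = 4 * \<tau> / \<epsilon>" using n by simp
    finally show ?thesis .
  qed
  have P1: "prob {w \<in> space M. (\<epsilon> / 2 * real n)^2 \<le> (S1 n w)^2} \<le> 16 * N^2 / (\<epsilon>^2 * real n)" if n: "1 < n" for n
  proof -
    have int1: "integrable M (\<lambda>w. (S1 n w)^2)" and E: "expectation (\<lambda>w. (S1 n w)^2) \<le> real n * (2 * N)^2"
      unfolding S1_def using second_moment_indep_sum_le[OF Zindep Zbound Zmean] by auto
    have "prob {w \<in> space M. (\<epsilon> / 2 * real n)^2 \<le> (S1 n w)^2} \<le> expectation (\<lambda>w. (S1 n w)^2) / (\<epsilon> / 2 * real n)^2"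
      using \<epsilon> n by (intro integral_Markov_inequality_measure[OF int1 sets.empty_sets]) auto
    also have "\<dots> \<le> real n * (2 * N)^2 / (\<epsilon> / 2 * real n)^2" using E by (intro divide_right_mono) auto
    also have "\<dots> = 16 * N^2 / (\<epsilon>^2 * real n)" using n \<epsilon> by (simp add: field_simps power2_eq_square)
    finally show ?thesis .
  qed
  have "(\<lambda>n. 16 * N^2 / (\<epsilon>^2 * real n)) \<longlonglongrightarrow> 0" using \<epsilon> by real_asymp
  then have "eventually (\<lambda>n. 16 * N^2 / (\<epsilon>^2 * real n) < \<rho> / 2) sequentially"
    using order_tendstoD(2) \<rho> by (metis half_gt_zero)
  then obtain n0 where n0: "\<And>n. n0 \<le> n \<Longrightarrow> 16 * N^2 / (\<epsilon>^2 * real n) < \<rho> / 2" by (auto simp: eventually_sequentially)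
  show "\<exists>no. \<forall>n\<ge>no. norm (prob {w \<in> space M. \<epsilon> < \<bar>(\<Sum>i=1..n. Y i w) / real n\<bar>} - 0) < \<rho>"
  proof (intro exI[of _ "max 2 n0"] allI impI)
    fix n assume "max 2 n0 \<le> n"
    then have n: "1 < n" "n0 \<le> n" by auto
    have "{w \<in> space M. \<epsilon> < \<bar>(\<Sum>i=1..n. Y i w) / real n\<bar>}
       \<subseteq> {w \<in> space M. (\<epsilon> / 2 * real n)^2 \<le> (S1 n w)^2} \<union> {w \<in> space M. \<epsilon> / 2 * real n \<le> S2 n w}"
    proof
      fix w assume w: "w \<in> {w \<in> space M. \<epsilon> < \<bar>(\<Sum>i=1..n. Y i w) / real n\<bar>}"
      then have "\<epsilon> * real n < \<bar>\<Sum>i=1..n. Y i w\<bar>" using n by (simp add: pos_less_divide_eq)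
      also have "\<dots> = \<bar>S1 n w + (\<Sum>i=1..n. (R i w + m i))\<bar>"
        unfolding S1_def sum.distrib[symmetric] using decomp by simp
      also have "\<dots> \<le> \<bar>S1 n w\<bar> + S2 n w"
        unfolding S2_def by (intro order_trans[OF abs_triangle_ineq] add_left_mono sum_abs)
      finally have "\<epsilon> / 2 * real n \<le> \<bar>S1 n w\<bar> \<or> \<epsilon> / 2 * real n \<le> S2 n w" by linarith
      moreover have "(\<epsilon> / 2 * real n)^2 \<le> (S1 n w)^2" if "\<epsilon> / 2 * real n \<le> \<bar>S1 n w\<bar>"
        using power_mono[OF that, of 2] \<epsilon> by simp
      ultimately show "w \<in> {w \<in> space M. (\<epsilon> / 2 * real n)^2 \<le> (S1 n w)^2} \<union> {w \<in> space M. \<epsilon> / 2 * real n \<le> S2 n w}"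
        using w by auto
    qed
    then have "prob {w \<in> space M. \<epsilon> < \<bar>(\<Sum>i=1..n. Y i w) / real n\<bar>}
       \<le> prob ({w \<in> space M. (\<epsilon> / 2 * real n)^2 \<le> (S1 n w)^2} \<union> {w \<in> space M. \<epsilon> / 2 * real n \<le> S2 n w})"
      by (intro finite_measure_mono) measurable
    also have "\<dots> \<le> prob {w \<in> space M. (\<epsilon> / 2 * real n)^2 \<le> (S1 n w)^2} + prob {w \<in> space M. \<epsilon> / 2 * real n \<le> S2 n w}"
      by (rule measure_Un_le) measurable
    also have "\<dots> < \<rho>"
    proof -
      have "4 * \<tau> / \<epsilon> = \<rho> / 4" using \<epsilon> by (simp add: \<tau>_def)
      then show ?thesis using P1[OF n(1)] P2[OF n(1)] n0[OF n(2)] \<rho> by linarith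
    qed
    finally show "norm (prob {w \<in> space M. \<epsilon> < \<bar>(\<Sum>i=1..n. Y i w) / real n\<bar>} - 0) < \<rho>" by simp
  qed
qed

section \<open>Slutsky's theorem for vanishing remainders\<close>

text \<open>
  The limit gives almost all of its mass to a large ball; testing against a cut-off function shows that
  eventually the \<open>Z n\<close> do so, too. On the ball the test function \<open>\<phi>\<close> is uniformly continuous, so that moving
  its argument by a small amount hardly matters.
\<close>

lemma tendsto_in_distr_add_vanishing:
  fixes Z Z' :: "nat \<Rightarrow> 'w \<Rightarrow> 'e::euclidean_space"
  assumes M: "prob_space M" and N: "sets N = sets borel"
    and Z: "tendsto_in_distr M Z N" and Z': "\<And>n. Z' n \<in> borel_measurable M"
    and small: "\<And>\<epsilon>. 0 < \<epsilon> \<Longrightarrow> (\<lambda>n. measure M {w \<in> space M. \<epsilon> < norm (Z' n w - Z n w)}) \<longlonglongrightarrow> 0"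
  shows "tendsto_in_distr M Z' N"
  unfolding tendsto_in_distr_def
proof (intro conjI allI impI)
  interpret M: prob_space M by (rule M)
  show "Z' n \<in> borel_measurable M" for n by (rule Z')
  fix \<phi> :: "'e \<Rightarrow> real" assume "continuous_on UNIV \<phi> \<and> bounded (range \<phi>)"
  then have cont: "continuous_on UNIV \<phi>" and bdd: "bounded (range \<phi>)" by auto
  have meas [measurable]: "Z n \<in> borel_measurable M" "Z' n \<in> borel_measurable M" for n
    using Z Z' by (auto simp: tendsto_in_distr_def)
  have \<phi>_meas [measurable]: "\<phi> \<in> borel_measurable borel" using cont by (rule borel_measurable_continuous_onI)
  have lim: "(\<lambda>n. \<integral>w. \<psi> (Z n w) \<partial>M) \<longlonglongrightarrow> (\<integral>x. \<psi> x \<partial>N)"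
    if "continuous_on UNIV \<psi>" "bounded (range \<psi>)" for \<psi> :: "'e \<Rightarrow> real"
    using Z that by (auto simp: tendsto_in_distr_def)
  obtain B where B: "0 < B" "\<And>x. \<bar>\<phi> x\<bar> \<le> B" using bdd unfolding bounded_pos by auto
  have spN: "space N = UNIV" using sets_eq_imp_space_eq[OF N] by simp
  \<comment> \<open>Testing against the constant \<open>1\<close> shows that the limit is a probability measure.\<close>
  have "bounded (range (\<lambda>_::'e. 1 :: real))" by simp
  from lim[OF continuous_on_const this]
  have "(\<lambda>n::nat. 1) \<longlonglongrightarrow> measure N UNIV" by (simp add: spN M.prob_space)
  then have N1: "measure N UNIV = 1" by (simp add: LIMSEQ_const_iff)
  then have "emeasure N (space N) \<noteq> \<infinity>" using spN by (auto simp: measure_def)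
  then interpret N: finite_measure N by (rule finite_measureI)
  define cut where "cut K x = max 0 (min 1 (K + 1 - norm x))" for K :: nat and x :: 'e
  have cut: "0 \<le> cut K x" "cut K x \<le> 1" "norm x \<le> real K \<Longrightarrow> cut K x = 1" "0 < cut K x \<Longrightarrow> norm x < real K + 1" for K x
    by (auto simp: cut_def max_def min_def split: if_splits)
  have cut_cont: "continuous_on UNIV (cut K)" for K
    unfolding cut_def[abs_def] by (intro continuous_intros)
  have [measurable]: "cut K \<in> borel_measurable borel" for K using cut_cont by (rule borel_measurable_continuous_onI)
  have measN: "cut K \<in> borel_measurable N" for K using N by (simp cong: measurable_cong_sets)
  have cut_lim: "(\<lambda>K. \<integral>x. cut K x \<partial>N) \<longlonglongrightarrow> 1"
  proof -
    have "(\<lambda>K. \<integral>x. cut K x \<partial>N) \<longlonglongrightarrow> (\<integral>x. 1 \<partial>N)"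
    proof (rule integral_dominated_convergence[where w="\<lambda>_. 1"])
      show "AE x in N. (\<lambda>K. cut K x) \<longlonglongrightarrow> 1"
      proof (rule AE_I2, rule tendsto_eventually)
        fix x :: 'e
        obtain K0 where "norm x \<le> real K0" using real_arch_simple by blast
        then show "eventually (\<lambda>K. cut K x = 1) sequentially"
          using cut(3)[of x] by (intro eventually_sequentiallyI[of K0]) (metis of_nat_le_iff order_trans)
      qed
    qed (use measN cut in auto)
    then show ?thesis using N1 spN by simp
  qed
  have diff: "(\<lambda>n. (\<integral>w. \<phi> (Z' n w) \<partial>M) - (\<integral>w. \<phi> (Z n w) \<partial>M)) \<longlonglongrightarrow> 0"
  proof (rule LIMSEQ_I)
    fix \<rho> :: real assume \<rho>: "0 < \<rho>"
    \<comment> \<open>The two exceptional events contribute at most \<open>2 * B * (\<eta> + \<eta>) = \<rho> / 2\<close>.\<close>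
    define \<eta> where "\<eta> = \<rho> / (8 * B)"
    have \<eta>: "0 < \<eta>" using \<rho> B by (simp add: \<eta>_def)
    obtain K where K: "1 - \<eta> < (\<integral>x. cut K x \<partial>N)"
      using order_tendstoD(1)[OF cut_lim, of "1 - \<eta>"] \<eta> by (auto simp: eventually_sequentially)
    have "(\<lambda>n. \<integral>w. cut K (Z n w) \<partial>M) \<longlonglongrightarrow> (\<integral>x. cut K x \<partial>N)"
      using cut by (intro lim cut_cont) (auto intro!: boundedI[of _ 1])
    from order_tendstoD(1)[OF this K] obtain n1 where n1: "\<And>n. n1 \<le> n \<Longrightarrow> 1 - \<eta> < (\<integral>w. cut K (Z n w) \<partial>M)"
      by (auto simp: eventually_sequentially)
    have "uniformly_continuous_on (cball 0 (real K + 2)) \<phi>"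
      using cont by (intro compact_uniformly_continuous) (auto intro: continuous_on_subset)
    then obtain d where d: "0 < d"
      "\<And>x y. norm x \<le> real K + 2 \<Longrightarrow> norm y \<le> real K + 2 \<Longrightarrow> dist y x < d \<Longrightarrow> \<bar>\<phi> y - \<phi> x\<bar> < \<rho> / 4"
      unfolding uniformly_continuous_on_def using \<rho> by (auto simp: dist_real_def dest!: spec[of _ "\<rho> / 4"])
    define \<epsilon> where "\<epsilon> = min 1 (d / 2)"
    have \<epsilon>: "0 < \<epsilon>" "\<epsilon> \<le> 1" "\<epsilon> < d" using d by (auto simp: \<epsilon>_def)
    obtain n2 where n2: "\<And>n. n2 \<le> n \<Longrightarrow> measure M {w \<in> space M. \<epsilon> < norm (Z' n w - Z n w)} < \<eta>"
      using order_tendstoD(2)[OF small[OF \<epsilon>(1)] \<eta>] by (auto simp: eventually_sequentially)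
    show "\<exists>no. \<forall>n\<ge>no. norm ((\<integral>w. \<phi> (Z' n w) \<partial>M) - (\<integral>w. \<phi> (Z n w) \<partial>M) - 0) < \<rho>"
    proof (intro exI[of _ "max n1 n2"] allI impI)
      fix n assume "max n1 n2 \<le> n"
      then have n: "n1 \<le> n" "n2 \<le> n" by auto
      define E where "E = {w \<in> space M. \<epsilon> < norm (Z' n w - Z n w)}"
      have [measurable]: "E \<in> sets M" unfolding E_def by measurable
      have bnd: "\<bar>\<phi> (Z' n w) - \<phi> (Z n w)\<bar> \<le> \<rho> / 4 + 2 * B * ((1 - cut K (Z n w)) + indicator E w)"
        if "w \<in> space M" for w
      proof (cases "w \<in> E \<or> cut K (Z n w) = 0")
        case True
        have "\<bar>\<phi> (Z' n w) - \<phi> (Z n w)\<bar> \<le> 2 * B * 1" using B(2)[of "Z' n w"] B(2)[of "Z n w"] by linarith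
        also have "\<dots> \<le> 2 * B * ((1 - cut K (Z n w)) + indicator E w)"
          using True B cut(1,2)[of K "Z n w"] by (intro mult_left_mono) auto
        finally show ?thesis using \<rho> by linarith
      next
        case False
        then have "norm (Z' n w - Z n w) \<le> \<epsilon>" using that by (auto simp: E_def)
        moreover have "norm (Z n w) < real K + 1" using False cut(1,2)[of K "Z n w"] by (intro cut(4)) linarith
        moreover have "norm (Z' n w) \<le> norm (Z n w) + norm (Z' n w - Z n w)" by (rule norm_triangle_sub)
        ultimately have "\<bar>\<phi> (Z' n w) - \<phi> (Z n w)\<bar> < \<rho> / 4" using \<epsilon> by (intro d) (auto simp: dist_norm)
        moreover have "0 \<le> 2 * B * ((1 - cut K (Z n w)) + indicator E w)" using B cut(1,2)[of K "Z n w"] by auto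
        ultimately show ?thesis by linarith
      qed
      have i1: "integrable M (\<lambda>w. \<phi> (Z' n w))" "integrable M (\<lambda>w. \<phi> (Z n w))"
        using B(2) by (auto intro!: M.integrable_const_bound[of _ B])
      have i2: "integrable M (\<lambda>w. cut K (Z n w))" using cut by (auto intro!: M.integrable_const_bound[of _ 1])
      have iE: "integrable M (indicator E :: 'w \<Rightarrow> real)" by (intro integrable_real_indicator) (auto simp: less_top[symmetric])
      have "\<bar>(\<integral>w. \<phi> (Z' n w) \<partial>M) - (\<integral>w. \<phi> (Z n w) \<partial>M)\<bar> = \<bar>\<integral>w. \<phi> (Z' n w) - \<phi> (Z n w) \<partial>M\<bar>" using i1 by simp
      also have "\<dots> \<le> (\<integral>w. \<bar>\<phi> (Z' n w) - \<phi> (Z n w)\<bar> \<partial>M)" by (rule integral_abs_bound)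
      also have "\<dots> \<le> (\<integral>w. \<rho> / 4 + 2 * B * ((1 - cut K (Z n w)) + indicator E w) \<partial>M)"
        using i1 i2 iE bnd by (intro integral_mono) auto
      also have "\<dots> = \<rho> / 4 + 2 * B * ((1 - (\<integral>w. cut K (Z n w) \<partial>M)) + measure M E)"
        using i2 iE by (simp add: M.prob_space)
      also have "\<dots> \<le> \<rho> / 4 + 2 * B * (\<eta> + \<eta>)"
        using n1[OF n(1)] n2[OF n(2)] B by (intro add_left_mono mult_left_mono add_mono) (auto simp: E_def)
      also have "\<dots> < \<rho>" using B \<rho> by (simp add: \<eta>_def)
      finally show "norm ((\<integral>w. \<phi> (Z' n w) \<partial>M) - (\<integral>w. \<phi> (Z n w) \<partial>M) - 0) < \<rho>" by simp
    qed
  qed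
  show "(\<lambda>n. \<integral>w. \<phi> (Z' n w) \<partial>M) \<longlonglongrightarrow> (\<integral>x. \<phi> x \<partial>N)"
    using tendsto_add[OF diff lim[OF cont bdd]] by simp
qed

section \<open>Quadratic expansion of the likelihood\<close>

lemma norm_nth_mult_le:
  fixes h :: "real ^ 'p"
  shows "\<bar>h $ k * h $ j\<bar> \<le> (norm h)^2"
  unfolding abs_mult power2_eq_square by (intro mult_mono component_le_norm_cart) auto

text \<open>
  The gradient vanishes at the maximizer, so the second-order Taylor formula compares \<open>Q\<close> with
  the Hessian at an intermediate point. That Hessian differs from the one at \<open>\<theta>g\<close> by at most the bound on the
  third derivatives times the radius, and the latter from \<open>- n * A\<close> by \<open>\<kappa> * n\<close>. Using \<open>A\<close> itself, instead of
  the random Hessian at the maximizer, as quadratic form makes the comparison Gaussian deterministic.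
\<close>

lemma quadratic_expansion_at_maximizer:
  fixes v :: "nat \<Rightarrow> real ^ 'p \<Rightarrow> real" and A :: "real ^ 'p ^ 'p" and n :: nat
  assumes U: "U = ball \<theta>g (2 * \<delta>)" and v: "\<And>i. i \<in> {1..n} \<Longrightarrow> thrice_differentiable_on (v i) U"
    and a: "0 \<le> a" "a \<le> 1" and Q: "\<And>\<theta>. \<theta> \<in> U \<Longrightarrow> Q \<theta> = c0 - a * (\<Sum>i=1..n. v i \<theta>)"
    and third: "\<And>l j k \<theta>. \<theta> \<in> U \<Longrightarrow> (\<Sum>i=1..n. \<bar>partial3 U l j k (v i) \<theta>\<bar>) \<le> C * real n"
    and second: "\<And>j k. \<bar>a * (\<Sum>i=1..n. partial2 U j k (v i) \<theta>g) - real n * A $ j $ k\<bar> \<le> \<kappa> * real n"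
    and max: "\<And>\<theta>. \<theta> \<in> U \<Longrightarrow> Q \<theta> \<le> Q \<theta>hat"
    and near: "norm (\<theta>hat - \<theta>g) < \<delta>" "norm (\<theta> - \<theta>hat) \<le> \<delta>" and \<delta>: "0 < \<delta>" and C: "0 \<le> C"
  shows "\<bar>Q \<theta> - Q \<theta>hat + real n * ((\<theta> - \<theta>hat) \<bullet> (A *v (\<theta> - \<theta>hat)) / 2)\<bar>
     \<le> real n * ((real CARD('p))^2 * (2 * real CARD('p) * C * \<delta> + \<kappa>) / 2 * (norm (\<theta> - \<theta>hat))^2)"
proof -
  define p where "p = real CARD('p)"
  have op: "open U" and conv: "convex U" by (simp_all add: U)
  have g: "\<theta>g \<in> U" using \<delta> by (simp add: U)
  have hat: "\<theta>hat \<in> U" using near(1) \<delta> by (simp add: U dist_norm norm_minus_commute)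
  have "norm (\<theta> - \<theta>g) < 2 * \<delta>" using norm_triangle_ineq[of "\<theta> - \<theta>hat" "\<theta>hat - \<theta>g"] near by simp
  then have \<theta>: "\<theta> \<in> U" by (simp add: U dist_norm norm_minus_commute)
  define G where "G k \<xi> = - a * (\<Sum>i=1..n. partial U k (v i) \<xi>)" for k \<xi>
  define H where "H j k \<xi> = - a * (\<Sum>i=1..n. partial2 U j k (v i) \<xi>)" for j k \<xi>
  define T3 where "T3 l j k \<xi> = - a * (\<Sum>i=1..n. partial3 U l j k (v i) \<xi>)" for l j k \<xi>
  have d: "v i differentiable_on U" "partial U k (v i) differentiable_on U" "partial2 U j k (v i) differentiable_on U"
    if "i \<in> {1..n}" for i j k
    using v[OF that] unfolding thrice_differentiable_on_def by blast+
  have comb: "((\<lambda>\<xi>. - a * (\<Sum>i=1..n. u i \<xi>)) has_derivative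
      (\<lambda>x. \<Sum>k\<in>UNIV. x $ k * (- a * (\<Sum>i=1..n. partial U k (u i) \<xi>)))) (at \<xi>)"
    if "\<xi> \<in> U" "\<And>i. i \<in> {1..n} \<Longrightarrow> u i differentiable_on U" for u :: "nat \<Rightarrow> real ^ 'p \<Rightarrow> real" and \<xi>
  proof -
    have "((\<lambda>\<xi>. \<Sum>i=1..n. u i \<xi>) has_derivative (\<lambda>x. \<Sum>i=1..n. \<Sum>k\<in>UNIV. x $ k * partial U k (u i) \<xi>)) (at \<xi>)"
      by (intro has_derivative_sum has_derivative_partial[OF op that(1)] that(2))
    from has_derivative_mult_right[OF this, of "- a"] show ?thesis
    proof (rule has_derivative_eq_rhs, intro ext)
      fix x :: "real ^ 'p"
      have eq: "(\<Sum>i=1..n. \<Sum>k\<in>UNIV. x $ k * partial U k (u i) \<xi>) = (\<Sum>k\<in>UNIV. x $ k * (\<Sum>i=1..n. partial U k (u i) \<xi>))"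
        unfolding sum_distrib_left by (rule sum.swap)
      show "- a * (\<Sum>i=1..n. \<Sum>k\<in>UNIV. x $ k * partial U k (u i) \<xi>)
        = (\<Sum>k\<in>UNIV. x $ k * (- a * (\<Sum>i=1..n. partial U k (u i) \<xi>)))"
        unfolding eq by (subst sum_distrib_left) (simp only: mult.left_commute)
    qed
  qed
  have dQ: "(Q has_derivative (\<lambda>x. \<Sum>k\<in>UNIV. x $ k * G k \<xi>)) (at \<xi>)" if "\<xi> \<in> U" for \<xi>
  proof -
    have "((\<lambda>\<xi>. c0 + (- a * (\<Sum>i=1..n. v i \<xi>))) has_derivative (\<lambda>x. 0 + (\<Sum>k\<in>UNIV. x $ k * G k \<xi>))) (at \<xi>)"
      unfolding G_def by (intro has_derivative_add has_derivative_const comb that d)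
    then show ?thesis using that Q
      by (intro has_derivative_cong_open[OF op that, of "\<lambda>\<xi>. c0 + (- a * (\<Sum>i=1..n. v i \<xi>))" Q]) simp_all
  qed
  have dG: "(G k has_derivative (\<lambda>x. \<Sum>j\<in>UNIV. x $ j * H j k \<xi>)) (at \<xi>)" if "\<xi> \<in> U" for k \<xi>
    unfolding G_def[abs_def] H_def by (intro comb that d)
  have dH: "(H j k has_derivative (\<lambda>x. \<Sum>l\<in>UNIV. x $ l * T3 l j k \<xi>)) (at \<xi>)" if "\<xi> \<in> U" for j k \<xi>
    unfolding H_def[abs_def] T3_def by (intro comb that d)
  have "(\<lambda>x. \<Sum>k\<in>UNIV. x $ k * G k \<theta>hat) = (\<lambda>x. 0)"
    using max by (intro differential_zero_maxmin[OF hat op dQ[OF hat]]) blast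
  from fun_cong[OF this, of "\<theta> - \<theta>hat"] have grad: "(\<Sum>k\<in>UNIV. (\<theta> - \<theta>hat) $ k * G k \<theta>hat) = 0" .
  define h where "h = \<theta> - \<theta>hat"
  obtain \<xi> where \<xi>: "\<xi> \<in> U" "Q \<theta> = Q \<theta>hat + (\<Sum>k\<in>UNIV. \<Sum>j\<in>UNIV. h $ k * h $ j * H j k \<xi>) / 2"
    using taylor2_convex[OF conv hat \<theta> dQ dG] unfolding grad h_def by auto
  have Hbound: "\<bar>H j k \<xi> + real n * A $ j $ k\<bar> \<le> (2 * p * C * \<delta> + \<kappa>) * real n" for j k
  proof -
    have "\<bar>H j k \<xi> - H j k \<theta>g\<bar> \<le> (\<Sum>l\<in>(UNIV::'p set). C * real n) * norm (\<xi> - \<theta>g)"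
    proof (rule bounded_gradient_lipschitz[OF conv g \<xi>(1) dH])
      fix l \<zeta> assume \<zeta>: "\<zeta> \<in> U"
      have "\<bar>\<Sum>i=1..n. partial3 U l j k (v i) \<zeta>\<bar> \<le> C * real n"
        by (rule order_trans[OF sum_abs third[OF \<zeta>]])
      then have "a * \<bar>\<Sum>i=1..n. partial3 U l j k (v i) \<zeta>\<bar> \<le> 1 * (C * real n)"
        using a by (intro mult_mono) auto
      then show "\<bar>T3 l j k \<zeta>\<bar> \<le> C * real n" using a(1) by (simp add: T3_def abs_mult)
    qed
    also have "\<dots> = p * C * real n * norm (\<xi> - \<theta>g)" by (simp add: p_def)
    also have "\<dots> \<le> p * C * real n * (2 * \<delta>)"
      using \<xi>(1) C by (intro mult_left_mono) (auto simp: U dist_norm norm_minus_commute p_def)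
    finally have "\<bar>H j k \<xi> - H j k \<theta>g\<bar> \<le> (2 * p * C * \<delta>) * real n" by (simp add: mult_ac)
    moreover have "\<bar>H j k \<theta>g + real n * A $ j $ k\<bar> \<le> \<kappa> * real n"
      using second[of j k] unfolding H_def by linarith
    ultimately show ?thesis unfolding distrib_right by linarith
  qed
  have quad: "h \<bullet> (A *v h) = (\<Sum>j\<in>UNIV. \<Sum>k\<in>UNIV. h $ k * h $ j * A $ j $ k)"
    by (simp add: inner_vec_def matrix_vector_mult_def sum_distrib_left mult_ac)
  have "Q \<theta> - Q \<theta>hat + real n * (h \<bullet> (A *v h) / 2)
      = (\<Sum>k\<in>UNIV. \<Sum>j\<in>UNIV. h $ k * h $ j * (H j k \<xi> + real n * A $ j $ k)) / 2"
    unfolding \<xi>(2) quad sum.swap[of "\<lambda>j k. h $ k * h $ j * A $ j $ k"]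
    by (simp add: distrib_left sum.distrib sum_distrib_left mult_ac add_divide_distrib)
  also have "\<bar>\<dots>\<bar> \<le> (\<Sum>k\<in>(UNIV::'p set). \<Sum>j\<in>(UNIV::'p set). (norm h)^2 * ((2 * p * C * \<delta> + \<kappa>) * real n)) / 2"
  proof -
    have "\<bar>\<Sum>k\<in>UNIV. \<Sum>j\<in>UNIV. h $ k * h $ j * (H j k \<xi> + real n * A $ j $ k)\<bar>
       \<le> (\<Sum>k\<in>(UNIV::'p set). \<Sum>j\<in>(UNIV::'p set). (norm h)^2 * ((2 * p * C * \<delta> + \<kappa>) * real n))"
    proof (intro order_trans[OF sum_abs] sum_mono)
      fix k j :: 'p
      show "\<bar>h $ k * h $ j * (H j k \<xi> + real n * A $ j $ k)\<bar> \<le> (norm h)^2 * ((2 * p * C * \<delta> + \<kappa>) * real n)"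
        unfolding abs_mult[of "h $ k * h $ j"] by (intro mult_mono norm_nth_mult_le Hbound) auto
    qed
    then show ?thesis by simp
  qed
  also have "\<dots> = real n * (p^2 * (2 * p * C * \<delta> + \<kappa>) / 2 * (norm h)^2)"
    by (simp add: p_def power2_eq_square)
  finally show ?thesis unfolding p_def h_def .
qed

section \<open>Measurable versions under the completed law\<close>

lemma is_density_measurable: "is_density lam g \<Longrightarrow> g \<in> borel_measurable lam"
  by (simp add: is_density_def)

text \<open>
  A function that is only measurable up to null sets has to be replaced by a measurable version
  before it may be composed with an observation. Dividing by \<open>g\<close> is harmless, since only points with
  \<open>0 < g x\<close> count.
\<close>

lemma law_measurable_version:
  assumes g: "is_density lam g" and h: "integrable (completion lam) h"
    and eq: "AE x in lam. h x = g x * P x"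
  obtains P' where "P' \<in> borel_measurable lam" "AE x in density lam (\<lambda>x. ennreal (g x)). P x = P' x"
    "integrable (density lam (\<lambda>x. ennreal (g x))) P'"
proof -
  have [measurable]: "g \<in> borel_measurable lam" and g0: "\<And>x. x \<in> space lam \<Longrightarrow> 0 \<le> g x"
    using g by (auto simp: is_density_def)
  obtain h' where [measurable]: "h' \<in> borel_measurable lam" and h': "AE x in lam. h x = h' x"
    using completion_ex_borel_measurable_real[OF borel_measurable_integrable[OF h]] by blast
  have "integrable (completion lam) h'"
    using h' by (intro integrable_cong_AE_imp[OF h]) (auto intro: measurable_completion AE_completion)
  then have int: "integrable lam h'" by (simp add: integrable_completion)
  define P' where "P' x = h' x / g x" for x
  have [measurable]: "P' \<in> borel_measurable lam" unfolding P'_def[abs_def] by measurable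
  have "AE x in lam. 0 < g x \<longrightarrow> P x = P' x"
    using eq h' by eventually_elim (auto simp: P'_def)
  then have "AE x in density lam (\<lambda>x. ennreal (g x)). P x = P' x"
    by (subst AE_density) (auto simp: ennreal_less_zero_iff)
  moreover have "integrable lam (\<lambda>x. g x *\<^sub>R P' x)"
    by (rule Bochner_Integration.integrable_bound[OF int]) (auto simp: P'_def)
  then have "integrable (density lam (\<lambda>x. ennreal (g x))) P'"
    using g0 by (subst integrable_density) auto
  ultimately show thesis using that by auto
qed

lemma completion_measurable_AE:
  fixes P P' :: "'a \<Rightarrow> real"
  assumes [measurable]: "P' \<in> borel_measurable N" and eq: "AE x in N. P x = P' x"
  shows "P \<in> borel_measurable (completion N)"
proof (rule measurableI)
  fix A :: "real set" assume [measurable]: "A \<in> sets borel"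
  show "P -` A \<inter> space (completion N) \<in> sets (completion N)"
  proof (rule completion.in_sets_AE)
    show "P' -` A \<inter> space N \<in> sets (completion N)" by (intro sets_completionI_sets) measurable
    show "AE x in completion N. (x \<in> P' -` A \<inter> space N) = (x \<in> P -` A \<inter> space (completion N))"
      using AE_completion[OF eq] by eventually_elim auto
  qed auto
qed auto

lemma integral_law_version:
  fixes P P' :: "'a \<Rightarrow> real"
  assumes "P' \<in> borel_measurable lam" "AE x in density lam (\<lambda>x. ennreal (g x)). P x = P' x"
  shows "(\<integral>x. P x \<partial>law lam g) = (\<integral>x. P' x \<partial>density lam (\<lambda>x. ennreal (g x)))"
proof -
  have [measurable]: "P' \<in> borel_measurable (density lam (\<lambda>x. ennreal (g x)))" using assms(1) by simp
  have "(\<integral>x. P x \<partial>law lam g) = (\<integral>x. P' x \<partial>law lam g)"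
    unfolding law_def using assms(2)
    by (intro integral_cong_AE completion_measurable_AE[OF _ assms(2)] measurable_completion AE_completion) auto
  then show ?thesis by (simp add: law_def integral_completion)
qed

lemma true_modelD:
  assumes "true_model M lam X g"
  shows "prob_space M" "sigma_finite_measure lam" "prob_space.indep_vars M (\<lambda>_. lam) X {1..}"
    "\<And>i. 1 \<le> i \<Longrightarrow> is_density lam (g i)" "\<And>i. 1 \<le> i \<Longrightarrow> X i \<in> measurable M lam"
    "\<And>i. 1 \<le> i \<Longrightarrow> distr M lam (X i) = density lam (\<lambda>x. ennreal (g i x))"
  using assms by (auto simp: true_model_def distributed_def)

lemma true_model_AE:
  assumes tm: "true_model M lam X g" and i: "1 \<le> i" and P: "AE x in density lam (\<lambda>x. ennreal (g i x)). P x"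
  shows "AE w in M. P (X i w)"
  using AE_distrD[OF true_modelD(5)[OF tm i]] P unfolding true_modelD(6)[OF tm i] by blast

lemma true_model_integral:
  fixes P' :: "'a \<Rightarrow> real"
  assumes tm: "true_model M lam X g" and i: "1 \<le> i" and P: "P' \<in> borel_measurable lam"
    "integrable (density lam (\<lambda>x. ennreal (g i x))) P'"
  shows "integrable M (\<lambda>w. P' (X i w))"
    "(\<integral>w. P' (X i w) \<partial>M) = (\<integral>x. P' x \<partial>density lam (\<lambda>x. ennreal (g i x)))"
proof -
  show "integrable M (\<lambda>w. P' (X i w))"
    using P(2) unfolding true_modelD(6)[OF tm i, symmetric]
    by (subst (asm) integrable_distr_eq) (use P true_modelD(5)[OF tm i] in auto)
  show "(\<integral>w. P' (X i w) \<partial>M) = (\<integral>x. P' x \<partial>density lam (\<lambda>x. ennreal (g i x)))"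
    unfolding true_modelD(6)[OF tm i, symmetric]
    by (subst integral_distr) (use P true_modelD(5)[OF tm i] in auto)
qed

text \<open>
  The tail condition is stated for \<open>D\<close> under the completed law, the conclusion for the measurable
  version \<open>D'\<close> at the observations; the expectations agree.
\<close>

lemma law_of_large_numbers_law:
  fixes D :: "nat \<Rightarrow> 'a \<Rightarrow> real"
  assumes tm: "true_model M lam X g"
    and D': "\<And>i. 1 \<le> i \<Longrightarrow> D' i \<in> borel_measurable lam"
      "\<And>i. 1 \<le> i \<Longrightarrow> AE x in density lam (\<lambda>x. ennreal (g i x)). D i x = D' i x"
      "\<And>i. 1 \<le> i \<Longrightarrow> integrable (density lam (\<lambda>x. ennreal (g i x))) (D' i)"
    and tails: "averaged_tails_vanish lam g (\<lambda>i x. D i x - (\<integral>y. D i y \<partial>law lam (g i)))"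
    and \<epsilon>: "0 < \<epsilon>"
  shows "(\<lambda>n. measure M {w \<in> space M.
     \<epsilon> < \<bar>(\<Sum>i=1..n. D' i (X i w) - (\<integral>y. D i y \<partial>law lam (g i))) / real n\<bar>}) \<longlonglongrightarrow> 0"
proof -
  interpret prob_space M by (rule true_modelD(1)[OF tm])
  define m where "m i = (\<integral>y. D i y \<partial>law lam (g i))" for i
  define Y where "Y i w = D' i (X i w) - m i" for i w
  have int: "integrable M (\<lambda>w. D' i (X i w))" if "1 \<le> i" for i
    by (rule true_model_integral(1)[OF tm that D'(1,3)[OF that]])
  have mE: "m i = expectation (\<lambda>w. D' i (X i w))" if "1 \<le> i" for i
    unfolding m_def integral_law_version[OF D'(1,2)[OF that]]
    by (rule true_model_integral(2)[OF tm that D'(1,3)[OF that], symmetric])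
  have indep: "indep_vars (\<lambda>_. borel) Y {1..}"
    unfolding Y_def[abs_def] using D'(1)
    by (intro indep_vars_compose2[OF true_modelD(3)[OF tm]] borel_measurable_diff) auto
  have nn: "(\<integral>\<^sup>+w. ennreal (\<bar>Y i w\<bar> * indicator {y. \<bar>y\<bar> > N} (Y i w)) \<partial>M)
     = (\<integral>\<^sup>+x. ennreal (\<bar>D i x - m i\<bar> * indicator {y. \<bar>D i y - m i\<bar> > N} x) \<partial>law lam (g i))" if i: "1 \<le> i" for i N
  proof -
    have [measurable]: "D' i \<in> borel_measurable lam" "X i \<in> measurable M lam" using D'(1) true_modelD(5)[OF tm] i by auto
    have "(\<integral>\<^sup>+x. ennreal (\<bar>D i x - m i\<bar> * indicator {y. \<bar>D i y - m i\<bar> > N} x) \<partial>law lam (g i))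
      = (\<integral>\<^sup>+x. ennreal (\<bar>D i x - m i\<bar> * indicator {y. \<bar>D i y - m i\<bar> > N} x) \<partial>density lam (\<lambda>x. ennreal (g i x)))"
      unfolding law_def by (rule nn_integral_completion)
    also have "\<dots> = (\<integral>\<^sup>+x. ennreal (\<bar>D' i x - m i\<bar> * indicator {y. \<bar>y\<bar> > N} (D' i x - m i)) \<partial>density lam (\<lambda>x. ennreal (g i x)))"
      by (rule nn_integral_cong_AE[OF AE_mp[OF D'(2)[OF i] AE_I2]]) (simp add: indicator_def)
    also have "\<dots> = (\<integral>\<^sup>+w. ennreal (\<bar>Y i w\<bar> * indicator {y. \<bar>y\<bar> > N} (Y i w)) \<partial>M)"
      unfolding true_modelD(6)[OF tm i, symmetric] Y_def by (subst nn_integral_distr) simp_all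
    finally show ?thesis by simp
  qed
  have "(\<lambda>n. prob {w \<in> space M. \<epsilon> < \<bar>(\<Sum>i=1..n. Y i w) / real n\<bar>}) \<longlonglongrightarrow> 0"
  proof (rule weak_law_averaged_tails[OF indep _ _ _ \<epsilon>])
    show "integrable M (Y i)" if "1 \<le> i" for i unfolding Y_def[abs_def] using int[OF that] by simp
    show "expectation (Y i) = 0" if "1 \<le> i" for i
      unfolding Y_def[abs_def] using int[OF that] mE[OF that] by (simp add: prob_space)
    have "(\<Sum>i=1..n. \<integral>\<^sup>+w. ennreal (\<bar>Y i w\<bar> * indicator {y. \<bar>y\<bar> > N} (Y i w)) \<partial>M)
      = (\<Sum>i=1..n. \<integral>\<^sup>+x. ennreal (\<bar>D i x - m i\<bar> * indicator {y. \<bar>D i y - m i\<bar> > N} x) \<partial>law lam (g i))" for n N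
      by (rule sum.cong[OF refl nn]) simp
    then show "((\<lambda>N::real. SUP n\<in>{1<..}.
         (\<Sum>i=1..n. \<integral>\<^sup>+w. ennreal (\<bar>Y i w\<bar> * indicator {y. \<bar>y\<bar> > N} (Y i w)) \<partial>M) / ennreal (real n)) \<longlongrightarrow> 0) at_top"
      using tails unfolding averaged_tails_vanish_def m_def[symmetric] by (simp only:)
  qed
  then show ?thesis unfolding Y_def m_def .
qed

section \<open>Derivatives of the divergence contributions\<close>

lemma partial2_add_cmult:
  fixes h u :: "real ^ 'p \<Rightarrow> real"
  assumes U: "open U" "\<theta> \<in> U" and h: "thrice_differentiable_on h U" and u: "thrice_differentiable_on u U"
  shows "partial2 U j k (\<lambda>\<theta>. h \<theta> + c * u \<theta>) \<theta> = partial2 U j k h \<theta> + c * partial2 U j k u \<theta>"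
proof -
  have d: "h differentiable_on U" "partial U k h differentiable_on U"
    "u differentiable_on U" "partial U k u differentiable_on U"
    using h u unfolding thrice_differentiable_on_def by blast+
  have dc: "(\<lambda>\<theta>. c * w \<theta>) differentiable_on U" if "w differentiable_on U" for w :: "real ^ 'p \<Rightarrow> real"
    using that by (intro differentiable_on_mult differentiable_on_const)
  have "partial U k (\<lambda>\<theta>. h \<theta> + c * u \<theta>) \<eta> = partial U k h \<eta> + c * partial U k u \<eta>" if "\<eta> \<in> U" for \<eta>
    by (simp only: partial_add[OF U(1) that d(1) dc[OF d(3)]] partial_cmult[OF U(1) that d(3)])
  from partial_cong[OF U this] have "partial2 U j k (\<lambda>\<theta>. h \<theta> + c * u \<theta>) \<theta>
      = partial U j (\<lambda>\<eta>. partial U k h \<eta> + c * partial U k u \<eta>) \<theta>" .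
  then show ?thesis
    by (simp only: partial_add[OF U d(2) dc[OF d(4)]] partial_cmult[OF U d(4)])
qed

lemma partial2_cmult:
  fixes u :: "real ^ 'p \<Rightarrow> real"
  assumes U: "open U" "\<theta> \<in> U" and u: "thrice_differentiable_on u U"
  shows "partial2 U j k (\<lambda>\<theta>. c * u \<theta>) \<theta> = c * partial2 U j k u \<theta>"
proof -
  have d: "u differentiable_on U" "partial U k u differentiable_on U"
    using u unfolding thrice_differentiable_on_def by blast+
  show ?thesis
    using partial_cong[OF U partial_cmult[OF U(1) _ d(1)]] by (simp only: partial_cmult[OF U d(2)])
qed

lemma thrice_differentiable_on_open_subset:
  assumes "open U" "U \<subseteq> T" "thrice_differentiable_on h T"
  shows "thrice_differentiable_on h U"
  using times_differentiable_on_open_subset[OF assms(1,2)] assms(3) unfolding thrice_differentiable_iff_times .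

text \<open>
  The differentiability of the power comes from that of the density by the chain rule, as the density
  is positive at \<open>x\<close>; the differentiability of the integral is part of (A3).
\<close>

lemma V_regular:
  fixes f :: "nat \<Rightarrow> real ^ 'p \<Rightarrow> 'a \<Rightarrow> real"
  assumes pf: "parametric_family lam T f" and A3: "cond_A3 \<alpha> lam g f T" and i: "1 \<le> i"
    and U: "open U" "U \<subseteq> T" and pos: "\<And>\<theta>. \<theta> \<in> T \<Longrightarrow> 0 < f i \<theta> x"
    and diff: "thrice_differentiable_on (\<lambda>\<theta>. f i \<theta> x) T"
  shows "thrice_differentiable_on (V \<alpha> lam f i x) U"
    and "thrice_differentiable_on (\<lambda>\<theta>. f i \<theta> x powr \<alpha>) U"
    and "\<theta> \<in> U \<Longrightarrow> partial2 U j k (V \<alpha> lam f i x) \<theta>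
      = partial2 U j k (\<lambda>\<theta>. \<integral>y. f i \<theta> y powr (1 + \<alpha>) \<partial>lam) \<theta>
        + (- (1 + 1 / \<alpha>)) * partial2 U j k (\<lambda>\<theta>. f i \<theta> x powr \<alpha>) \<theta>"
proof -
  let ?c = "\<lambda>\<theta>. \<integral>y. f i \<theta> y powr (1 + \<alpha>) \<partial>lam"
  have ceq: "(\<integral>y. f i \<theta> y powr (1 + \<alpha>) \<partial>completion lam) = ?c \<theta>" if "\<theta> \<in> U" for \<theta>
  proof -
    have "is_density lam (f i \<theta>)" using pf i that U(2) unfolding parametric_family_def by blast
    then have [measurable]: "f i \<theta> \<in> borel_measurable lam" by (rule is_density_measurable)
    show ?thesis by (rule integral_completion) measurable
  qed
  have "thrice_differentiable_on (\<lambda>\<theta>. \<integral>y. f i \<theta> y powr (1 + \<alpha>) \<partial>completion lam) T"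
    using A3 i unfolding cond_A3_def thrice_differentiable_under_integral_def by blast
  from thrice_differentiable_on_open_subset[OF U this]
  have c: "thrice_differentiable_on ?c U"
    unfolding thrice_differentiable_iff_times by (rule times_differentiable_on_cong[OF U(1) _ ceq])
  have pos': "0 < f i \<theta> x" if "\<theta> \<in> U" for \<theta> using pos that U(2) by blast
  show p: "thrice_differentiable_on (\<lambda>\<theta>. f i \<theta> x powr \<alpha>) U"
    using thrice_differentiable_on_open_subset[OF U diff] unfolding thrice_differentiable_iff_times
    by (intro times_differentiable_on_powr U pos')
  have V: "V \<alpha> lam f i x = (\<lambda>\<theta>. ?c \<theta> + (- (1 + 1 / \<alpha>)) * f i \<theta> x powr \<alpha>)"
    unfolding V_def by (simp only: diff_conv_add_uminus mult_minus_left)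
  show "thrice_differentiable_on (V \<alpha> lam f i x) U"
    using c p unfolding V thrice_differentiable_iff_times
    by (intro times_differentiable_on_add times_differentiable_on_mult times_differentiable_on_const U)
  show "\<theta> \<in> U \<Longrightarrow> partial2 U j k (V \<alpha> lam f i x) \<theta>
      = partial2 U j k ?c \<theta> + (- (1 + 1 / \<alpha>)) * partial2 U j k (\<lambda>\<theta>. f i \<theta> x powr \<alpha>) \<theta>"
    unfolding V by (rule partial2_add_cmult[OF U(1) _ c p])
qed

lemma AE_density_law:
  assumes "g \<in> borel_measurable lam"
  shows "(AE x in law lam g. P x) \<longleftrightarrow> (AE x in density lam (\<lambda>x. ennreal (g x)). P x)"
    and "(AE x in density lam (\<lambda>x. ennreal (g x)). P x) \<longleftrightarrow> (AE x in lam. 0 < g x \<longrightarrow> P x)"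
  using assms unfolding law_def AE_completion_iff by (simp_all add: AE_density)

text \<open>
  The regularity in (A2) is only asserted on \<open>S\<close>, but almost every observation lies there by (A1).
\<close>

lemma AE_regular_points:
  fixes f :: "nat \<Rightarrow> real ^ 'p \<Rightarrow> 'a \<Rightarrow> real"
  assumes g: "\<And>i. 1 \<le> i \<Longrightarrow> is_density lam (g i)"
    and A1: "cond_A1 lam g f T S" and A2: "cond_A2 lam f T S \<theta>g" and i: "1 \<le> i"
  shows "AE x in density lam (\<lambda>x. ennreal (g i x)). x \<in> S \<and> (\<forall>m\<ge>1. thrice_differentiable_on (\<lambda>\<theta>. f m \<theta> x) T)"
proof -
  have gm: "g i \<in> borel_measurable lam" by (rule is_density_measurable[OF g[OF i]])
  have "AE x in density lam (\<lambda>x. ennreal (g i x)). x \<in> S"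
    by (rule AE_density_law(1)[OF gm, THEN iffD1, OF conjunct2[OF A1[unfolded cond_A1_def], rule_format, OF i]])
  moreover have "AE x in lam. x \<in> S \<longrightarrow> (\<forall>m\<ge>1. thrice_differentiable_on (\<lambda>\<theta>. f m \<theta> x) T)"
    by (rule AE_mp[OF conjunct2[OF A2[unfolded cond_A2_def]] AE_I2]) blast
  then have "AE x in density lam (\<lambda>x. ennreal (g i x)). x \<in> S \<longrightarrow> (\<forall>m\<ge>1. thrice_differentiable_on (\<lambda>\<theta>. f m \<theta> x) T)"
    unfolding AE_density_law(2)[OF gm] by (rule AE_mp) (rule AE_I2, blast)
  ultimately show ?thesis by (rule AE_mp[OF AE_conjI]) (rule AE_I2, blast)
qed

text \<open>
  (A3) provides the integrability of the second derivatives of the density power times \<open>g\<close>. At a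
  regular point the factor \<open>g i x\<close> may be taken out of the derivative, and where it is zero, both sides vanish.
\<close>

lemma hessian_measurable_version:
  fixes f :: "nat \<Rightarrow> real ^ 'p \<Rightarrow> 'a \<Rightarrow> real"
  assumes tm: "true_model M lam X g" and pf: "parametric_family lam T f"
    and A1: "cond_A1 lam g f T S" and A2: "cond_A2 lam f T S \<theta>g" and A3: "cond_A3 \<alpha> lam g f T"
    and U: "open U" "U \<subseteq> T" "\<theta>g \<in> U" and i: "1 \<le> i"
  obtains D' where "D' \<in> borel_measurable lam"
    "AE x in density lam (\<lambda>x. ennreal (g i x)). partial2 T j k (V \<alpha> lam f i x) \<theta>g = D' x"
    "integrable (density lam (\<lambda>x. ennreal (g i x))) D'"
proof -
  have g: "\<And>i. 1 \<le> i \<Longrightarrow> is_density lam (g i)" by (rule true_modelD(4)[OF tm])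
  have gm: "g i \<in> borel_measurable lam" by (rule is_density_measurable[OF g[OF i]])
  have g0: "\<And>x. x \<in> space lam \<Longrightarrow> 0 \<le> g i x" using g[OF i] by (simp add: is_density_def)
  let ?N = "density lam (\<lambda>x. ennreal (g i x))"
  define P where "P x = partial2 T j k (\<lambda>\<theta>. f i \<theta> x powr \<alpha>) \<theta>g" for x
  define c2 where "c2 = partial2 U j k (\<lambda>\<theta>. \<integral>y. f i \<theta> y powr (1 + \<alpha>) \<partial>lam) \<theta>g"
  have pos: "0 < f i \<theta> x" if "x \<in> S" "\<theta> \<in> T" for x \<theta>
    using A1 i that unfolding cond_A1_def by blast
  have reg: "AE x in ?N. x \<in> S \<and> (\<forall>m\<ge>1. thrice_differentiable_on (\<lambda>\<theta>. f m \<theta> x) T)"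
    by (rule AE_regular_points[OF g A1 A2 i])
  have T: "\<theta>g \<in> T" using U by blast
  have int: "integrable (completion lam) (\<lambda>x. partial2 T j k (\<lambda>\<theta>. f i \<theta> x powr \<alpha> * g i x) \<theta>g)"
    using A3 i T unfolding cond_A3_def thrice_differentiable_under_integral_def by blast
  have scale: "partial2 T j k (\<lambda>\<theta>. f i \<theta> x powr \<alpha> * g i x) \<theta>g = g i x * P x"
    if "0 < g i x \<longrightarrow> x \<in> S \<and> (\<forall>m\<ge>1. thrice_differentiable_on (\<lambda>\<theta>. f m \<theta> x) T)" "x \<in> space lam" for x
  proof (cases "0 < g i x")
    case True
    have "thrice_differentiable_on (\<lambda>\<theta>. f i \<theta> x powr \<alpha>) U"
      by (rule V_regular(2)[OF pf A3 i U(1,2) pos]) (use that True i in auto)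
    from partial2_cmult[OF U(1,3) this, of j k "g i x"]
    show ?thesis unfolding P_def partial2_open_subset[OF U] by (simp only: mult.commute[of "g i x"])
  next
    case False
    then have g0: "g i x = 0" using g0[OF that(2)] by simp
    have "thrice_differentiable_on (\<lambda>_. 0) U"
      unfolding thrice_differentiable_iff_times by (rule times_differentiable_on_const[OF U(1)])
    from partial2_cmult[OF U(1,3) this, of j k 0]
    show ?thesis unfolding g0 partial2_open_subset[OF U] by simp
  qed
  have "AE x in lam. partial2 T j k (\<lambda>\<theta>. f i \<theta> x powr \<alpha> * g i x) \<theta>g = g i x * P x"
    using reg unfolding AE_density_law(2)[OF gm] by (rule AE_mp) (rule AE_I2, rule impI, rule scale)
  from law_measurable_version[OF g[OF i] int this]
  obtain P' where P': "P' \<in> borel_measurable lam" "AE x in ?N. P x = P' x" "integrable ?N P'" by blast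
  interpret M: prob_space M by (rule true_modelD(1)[OF tm])
  interpret N: prob_space ?N
    unfolding true_modelD(6)[OF tm i, symmetric] by (rule M.prob_space_distr[OF true_modelD(5)[OF tm i]])
  have V: "partial2 T j k (V \<alpha> lam f i x) \<theta>g = c2 + (- (1 + 1 / \<alpha>)) * P x"
    if "x \<in> S \<and> (\<forall>m\<ge>1. thrice_differentiable_on (\<lambda>\<theta>. f m \<theta> x) T)" for x
    unfolding P_def c2_def partial2_open_subset[OF U]
    by (rule V_regular(3)[OF pf A3 i U(1,2) pos _ U(3)]) (use that i in auto)
  show thesis
  proof
    show "(\<lambda>x. c2 + (- (1 + 1 / \<alpha>)) * P' x) \<in> borel_measurable lam"
      using P'(1) by (intro borel_measurable_add borel_measurable_times borel_measurable_const)
    show "AE x in ?N. partial2 T j k (V \<alpha> lam f i x) \<theta>g = c2 + (- (1 + 1 / \<alpha>)) * P' x"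
      by (rule AE_mp[OF AE_conjI[OF reg P'(2)] AE_I2]) (use V in \<open>auto simp only:\<close>)
    show "integrable ?N (\<lambda>x. c2 + (- (1 + 1 / \<alpha>)) * P' x)"
      using P'(3) by (intro Bochner_Integration.integrable_add integrable_mult_right N.integrable_const)
  qed
qed

text \<open>
  (A5) has one envelope for each triple of indices. Their sum is a common one, because each of them
  is almost everywhere non-negative.
\<close>

lemma third_derivative_envelope:
  fixes f :: "nat \<Rightarrow> real ^ 'p \<Rightarrow> 'a \<Rightarrow> real"
  assumes tm: "true_model M lam X g" and A1: "cond_A1 lam g f T S" and A5: "cond_A5 \<alpha> lam g f T S"
    and T: "T \<noteq> {}"
  obtains B and C :: real and n0 :: nat where "\<And>i. 1 \<le> i \<Longrightarrow> B i \<in> borel_measurable lam"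
    "\<And>i. 1 \<le> i \<Longrightarrow> integrable (density lam (\<lambda>x. ennreal (g i x))) (B i)"
    "\<And>i. 1 \<le> i \<Longrightarrow> AE x in density lam (\<lambda>x. ennreal (g i x)).
        0 \<le> B i x \<and> (\<forall>j k l. \<forall>\<theta>\<in>T. \<bar>partial3 T j k l (V \<alpha> lam f i x) \<theta>\<bar> \<le> B i x)"
    "\<And>n. n0 \<le> n \<Longrightarrow> (\<Sum>i=1..n. \<integral>x. B i x \<partial>density lam (\<lambda>x. ennreal (g i x))) \<le> C * real n" "0 \<le> C"
proof -
  let ?N = "\<lambda>i. density lam (\<lambda>x. ennreal (g i x))"
  have gm: "g i \<in> borel_measurable lam" if "1 \<le> i" for i by (rule is_density_measurable[OF true_modelD(4)[OF tm that]])
  define admissible where "admissible j k l B C n0 \<longleftrightarrow> (\<forall>i\<ge>1. B i \<in> borel_measurable lam \<and> integrable (?N i) (B i) \<and>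
        (AE x in ?N i. \<forall>\<theta>\<in>T. \<bar>partial3 T j k l (V \<alpha> lam f i x) \<theta>\<bar> \<le> B i x)) \<and>
        (\<forall>n\<ge>n0. (\<Sum>i=1..n. \<integral>x. B i x \<partial>?N i) \<le> C * real n) \<and> 0 \<le> C"
    for j k l :: 'p and B :: "nat \<Rightarrow> 'a \<Rightarrow> real" and C :: real and n0 :: nat
  have "\<exists>t. case t of (B, C, n0) \<Rightarrow> admissible j k l B C n0" for j k l
  proof -
    from A5[unfolded cond_A5_def, THEN spec[of _ j], THEN spec[of _ k], THEN spec[of _ l]]
    obtain B0 :: "nat \<Rightarrow> 'a \<Rightarrow> real" where B0a: "\<forall>i\<ge>1. integrable (law lam (g i)) (B0 i) \<and>
        (AE x in lam. x \<in> S \<longrightarrow> (\<forall>\<theta>\<in>T. \<bar>partial3 T j k l (V \<alpha> lam f i x) \<theta>\<bar> \<le> B0 i x))"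
      and B0b: "(\<lambda>n. 1 / real n * (\<Sum>i=1..n. \<integral>x. B0 i x \<partial>law lam (g i))) \<in> O(\<lambda>_. 1)"
      by (elim exE conjE)
    have B0: "\<And>i. 1 \<le> i \<Longrightarrow> integrable (law lam (g i)) (B0 i)"
      "\<And>i. 1 \<le> i \<Longrightarrow> AE x in lam. x \<in> S \<longrightarrow> (\<forall>\<theta>\<in>T. \<bar>partial3 T j k l (V \<alpha> lam f i x) \<theta>\<bar> \<le> B0 i x)"
      using B0a by simp_all
    have "\<exists>B. B \<in> borel_measurable lam \<and> (AE x in ?N i. B0 i x = B x)" if "1 \<le> i" for i
      using completion_ex_borel_measurable_real[OF borel_measurable_integrable[OF B0(1)[OF that, unfolded law_def]]] by auto
    then obtain B where B: "\<And>i. 1 \<le> i \<Longrightarrow> B i \<in> borel_measurable lam" "\<And>i. 1 \<le> i \<Longrightarrow> AE x in ?N i. B0 i x = B i x"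
      by metis
    have int: "integrable (?N i) (B i)" if "1 \<le> i" for i
    proof -
      have m: "B i \<in> borel_measurable (?N i)" using B(1)[OF that] by simp
      have "integrable (completion (?N i)) (B i)"
        by (rule integrable_cong_AE_imp[OF B0(1)[OF that, unfolded law_def] measurable_completion[OF m]])
          (use AE_completion[OF B(2)[OF that]] in \<open>eventually_elim, simp\<close>)
      then show ?thesis using integrable_completion[OF m] by simp
    qed
    have ae: "AE x in ?N i. \<forall>\<theta>\<in>T. \<bar>partial3 T j k l (V \<alpha> lam f i x) \<theta>\<bar> \<le> B i x" if i: "1 \<le> i" for i
    proof -
      have "AE x in ?N i. x \<in> S" 
        by (rule AE_density_law(1)[OF gm[OF i], THEN iffD1, OF conjunct2[OF A1[unfolded cond_A1_def], rule_format, OF i]])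
      moreover have "AE x in ?N i. x \<in> S \<longrightarrow> (\<forall>\<theta>\<in>T. \<bar>partial3 T j k l (V \<alpha> lam f i x) \<theta>\<bar> \<le> B0 i x)"
        using B0(2)[OF i] unfolding AE_density_law(2)[OF gm[OF i]] by (rule AE_mp) (rule AE_I2, blast)
      ultimately show ?thesis
        using B(2)[OF i] by eventually_elim simp
    qed
    obtain C where C0: "0 < C"
      "eventually (\<lambda>n. norm (1 / real n * (\<Sum>i=1..n. \<integral>x. B0 i x \<partial>law lam (g i))) \<le> C * norm (1 :: real)) sequentially"
      by (rule landau_o.bigE[OF B0b])
    then obtain n0 where C: "0 < C" "\<And>n. n0 \<le> n \<Longrightarrow> norm (1 / real n * (\<Sum>i=1..n. \<integral>x. B0 i x \<partial>law lam (g i))) \<le> C"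
      unfolding eventually_sequentially by auto
    have "(\<Sum>i=1..n. \<integral>x. B i x \<partial>?N i) \<le> C * real n" if "max 1 n0 \<le> n" for n
    proof -
      have "(\<Sum>i=1..n. \<integral>x. B i x \<partial>?N i) = (\<Sum>i=1..n. \<integral>x. B0 i x \<partial>law lam (g i))"
        by (rule sum.cong[OF refl]) (simp add: integral_law_version[OF B])
      moreover have "(\<Sum>i=1..n. \<integral>x. B0 i x \<partial>law lam (g i)) / real n \<le> C"
        using order_trans[OF abs_ge_self C(2)[of n, unfolded real_norm_def]] that by simp
      ultimately show ?thesis using that by (simp add: pos_divide_le_eq)
    qed
    then have "admissible j k l B C (max 1 n0)"
      unfolding admissible_def using B(1) int ae C(1) by simp
    then show ?thesis by (intro exI[of _ "(B, C, max 1 n0)"]) simp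
  qed
  then have "\<exists>F. \<forall>j k l. case F j k l of (B, C, n0) \<Rightarrow> admissible j k l B C n0"
    by (intro choice allI)
  then obtain F where F: "\<And>j k l. case F j k l of (B, C, n0) \<Rightarrow> admissible j k l B C n0" by blast
  define B where "B j k l = fst (F j k l)" for j k l
  define C where "C j k l = fst (snd (F j k l))" for j k l
  define n0 where "n0 j k l = snd (snd (F j k l))" for j k l
  have adm: "admissible j k l (B j k l) (C j k l) (n0 j k l)" for j k l
    using F[of j k l] by (simp add: B_def C_def n0_def split: prod.splits)
  have BC: "\<And>j k l i. 1 \<le> i \<Longrightarrow> B j k l i \<in> borel_measurable lam"
    "\<And>j k l i. 1 \<le> i \<Longrightarrow> integrable (?N i) (B j k l i)"
    "\<And>j k l i. 1 \<le> i \<Longrightarrow> AE x in ?N i. \<forall>\<theta>\<in>T. \<bar>partial3 T j k l (V \<alpha> lam f i x) \<theta>\<bar> \<le> B j k l i x"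
    "\<And>j k l n. n0 j k l \<le> n \<Longrightarrow> (\<Sum>i=1..n. \<integral>x. B j k l i x \<partial>?N i) \<le> C j k l * real n" "\<And>j k l. 0 \<le> C j k l"
    using adm unfolding admissible_def by simp_all
  define J where "J = (UNIV :: ('p \<times> 'p \<times> 'p) set)"
  define B' where "B' i x = (\<Sum>(j,k,l)\<in>J. B j k l i x)" for i x
  define C' where "C' = (\<Sum>(j,k,l)\<in>J. C j k l)"
  define n' where "n' = (\<Sum>(j,k,l)\<in>J. n0 j k l)"
  have fin: "finite J" by (simp add: J_def)
  show thesis
  proof
    show "B' i \<in> borel_measurable lam" if "1 \<le> i" for i
      unfolding B'_def[abs_def] using BC(1)[OF that] by (intro borel_measurable_sum) auto
    show "integrable (?N i) (B' i)" if "1 \<le> i" for i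
      unfolding B'_def[abs_def] using BC(2)[OF that] by (intro Bochner_Integration.integrable_sum) auto
    show "0 \<le> C'" unfolding C'_def using BC(5) by (intro sum_nonneg) auto
    show "AE x in ?N i. 0 \<le> B' i x \<and> (\<forall>j k l. \<forall>\<theta>\<in>T. \<bar>partial3 T j k l (V \<alpha> lam f i x) \<theta>\<bar> \<le> B' i x)" if i: "1 \<le> i" for i
    proof -
      have "AE x in ?N i. \<forall>t\<in>J. case t of (j,k,l) \<Rightarrow> \<forall>\<theta>\<in>T. \<bar>partial3 T j k l (V \<alpha> lam f i x) \<theta>\<bar> \<le> B j k l i x"
        using BC(3)[OF i] by (intro AE_finite_allI[OF fin]) auto
      then show ?thesis
      proof (rule AE_mp, intro AE_I2 impI)
        fix x assume b: "\<forall>t\<in>J. case t of (j,k,l) \<Rightarrow> \<forall>\<theta>\<in>T. \<bar>partial3 T j k l (V \<alpha> lam f i x) \<theta>\<bar> \<le> B j k l i x"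
        then have b': "\<bar>partial3 T j k l (V \<alpha> lam f i x) \<theta>\<bar> \<le> B j k l i x" if "\<theta> \<in> T" for j k l \<theta>
          using that unfolding J_def by blast
        have nn: "0 \<le> B j k l i x" for j k l using b' T abs_ge_zero order_trans by blast
        have le: "B j k l i x \<le> B' i x" for j k l
          using member_le_sum[of "(j,k,l)" J "\<lambda>(j,k,l). B j k l i x"] nn fin by (auto simp: B'_def J_def)
        show "0 \<le> B' i x \<and> (\<forall>j k l. \<forall>\<theta>\<in>T. \<bar>partial3 T j k l (V \<alpha> lam f i x) \<theta>\<bar> \<le> B' i x)"
          using nn le b' order_trans by blast
      qed
    qed
    show "(\<Sum>i=1..n. \<integral>x. B' i x \<partial>?N i) \<le> C' * real n" if n: "n' \<le> n" for n
    proof -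
      have "n0 j k l \<le> n" for j k l
        using member_le_sum[of "(j,k,l)" J "\<lambda>(j,k,l). n0 j k l"] fin n by (auto simp: n'_def J_def)
      then have s: "(\<Sum>i=1..n. \<integral>x. B j k l i x \<partial>?N i) \<le> C j k l * real n" for j k l by (rule BC(4))
      have "(\<Sum>i=1..n. \<integral>x. B' i x \<partial>?N i) = (\<Sum>i=1..n. \<Sum>t\<in>J. case t of (j,k,l) \<Rightarrow> \<integral>x. B j k l i x \<partial>?N i)"
      proof (rule sum.cong[OF refl])
        fix i assume "i \<in> {1..n}"
        then show "(\<integral>x. B' i x \<partial>?N i) = (\<Sum>t\<in>J. case t of (j,k,l) \<Rightarrow> \<integral>x. B j k l i x \<partial>?N i)"
          unfolding B'_def using BC(2)[of i]
          by (subst Bochner_Integration.integral_sum) (auto simp: case_prod_beta)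
      qed
      also have "\<dots> = (\<Sum>t\<in>J. \<Sum>i=1..n. case t of (j,k,l) \<Rightarrow> \<integral>x. B j k l i x \<partial>?N i)" by (rule sum.swap)
      also have "\<dots> \<le> (\<Sum>t\<in>J. (case t of (j,k,l) \<Rightarrow> C j k l) * real n)"
        using s by (intro sum_mono) (auto simp: case_prod_beta)
      also have "\<dots> = C' * real n" by (simp add: C'_def sum_distrib_right case_prod_beta)
      finally show ?thesis .
    qed
  qed
qed

lemma average_bounded_in_probability:
  fixes B :: "nat \<Rightarrow> 'a \<Rightarrow> real"
  assumes tm: "true_model M lam X g" and B: "\<And>i. 1 \<le> i \<Longrightarrow> B i \<in> borel_measurable lam"
    "\<And>i. 1 \<le> i \<Longrightarrow> integrable (density lam (\<lambda>x. ennreal (g i x))) (B i)"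
    "\<And>i. 1 \<le> i \<Longrightarrow> AE x in density lam (\<lambda>x. ennreal (g i x)). 0 \<le> B i x"
    and C: "\<And>n. n0 \<le> n \<Longrightarrow> (\<Sum>i=1..n. \<integral>x. B i x \<partial>density lam (\<lambda>x. ennreal (g i x))) \<le> C * real n" "0 \<le> C"
    and \<eta>: "0 < \<eta>" and n: "n0 \<le> n" "1 \<le> n"
  shows "measure M {w \<in> space M. (C + 1) / \<eta> * real n \<le> (\<Sum>i=1..n. B i (X i w))} \<le> \<eta>"
proof -
  interpret prob_space M by (rule true_modelD(1)[OF tm])
  have int: "integrable M (\<lambda>w. B i (X i w))" if "1 \<le> i" for i by (rule true_model_integral(1)[OF tm that B(1,2)[OF that]])
  have ints: "integrable M (\<lambda>w. \<Sum>i=1..n. B i (X i w))" using int by (intro Bochner_Integration.integrable_sum) auto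
  have "AE w in M. \<forall>i\<in>{1..n}. 0 \<le> B i (X i w)"
    using true_model_AE[OF tm _ B(3)] by (intro AE_finite_allI) auto
  then have nn: "AE w in M. 0 \<le> (\<Sum>i=1..n. B i (X i w))"
    by (rule AE_mp) (rule AE_I2, intro impI sum_nonneg, blast)
  have pos: "0 < (C + 1) / \<eta> * real n" using C(2) \<eta> n by simp
  have "measure M {w \<in> space M. (C + 1) / \<eta> * real n \<le> (\<Sum>i=1..n. B i (X i w))}
     \<le> expectation (\<lambda>w. \<Sum>i=1..n. B i (X i w)) / ((C + 1) / \<eta> * real n)"
    by (rule integral_Markov_inequality_measure[OF ints sets.empty_sets nn pos])
  also have "expectation (\<lambda>w. \<Sum>i=1..n. B i (X i w)) = (\<Sum>i=1..n. \<integral>x. B i x \<partial>density lam (\<lambda>x. ennreal (g i x)))"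
    using int true_model_integral(2)[OF tm _ B(1,2)] by (subst Bochner_Integration.integral_sum) auto
  also have "(\<Sum>i=1..n. \<integral>x. B i x \<partial>density lam (\<lambda>x. ennreal (g i x))) / ((C + 1) / \<eta> * real n)
      \<le> (C + 1) * real n / ((C + 1) / \<eta> * real n)"
    using C(1)[OF n(1)] C(2) pos by (intro divide_right_mono) (auto simp: algebra_simps)
  also have "\<dots> = \<eta>" using C(2) \<eta> n by simp
  finally show ?thesis .
qed

section \<open>The limiting Hessian\<close>

text \<open>
  The second derivatives commute at almost every observation, and hence so do their expectations.
\<close>

lemma Psi_symmetric:
  fixes f :: "nat \<Rightarrow> real ^ 'p \<Rightarrow> 'a \<Rightarrow> real"
  assumes tm: "true_model M lam X g" and pf: "parametric_family lam T f"
    and A1: "cond_A1 lam g f T S" and A2: "cond_A2 lam f T S \<theta>g" and A3: "cond_A3 \<alpha> lam g f T"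
    and U: "open U" "U \<subseteq> T" "\<theta>g \<in> U"
  shows "transpose (Psi \<alpha> lam g f T n \<theta>g) = Psi \<alpha> lam g f T n \<theta>g"
proof -
  have "(\<integral>x. partial2 T k j (V \<alpha> lam f i x) \<theta>g \<partial>law lam (g i)) = (\<integral>x. partial2 T j k (V \<alpha> lam f i x) \<theta>g \<partial>law lam (g i))"
    if i: "1 \<le> i" for i j k
  proof -
    obtain D' where D': "D' \<in> borel_measurable lam"
      "AE x in density lam (\<lambda>x. ennreal (g i x)). partial2 T j k (V \<alpha> lam f i x) \<theta>g = D' x"
      using hessian_measurable_version[OF tm pf A1 A2 A3 U i] by blast
    have sym: "partial2 T k j (V \<alpha> lam f i x) \<theta>g = partial2 T j k (V \<alpha> lam f i x) \<theta>g"
      if x: "x \<in> S \<and> (\<forall>m\<ge>1. thrice_differentiable_on (\<lambda>\<theta>. f m \<theta> x) T)" for x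
    proof -
      have "thrice_differentiable_on (V \<alpha> lam f i x) U"
        by (rule V_regular(1)[OF pf A3 i U(1,2)]) (use A1 i x in \<open>unfold cond_A1_def, blast+\<close>)
      from partial2_symmetric[OF U(1,3) this] show ?thesis unfolding partial2_open_subset[OF U] .
    qed
    have "AE x in density lam (\<lambda>x. ennreal (g i x)). partial2 T k j (V \<alpha> lam f i x) \<theta>g = D' x"
      by (rule AE_mp[OF AE_conjI[OF D'(2) AE_regular_points[OF true_modelD(4)[OF tm] A1 A2 i]] AE_I2])
        (use sym in \<open>auto simp only:\<close>)
    then show ?thesis using integral_law_version[OF D'(1)] D'(2) by (simp only:)
  qed
  then have "(\<Sum>i=1..n. \<integral>x. partial2 T k j (V \<alpha> lam f i x) \<theta>g \<partial>law lam (g i))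
      = (\<Sum>i=1..n. \<integral>x. partial2 T j k (V \<alpha> lam f i x) \<theta>g \<partial>law lam (g i))" for j k
    by (intro sum.cong refl) simp
  then have "Psi \<alpha> lam g f T n \<theta>g $ k $ j = Psi \<alpha> lam g f T n \<theta>g $ j $ k" for j k
    unfolding Psi_def by (simp only: vec_lambda_beta)
  then show ?thesis by (simp add: transpose_def vec_eq_iff)
qed

lemma INF_min_eigenvalue_lower_bound:
  assumes "0 < (INF n\<in>{1..}. ereal (min_eigenvalue (A n)))"
  obtains c where "0 < c" "\<And>n :: nat. 1 \<le> n \<Longrightarrow> c \<le> min_eigenvalue (A n)"
proof -
  obtain c where c: "0 < ereal c" "ereal c < (INF n\<in>{1..}. ereal (min_eigenvalue (A n)))"
    using ereal_dense2[OF assms] by auto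
  have "c \<le> min_eigenvalue (A n)" if "1 \<le> n" for n
    using order_less_le_trans[OF c(2) INF_lower[of n "{1..}"]] that by simp
  then show thesis using that c(1) by simp
qed

text \<open>
  (A4) bounds the smallest eigenvalue below, (E3) the determinant above, and together they bound the
  largest eigenvalue.
\<close>

lemma Psi_uniformly_elliptic:
  fixes f :: "nat \<Rightarrow> real ^ 'p \<Rightarrow> 'a \<Rightarrow> real"
  assumes sym: "\<And>n. transpose (Psi \<alpha> lam g f T n \<theta>g) = Psi \<alpha> lam g f T n \<theta>g"
    and A4: "cond_A4 \<alpha> lam g f T \<theta>g" and E3: "cond_E3 \<alpha> lam g f T" and T: "\<theta>g \<in> T"
  obtains c K n0 where "0 < c" "c \<le> K"
    "\<And>n h. 1 \<le> n \<Longrightarrow> c * (norm h)^2 \<le> h \<bullet> (Psi \<alpha> lam g f T n \<theta>g *v h) / 2"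
    "\<And>n h. n0 \<le> n \<Longrightarrow> h \<bullet> (Psi \<alpha> lam g f T n \<theta>g *v h) / 2 \<le> K * (norm h)^2"
proof -
  let ?A = "\<lambda>n. Psi \<alpha> lam g f T n \<theta>g"
  obtain c where c: "0 < c" "\<And>n. 1 \<le> n \<Longrightarrow> c \<le> min_eigenvalue (?A n)"
    using INF_min_eigenvalue_lower_bound[OF A4[unfolded cond_A4_def]] by blast
  have lower: "c * (h \<bullet> h) \<le> h \<bullet> (?A n *v h)" if "1 \<le> n" for n h
    using mult_right_mono[OF c(2)[OF that], of "h \<bullet> h"] min_eigenvalue_le_quadratic_form[OF sym, of n h] by simp
  obtain n0 where n0: "(SUP n\<in>{n0..}. ereal (det (?A n))) < \<infinity>"
    using E3 T unfolding cond_E3_def by blast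
  then obtain D where D: "(SUP n\<in>{n0..}. ereal (det (?A n))) < ereal D"
    using ereal_dense2[OF n0] by blast
  have det: "det (?A n) \<le> D" if "n0 \<le> n" for n
    using order_le_less_trans[OF SUP_upper[of n "{n0..}"] D] that by simp
  define K where "K = max (c / 2) (D / c ^ (CARD('p) - 1) / 2)"
  show thesis
  proof
    show "0 < c / 2" "c / 2 \<le> K" using c by (auto simp: K_def)
    show "c / 2 * (norm h)^2 \<le> h \<bullet> (?A n *v h) / 2" if "1 \<le> n" for n h
      using lower[OF that, of h] by (simp add: power2_norm_eq_inner)
    show "h \<bullet> (?A n *v h) / 2 \<le> K * (norm h)^2" if n: "max 1 n0 \<le> n" for n h
    proof -
      have "h \<bullet> (?A n *v h) \<le> det (?A n) / c ^ (CARD('p) - 1) * (h \<bullet> h)"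
        using n by (intro quadratic_form_le_det_bound sym lower c) auto
      also have "\<dots> \<le> D / c ^ (CARD('p) - 1) * (h \<bullet> h)"
        using det[of n] n c(1) by (intro mult_right_mono divide_right_mono) auto
      finally have "h \<bullet> (?A n *v h) / 2 \<le> D / c ^ (CARD('p) - 1) / 2 * (h \<bullet> h)" by simp
      also have "\<dots> \<le> K * (h \<bullet> h)" by (intro mult_right_mono) (auto simp: K_def)
      finally show ?thesis by (simp add: power2_norm_eq_inner)
    qed
  qed
qed

section \<open>The posterior mean near the maximizer\<close>

lemma prior_densityD:
  assumes "prior_density T \<pi>"
  shows "\<And>\<theta>. 0 \<le> indicator T \<theta> * \<pi> \<theta>" "integrable lborel (\<lambda>\<theta>. indicator T \<theta> * \<pi> \<theta>)"
    "(\<integral>\<theta>. indicator T \<theta> * \<pi> \<theta> \<partial>lborel) = 1"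
  using assms by (auto simp: prior_density_def set_integrable_def set_lebesgue_integral_def indicator_def)

text \<open>
  Normalizing the likelihood by any constant \<open>q0\<close> changes neither the posterior nor its mean; for \<open>q0\<close>
  the maximal value, the weights \<open>exp b\<close> are at most \<open>1\<close>.
\<close>

lemma expected_R_posterior_minus:
  fixes a :: "real ^ 'p"
  assumes b_def: "b = (\<lambda>\<theta>. indicator T \<theta> * (alpha_lik \<alpha> lam f X n w \<theta> - q0))"
    and p_def: "p = (\<lambda>\<theta>. indicator T \<theta> * \<pi> \<theta>)"
    and int: "integrable lborel (\<lambda>\<theta>. exp (b \<theta>) * p \<theta>)"
      "integrable lborel (\<lambda>\<theta>. (exp (b \<theta>) * p \<theta>) *\<^sub>R (\<theta> - a))"
    and pos: "0 < (\<integral>\<theta>. exp (b \<theta>) * p \<theta> \<partial>lborel)"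
  shows "expected_R_posterior \<alpha> lam f X T \<pi> n w - a
    = (1 / (\<integral>\<theta>. exp (b \<theta>) * p \<theta> \<partial>lborel)) *\<^sub>R (\<integral>\<theta>. (exp (b \<theta>) * p \<theta>) *\<^sub>R (\<theta> - a) \<partial>lborel)"
proof -
  let ?Q = "alpha_lik \<alpha> lam f X n w"
  define D where "D = (\<integral>\<theta>. exp (b \<theta>) * p \<theta> \<partial>lborel)"
  have shift: "indicator T \<theta> *\<^sub>R (exp (?Q \<theta>) * \<pi> \<theta>) = exp q0 * (exp (b \<theta>) * p \<theta>)" for \<theta>
    by (simp add: b_def p_def indicator_def exp_diff)
  have Z: "(LINT \<theta>:T|lborel. exp (?Q \<theta>) * \<pi> \<theta>) = exp q0 * D"
    unfolding set_lebesgue_integral_def shift D_def by simp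
  have "indicator T \<theta> *\<^sub>R (R_posterior \<alpha> lam f X T \<pi> n w \<theta> *\<^sub>R \<theta>)
      = (1 / D) *\<^sub>R ((exp (b \<theta>) * p \<theta>) *\<^sub>R (\<theta> - a) + (exp (b \<theta>) * p \<theta>) *\<^sub>R a)" for \<theta>
  proof -
    have "indicator T \<theta> * R_posterior \<alpha> lam f X T \<pi> n w \<theta> = indicator T \<theta> *\<^sub>R (exp (?Q \<theta>) * \<pi> \<theta>) / (exp q0 * D)"
      unfolding R_posterior_def Z by simp
    also have "\<dots> = (1 / D) * (exp (b \<theta>) * p \<theta>)" unfolding shift by simp
    finally show ?thesis by (simp only: scaleR_scaleR scaleR_add_right[symmetric] diff_add_cancel)
  qed
  then have "expected_R_posterior \<alpha> lam f X T \<pi> n w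
    = (\<integral>\<theta>. (1 / D) *\<^sub>R ((exp (b \<theta>) * p \<theta>) *\<^sub>R (\<theta> - a) + (exp (b \<theta>) * p \<theta>) *\<^sub>R a) \<partial>lborel)"
    unfolding expected_R_posterior_def set_lebesgue_integral_def by (simp only:)
  also have "\<dots> = (1 / D) *\<^sub>R ((\<integral>\<theta>. (exp (b \<theta>) * p \<theta>) *\<^sub>R (\<theta> - a) \<partial>lborel) + D *\<^sub>R a)"
    using int by (simp add: D_def)
  finally show ?thesis using pos unfolding D_def[symmetric] by (simp add: scaleR_add_right)
qed

lemma posterior_mean_laplace_bound:
  fixes \<theta>hat :: "real ^ 'p" and A :: "real ^ 'p ^ 'p"
  assumes T: "T \<in> sets borel" and prior: "prior_density T \<pi>" "set_integrable lborel T (\<lambda>\<theta>. \<pi> \<theta> *\<^sub>R \<theta>)"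
    and Qm: "(\<lambda>\<theta>. indicator T \<theta> * alpha_lik \<alpha> lam f X n w \<theta>) \<in> borel_measurable borel"
    and max: "\<And>\<theta>. \<theta> \<in> T \<Longrightarrow> alpha_lik \<alpha> lam f X n w \<theta> \<le> alpha_lik \<alpha> lam f X n w \<theta>hat"
    and sub: "\<And>\<theta>. norm (\<theta> - \<theta>hat) \<le> \<delta> \<Longrightarrow> \<theta> \<in> T"
    and local: "\<And>\<theta>. norm (\<theta> - \<theta>hat) \<le> \<delta> \<Longrightarrow> \<bar>alpha_lik \<alpha> lam f X n w \<theta> - alpha_lik \<alpha> lam f X n w \<theta>hat
        + real n * ((\<theta> - \<theta>hat) \<bullet> (A *v (\<theta> - \<theta>hat)) / 2)\<bar> \<le> real n * (\<eta> * (norm (\<theta> - \<theta>hat))^2)"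
    and elliptic: "\<And>h. c * (norm h)^2 \<le> h \<bullet> (A *v h) / 2" "\<And>h. h \<bullet> (A *v h) / 2 \<le> K * (norm h)^2"
    and const: "0 < c" "0 \<le> \<eta>" "\<eta> \<le> c / 2" "c \<le> K" "1 \<le> n" "1 / (sqrt (real n) * sqrt (2 * K)) \<le> \<delta>"
    and near: "\<And>\<theta>. norm (\<theta> - \<theta>hat) \<le> \<delta> \<Longrightarrow> \<bar>\<pi> \<theta> - p0\<bar> \<le> \<eta>'" "\<eta>' \<le> p0 / 2" "0 < p0"
    and far: "\<And>\<theta>. \<theta> \<in> T \<Longrightarrow> \<delta> < norm (\<theta> - \<theta>hat) \<Longrightarrow>
        alpha_lik \<alpha> lam f X n w \<theta> - alpha_lik \<alpha> lam f X n w \<theta>hat \<le> - (real n * e)"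
  shows "sqrt (real n) * norm (expected_R_posterior \<alpha> lam f X T \<pi> n w - \<theta>hat)
    \<le> ((2 * p0 * \<eta> + \<eta>') * integral\<^sup>L lborel (gauss_weight (c / 2) :: real ^ 'p \<Rightarrow> real)
        + sqrt (real n) ^ Suc DIM(real ^ 'p) * exp (- (real n * e))
            * ((\<integral>\<theta>. indicator T \<theta> * \<pi> \<theta> * norm \<theta> \<partial>lborel) + norm \<theta>hat))
       / (exp (- 1) * (p0 / 2) * (unit_ball_vol DIM(real ^ 'p) / sqrt (2 * K) ^ DIM(real ^ 'p)))"
proof -
  let ?Q = "alpha_lik \<alpha> lam f X n w" and ?d = "DIM(real ^ 'p)"
  define b where "b = (\<lambda>\<theta>. indicator T \<theta> * (?Q \<theta> - ?Q \<theta>hat))"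
  define p where "p = (\<lambda>\<theta>. indicator T \<theta> * \<pi> \<theta>)"
  define q where "q h = h \<bullet> (A *v h) / 2" for h
  define s where "s = sqrt (real n)"
  have s: "0 < s" "s^2 = real n" using const by (simp_all add: s_def)
  have [measurable]: "T \<in> sets borel" by (rule T)
  have "b = (\<lambda>\<theta>. indicator T \<theta> * ?Q \<theta> - indicator T \<theta> * ?Q \<theta>hat)"
    by (simp add: b_def fun_eq_iff right_diff_distrib)
  then have bm: "b \<in> borel_measurable borel" using Qm by simp
  have "continuous_on UNIV q" unfolding q_def[abs_def] by (intro continuous_intros) simp
  then have qm: "q \<in> borel_measurable borel" by (rule borel_measurable_continuous_onI)
  have pint: "integrable lborel (\<lambda>\<theta>. p \<theta> *\<^sub>R \<theta>)"
    using prior(2) unfolding set_integrable_def p_def by simp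
  have b0: "b \<theta> \<le> 0" for \<theta> using max by (simp add: b_def indicator_def)
  have loc: "\<bar>b \<theta> + s^2 * q (\<theta> - \<theta>hat)\<bar> \<le> s^2 * (\<eta> * (norm (\<theta> - \<theta>hat))^2)" if "norm (\<theta> - \<theta>hat) \<le> \<delta>" for \<theta>
    using local[OF that] sub[OF that] by (simp add: b_def q_def s(2))
  have neg: "A *v (- h) = - (A *v h)" for h by (metis matrix_vector_mult_scaleR scaleR_minus1_left)
  have qeven: "q (- h) = q h" for h unfolding q_def neg by simp
  have ql: "c * (norm h)^2 \<le> q h" and qu: "q h \<le> K * (norm h)^2" for h using elliptic by (simp_all add: q_def)
  have near': "\<bar>p \<theta> - p0\<bar> \<le> \<eta>'" if "norm (\<theta> - \<theta>hat) \<le> \<delta>" for \<theta>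
    using near(1)[OF that] sub[OF that] by (simp add: p_def)
  have far': "p \<theta> = 0 \<or> b \<theta> \<le> - (real n * e)" if "\<delta> < norm (\<theta> - \<theta>hat)" for \<theta>
    using far[OF _ that] by (cases "\<theta> \<in> T") (simp_all add: p_def b_def)
  have p_int: "integrable lborel p" and p_nn: "\<And>\<theta>. 0 \<le> p \<theta>" and p_1: "(\<integral>\<theta>. p \<theta> \<partial>lborel) \<le> 1"
    using prior_densityD[OF prior(1)] by (simp_all add: p_def)
  have sK: "1 / (s * sqrt (2 * K)) \<le> \<delta>" using const(6) by (simp add: s_def)
  note L = laplace_first_moment_bound[of b q p \<theta>hat \<delta> s \<eta> c K p0 \<eta>' "real n * e",
      OF bm qm p_int pint p_nn p_1 b0 loc qeven ql qu const(1-4) s(1) sK near' near(2,3) far']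
  define D where "D = (\<integral>\<theta>. exp (b \<theta>) * p \<theta> \<partial>lborel)"
  define N where "N = (\<integral>\<theta>. (exp (b \<theta>) * p \<theta>) *\<^sub>R (\<theta> - \<theta>hat) \<partial>lborel)"
  define d0 where "d0 = exp (- 1) * (p0 / 2) * (unit_ball_vol ?d / sqrt (2 * K) ^ ?d)"
  define J where "J = integral\<^sup>L lborel (gauss_weight (c / 2) :: real ^ 'p \<Rightarrow> real)"
  define R where "R = (\<integral>\<theta>. p \<theta> * norm \<theta> \<partial>lborel) + norm \<theta>hat"
  have K: "0 < K" using const by simp
  have d0: "0 < d0" using near(3) K unit_ball_vol_pos[of "?d"] by (simp add: d0_def)
  have D: "d0 / s ^ ?d \<le> D" using L(3) unfolding d0_def D_def .
  then have Dpos: "0 < D" using d0 s(1) by (smt (verit) divide_pos_pos zero_less_power)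
  have N: "norm N \<le> (2 * p0 * \<eta> + \<eta>') * J / s ^ Suc ?d + exp (- (real n * e)) * R"
    using L(4) unfolding N_def J_def R_def .
  have "expected_R_posterior \<alpha> lam f X T \<pi> n w - \<theta>hat = (1 / D) *\<^sub>R N"
    unfolding D_def N_def by (rule expected_R_posterior_minus[OF b_def p_def L(1,2) Dpos[unfolded D_def]])
  then have "s * norm (expected_R_posterior \<alpha> lam f X T \<pi> n w - \<theta>hat) = s * norm N / D"
    using Dpos by simp
  also have "\<dots> \<le> s * norm N / (d0 / s ^ ?d)"
    using D d0 s(1) by (intro divide_left_mono mult_nonneg_nonneg mult_pos_pos Dpos) auto
  also have "\<dots> = s ^ Suc ?d * norm N / d0" using s(1) by simp
  also have "\<dots> \<le> s ^ Suc ?d * ((2 * p0 * \<eta> + \<eta>') * J / s ^ Suc ?d + exp (- (real n * e)) * R) / d0"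
    using N d0 s(1) by (intro divide_right_mono mult_left_mono) auto
  also have "\<dots> = ((2 * p0 * \<eta> + \<eta>') * J + s ^ Suc ?d * exp (- (real n * e)) * R) / d0"
    using s(1) by (simp add: distrib_left)
  finally show ?thesis unfolding s_def J_def R_def d0_def p_def .
qed

section \<open>Measurability of the posterior mean\<close>

text \<open>
  The densities are jointly measurable on the parameter set only, so parameters outside it are first
  sent to \<open>\<theta>g\<close>. Any integrand over \<open>T\<close> is unaffected by this.
\<close>

lemma alpha_lik_measurable:
  fixes f :: "nat \<Rightarrow> real ^ 'p \<Rightarrow> 'a \<Rightarrow> real"
  assumes tm: "true_model M lam X g" and pf: "parametric_family lam T f" and T: "\<theta>g \<in> T"
  shows "(\<lambda>(w, \<theta>). alpha_lik \<alpha> lam f X n w (if \<theta> \<in> T then \<theta> else \<theta>g)) \<in> borel_measurable (M \<Otimes>\<^sub>M lborel)"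
proof -
  interpret lam: sigma_finite_measure lam by (rule true_modelD(2)[OF tm])
  have [measurable]: "T \<in> sets borel" using pf by (simp add: parametric_family_def)
  define \<tau> where "\<tau> \<theta> = (if \<theta> \<in> T then \<theta> else \<theta>g)" for \<theta>
  have "\<tau> \<in> borel_measurable borel" unfolding \<tau>_def[abs_def] by measurable
  then have \<tau> [measurable]: "\<tau> \<in> measurable borel (restrict_space borel T)"
    using T by (intro measurable_restrict_space2) (auto simp: \<tau>_def)
  have summand: "(\<lambda>x. 1 / \<alpha> * f i (\<tau> (snd x)) (X i (fst x)) powr \<alpha>
       - 1 / (1 + \<alpha>) * (\<integral>y. f i (\<tau> (snd x)) y powr (1 + \<alpha>) \<partial>lam) - 1 / \<alpha>) \<in> borel_measurable (M \<Otimes>\<^sub>M lborel)"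
    if i: "1 \<le> i" for i
  proof -
    have F [measurable]: "(\<lambda>(\<theta>, x). f i \<theta> x) \<in> borel_measurable (restrict_space borel T \<Otimes>\<^sub>M lam)"
      using pf i by (simp add: parametric_family_def)
    have [measurable]: "X i \<in> measurable M lam" by (rule true_modelD(5)[OF tm i])
    have s: "(\<lambda>x. \<tau> (snd x)) \<in> measurable (M \<Otimes>\<^sub>M lborel) (restrict_space borel T)"
      by (rule measurable_compose[OF measurable_snd]) (use \<tau> in simp)
    have "(\<lambda>x. (\<tau> (snd x), X i (fst x))) \<in> measurable (M \<Otimes>\<^sub>M lborel) (restrict_space borel T \<Otimes>\<^sub>M lam)"
      using s by measurable
    from measurable_compose[OF this F]
    have [measurable]: "(\<lambda>x. f i (\<tau> (snd x)) (X i (fst x))) \<in> borel_measurable (M \<Otimes>\<^sub>M lborel)" by simp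
    have "(\<lambda>z. (case z of (\<theta>, x) \<Rightarrow> f i \<theta> x) powr (1 + \<alpha>)) \<in> borel_measurable (restrict_space borel T \<Otimes>\<^sub>M lam)"
      by measurable
    then have "(\<lambda>\<theta>. \<integral>y. f i \<theta> y powr (1 + \<alpha>) \<partial>lam) \<in> borel_measurable (restrict_space borel T)"
      by (intro lam.borel_measurable_lebesgue_integral) (simp add: case_prod_beta')
    from measurable_compose[OF s this]
    have [measurable]: "(\<lambda>x. \<integral>y. f i (\<tau> (snd x)) y powr (1 + \<alpha>) \<partial>lam) \<in> borel_measurable (M \<Otimes>\<^sub>M lborel)" .
    show ?thesis by measurable
  qed
  then show ?thesis
    unfolding alpha_lik_def case_prod_beta \<tau>_def[symmetric] by (intro borel_measurable_sum) simp
qed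

lemma expected_R_posterior_measurable:
  fixes f :: "nat \<Rightarrow> real ^ 'p \<Rightarrow> 'a \<Rightarrow> real"
  assumes tm: "true_model M lam X g" and pf: "parametric_family lam T f" and T: "\<theta>g \<in> T"
    and prior: "prior_density T \<pi>"
  shows "expected_R_posterior \<alpha> lam f X T \<pi> n \<in> borel_measurable M"
proof -
  define \<tau> where "\<tau> \<theta> = (if \<theta> \<in> T then \<theta> else \<theta>g)" for \<theta>
  define p where "p \<theta> = indicator T \<theta> * \<pi> \<theta>" for \<theta>
  have A: "(\<lambda>x. alpha_lik \<alpha> lam f X n (fst x) (\<tau> (snd x))) \<in> borel_measurable (M \<Otimes>\<^sub>M lborel)"
    using alpha_lik_measurable[OF tm pf T] by (simp add: case_prod_beta' \<tau>_def)
  have "p \<in> borel_measurable lborel"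
    using borel_measurable_integrable[OF prior_densityD(2)[OF prior]] by (simp add: p_def[abs_def])
  from measurable_compose[OF measurable_snd this]
  have P: "(\<lambda>x. p (snd x)) \<in> borel_measurable (M \<Otimes>\<^sub>M lborel)" .
  define Z where "Z w = (\<integral>\<theta>. exp (alpha_lik \<alpha> lam f X n w (\<tau> \<theta>)) * p \<theta> \<partial>lborel)" for w
  have W: "(\<lambda>x. exp (alpha_lik \<alpha> lam f X n (fst x) (\<tau> (snd x))) * p (snd x)) \<in> borel_measurable (M \<Otimes>\<^sub>M lborel)"
    using A P by measurable
  have Z: "Z \<in> borel_measurable M"
    unfolding Z_def[abs_def] using W by (intro lborel.borel_measurable_lebesgue_integral) (simp add: case_prod_beta')
  from measurable_compose[OF measurable_fst this]
  have Z': "(\<lambda>x. Z (fst x)) \<in> borel_measurable (M \<Otimes>\<^sub>M lborel)" .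
  have I: "indicator T \<theta> *\<^sub>R (exp (alpha_lik \<alpha> lam f X n w \<theta>) * \<pi> \<theta>) = exp (alpha_lik \<alpha> lam f X n w (\<tau> \<theta>)) * p \<theta>" for w \<theta>
    by (simp add: p_def \<tau>_def indicator_def)
  have Zeq: "(LINT \<theta>:T|lborel. exp (alpha_lik \<alpha> lam f X n w \<theta>) * \<pi> \<theta>) = Z w" for w
    unfolding set_lebesgue_integral_def I Z_def ..
  have "indicator T \<theta> *\<^sub>R (R_posterior \<alpha> lam f X T \<pi> n w \<theta> *\<^sub>R \<theta>)
      = (exp (alpha_lik \<alpha> lam f X n w (\<tau> \<theta>)) * p \<theta> / Z w) *\<^sub>R \<theta>" for w \<theta>
    unfolding R_posterior_def Zeq I[symmetric] by simp
  then have E: "expected_R_posterior \<alpha> lam f X T \<pi> n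
      = (\<lambda>w. \<integral>\<theta>. (exp (alpha_lik \<alpha> lam f X n w (\<tau> \<theta>)) * p \<theta> / Z w) *\<^sub>R \<theta> \<partial>lborel)"
    unfolding expected_R_posterior_def[abs_def] set_lebesgue_integral_def by (simp only:)
  have "(\<lambda>x. (exp (alpha_lik \<alpha> lam f X n (fst x) (\<tau> (snd x))) * p (snd x) / Z (fst x)) *\<^sub>R snd x)
      \<in> borel_measurable (M \<Otimes>\<^sub>M lborel)"
    using W Z' by measurable
  then show ?thesis
    unfolding E by (intro lborel.borel_measurable_lebesgue_integral) (simp add: case_prod_beta')
qed

lemma alpha_lik_section_measurable:
  fixes f :: "nat \<Rightarrow> real ^ 'p \<Rightarrow> 'a \<Rightarrow> real"
  assumes tm: "true_model M lam X g" and pf: "parametric_family lam T f" and T: "\<theta>g \<in> T" and w: "w \<in> space M"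
  shows "(\<lambda>\<theta>. indicator T \<theta> * alpha_lik \<alpha> lam f X n w \<theta>) \<in> borel_measurable borel"
proof -
  have [measurable]: "T \<in> sets borel" using pf by (simp add: parametric_family_def)
  have "(\<lambda>\<theta>. (w, \<theta>)) \<in> measurable lborel (M \<Otimes>\<^sub>M lborel)" using w by (rule measurable_Pair1')
  from measurable_compose[OF this alpha_lik_measurable[OF tm pf T]]
  have "(\<lambda>\<theta>. alpha_lik \<alpha> lam f X n w (if \<theta> \<in> T then \<theta> else \<theta>g)) \<in> borel_measurable borel" by simp
  then have "(\<lambda>\<theta>. indicator T \<theta> * alpha_lik \<alpha> lam f X n w (if \<theta> \<in> T then \<theta> else \<theta>g)) \<in> borel_measurable borel"
    by (intro borel_measurable_times) auto
  moreover have "(\<lambda>\<theta>. indicator T \<theta> * alpha_lik \<alpha> lam f X n w (if \<theta> \<in> T then \<theta> else \<theta>g))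
      = (\<lambda>\<theta>. indicator T \<theta> * alpha_lik \<alpha> lam f X n w \<theta>)"
    by (simp add: fun_eq_iff indicator_def)
  ultimately show ?thesis by simp
qed

lemma alpha_lik_eq_sum_V:
  assumes "0 < \<alpha>"
  shows "alpha_lik \<alpha> lam f X n w \<theta> = - (real n / \<alpha>) - 1 / (1 + \<alpha>) * (\<Sum>i=1..n. V \<alpha> lam f i (X i w) \<theta>)"
proof -
  have eq: "1 / \<alpha> * y - 1 / (1 + \<alpha>) * z - 1 / \<alpha> = - (1 / \<alpha>) - 1 / (1 + \<alpha>) * (z - (1 + 1 / \<alpha>) * y)" for y z :: real
  proof -
    have "1 + \<alpha> \<noteq> 0" using assms by simp
    then have k: "1 / (1 + \<alpha>) * (1 + 1 / \<alpha>) = 1 / \<alpha>" using assms by (simp add: divide_simps)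
    show ?thesis by (simp only: right_diff_distrib mult.assoc[symmetric] k)
  qed
  have "alpha_lik \<alpha> lam f X n w \<theta> = (\<Sum>i=1..n. - (1 / \<alpha>) - 1 / (1 + \<alpha>) * V \<alpha> lam f i (X i w) \<theta>)"
    unfolding alpha_lik_def V_def by (rule sum.cong[OF refl eq])
  also have "\<dots> = - (real n / \<alpha>) - 1 / (1 + \<alpha>) * (\<Sum>i=1..n. V \<alpha> lam f i (X i w) \<theta>)"
    unfolding sum_subtractf sum_distrib_left by simp
  finally show ?thesis .
qed

section \<open>Asymptotic equivalence of the two estimators\<close>

text \<open>
  At a fixed sample point. By \<open>sep\<close> the maximizer lies within \<open>\<delta> / 2\<close> of \<open>\<theta>g\<close>, as no parameter
  farther away can do as well as \<open>\<theta>g\<close>. Therefore the ball of radius \<open>\<delta>\<close> about it stays inside the ball of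
  radius \<open>2 * \<delta>\<close> about \<open>\<theta>g\<close>, where the expansion is valid, while its exterior is at distance more than \<open>\<delta> / 2\<close>
  from \<open>\<theta>g\<close>, where the separation applies.
\<close>

lemma posterior_mean_close_on_good_event:
  fixes f :: "nat \<Rightarrow> real ^ 'p \<Rightarrow> 'a \<Rightarrow> real" and \<theta>h :: "real ^ 'p"
  defines "P \<equiv> real CARD('p)"
  assumes \<alpha>: "0 < \<alpha>" and tm: "true_model M lam X g" and pf: "parametric_family lam T f"
    and A3: "cond_A3 \<alpha> lam g f T" and w: "w \<in> space M" and n: "1 \<le> n"
    and U: "ball \<theta>g (2 * \<delta>) \<subseteq> T" "0 < \<delta>" "\<delta> \<le> 1"
    and prior: "prior_density T \<pi>" "set_integrable lborel T (\<lambda>\<theta>. \<pi> \<theta> *\<^sub>R \<theta>)" "0 < \<pi> \<theta>g"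
    and mx: "\<theta>h \<in> T" "\<And>\<theta>. \<theta> \<in> T \<Longrightarrow> alpha_lik \<alpha> lam f X n w \<theta> \<le> alpha_lik \<alpha> lam f X n w \<theta>h"
    and pos: "\<And>i \<theta>. 1 \<le> i \<Longrightarrow> \<theta> \<in> T \<Longrightarrow> 0 < f i \<theta> (X i w)"
    and diff: "\<And>i. 1 \<le> i \<Longrightarrow> thrice_differentiable_on (\<lambda>\<theta>. f i \<theta> (X i w)) T"
    and third: "\<And>i l j k \<theta>. 1 \<le> i \<Longrightarrow> \<theta> \<in> T \<Longrightarrow> \<bar>partial3 T l j k (V \<alpha> lam f i (X i w)) \<theta>\<bar> \<le> B i"
      "(\<Sum>i=1..n. B i) \<le> C * real n" "0 \<le> C"
    and second: "\<And>j k. \<bar>(\<Sum>i=1..n. partial2 T j k (V \<alpha> lam f i (X i w)) \<theta>g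
        - (\<integral>x. partial2 T j k (V \<alpha> lam f i x) \<theta>g \<partial>law lam (g i))) / real n\<bar> \<le> \<kappa>"
    and sep: "\<And>\<theta>. \<theta> \<in> T \<Longrightarrow> \<delta> / 2 < norm (\<theta> - \<theta>g) \<Longrightarrow>
        1 / real n * (alpha_lik \<alpha> lam f X n w \<theta> - alpha_lik \<alpha> lam f X n w \<theta>g) < - e" and e: "0 < e"
    and elliptic: "\<And>h. c * (norm h)^2 \<le> h \<bullet> (Psi \<alpha> lam g f T n \<theta>g *v h) / 2"
      "\<And>h. h \<bullet> (Psi \<alpha> lam g f T n \<theta>g *v h) / 2 \<le> K * (norm h)^2" "0 < c" "c \<le> K"
    and \<eta>: "0 \<le> \<eta>" "\<eta> \<le> c / 2" "P^2 * (2 * P * C * \<delta> + \<kappa>) / 2 \<le> \<eta>"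
    and nb: "\<And>\<theta>. norm (\<theta> - \<theta>g) < 2 * \<delta> \<Longrightarrow> \<bar>\<pi> \<theta> - \<pi> \<theta>g\<bar> \<le> \<eta>'" "\<eta>' \<le> \<pi> \<theta>g / 2"
    and large: "1 / (sqrt (real n) * sqrt (2 * K)) \<le> \<delta>"
  shows "sqrt (real n) * norm (expected_R_posterior \<alpha> lam f X T \<pi> n w - \<theta>h)
    \<le> ((2 * \<pi> \<theta>g * \<eta> + \<eta>') * integral\<^sup>L lborel (gauss_weight (c / 2) :: real ^ 'p \<Rightarrow> real)
        + sqrt (real n) ^ Suc DIM(real ^ 'p) * exp (- (real n * e))
            * ((\<integral>\<theta>. indicator T \<theta> * \<pi> \<theta> * norm \<theta> \<partial>lborel) + (norm \<theta>g + 1)))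
       / (exp (- 1) * (\<pi> \<theta>g / 2) * (unit_ball_vol DIM(real ^ 'p) / sqrt (2 * K) ^ DIM(real ^ 'p)))"
proof -
  let ?Q = "alpha_lik \<alpha> lam f X n w" and ?A = "Psi \<alpha> lam g f T n \<theta>g"
  define V' where "V' = ball \<theta>g (2 * \<delta>)"
  have V': "open V'" "V' \<subseteq> T" "\<theta>g \<in> V'" using U by (auto simp: V'_def)
  have Tm: "T \<in> sets borel" using pf by (simp add: parametric_family_def)
  have gT: "\<theta>g \<in> T" using V' by blast
  have close: "norm (\<theta>h - \<theta>g) \<le> \<delta> / 2"
  proof (rule ccontr)
    assume "\<not> ?thesis"
    then have "1 / real n * (?Q \<theta>h - ?Q \<theta>g) < - e" using mx(1) by (intro sep) auto
    moreover have "0 \<le> 1 / real n * (?Q \<theta>h - ?Q \<theta>g)" using mx(2)[OF gT] by simp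
    ultimately show False using e by linarith
  qed
  have ball: "norm (\<theta> - \<theta>g) < 2 * \<delta>" if "norm (\<theta> - \<theta>h) \<le> \<delta>" for \<theta>
    using norm_triangle_ineq[of "\<theta> - \<theta>h" "\<theta>h - \<theta>g"] that close U by simp
  have ballT: "\<theta> \<in> T" if "norm (\<theta> - \<theta>h) \<le> \<delta>" for \<theta>
    using ball[OF that] V'(2) by (auto simp: V'_def dist_norm norm_minus_commute)
  have local: "\<bar>?Q \<theta> - ?Q \<theta>h + real n * ((\<theta> - \<theta>h) \<bullet> (?A *v (\<theta> - \<theta>h)) / 2)\<bar> \<le> real n * (\<eta> * (norm (\<theta> - \<theta>h))^2)"
    if near: "norm (\<theta> - \<theta>h) \<le> \<delta>" for \<theta>
  proof -
    have "\<bar>?Q \<theta> - ?Q \<theta>h + real n * ((\<theta> - \<theta>h) \<bullet> (?A *v (\<theta> - \<theta>h)) / 2)\<bar>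
        \<le> real n * ((real CARD('p))^2 * (2 * real CARD('p) * C * \<delta> + \<kappa>) / 2 * (norm (\<theta> - \<theta>h))^2)"
    proof (rule quadratic_expansion_at_maximizer[where v="\<lambda>i. V \<alpha> lam f i (X i w)" and a="1 / (1 + \<alpha>)"
          and ?c0.0="- (real n / \<alpha>)", OF V'_def])
      show "thrice_differentiable_on (V \<alpha> lam f i (X i w)) V'" if "i \<in> {1..n}" for i
        by (rule V_regular(1)[OF pf A3 _ V'(1,2) pos diff]) (use that in auto)
      show "?Q \<theta> = - (real n / \<alpha>) - 1 / (1 + \<alpha>) * (\<Sum>i=1..n. V \<alpha> lam f i (X i w) \<theta>)" for \<theta>
        by (rule alpha_lik_eq_sum_V[OF \<alpha>])
      show "(\<Sum>i=1..n. \<bar>partial3 V' l j k (V \<alpha> lam f i (X i w)) \<theta>\<bar>) \<le> C * real n" if "\<theta> \<in> V'" for l j k \<theta>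
      proof -
        have "(\<Sum>i=1..n. \<bar>partial3 V' l j k (V \<alpha> lam f i (X i w)) \<theta>\<bar>) \<le> (\<Sum>i=1..n. B i)"
          unfolding partial3_open_subset[OF V'(1,2) that, symmetric]
          using that V'(2) by (intro sum_mono third(1)) auto
        then show ?thesis using third(2) by linarith
      qed
      show "\<bar>1 / (1 + \<alpha>) * (\<Sum>i=1..n. partial2 V' j k (V \<alpha> lam f i (X i w)) \<theta>g) - real n * ?A $ j $ k\<bar> \<le> \<kappa> * real n" for j k
      proof -
        let ?D = "\<lambda>i. partial2 T j k (V \<alpha> lam f i (X i w)) \<theta>g"
        let ?m = "\<lambda>i. \<integral>x. partial2 T j k (V \<alpha> lam f i x) \<theta>g \<partial>law lam (g i)"
        have "real n * ?A $ j $ k = 1 / (1 + \<alpha>) * (\<Sum>i=1..n. ?m i)"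
          unfolding Psi_def vec_lambda_beta using n by simp
        then have "1 / (1 + \<alpha>) * (\<Sum>i=1..n. ?D i) - real n * ?A $ j $ k = 1 / (1 + \<alpha>) * (\<Sum>i=1..n. ?D i - ?m i)"
          by (simp only: sum_subtractf right_diff_distrib)
        moreover have "\<bar>1 / (1 + \<alpha>) * (\<Sum>i=1..n. ?D i - ?m i)\<bar> \<le> 1 * \<bar>\<Sum>i=1..n. ?D i - ?m i\<bar>"
          using \<alpha> unfolding abs_mult by (intro mult_right_mono) auto
        moreover have "\<bar>\<Sum>i=1..n. ?D i - ?m i\<bar> \<le> \<kappa> * real n"
          using second[of j k] n unfolding abs_divide by (simp add: pos_divide_le_eq)
        ultimately show ?thesis unfolding partial2_open_subset[OF V', symmetric] by linarith
      qed
      show "?Q \<theta> \<le> ?Q \<theta>h" if "\<theta> \<in> V'" for \<theta> using mx(2) that V'(2) by blast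
    qed (use \<alpha> close near U third(3) in auto)
    also have "\<dots> \<le> real n * (\<eta> * (norm (\<theta> - \<theta>h))^2)"
      using \<eta>(3) unfolding P_def by (intro mult_left_mono mult_right_mono) auto
    finally show ?thesis .
  qed
  have far: "?Q \<theta> - ?Q \<theta>h \<le> - (real n * e)" if "\<theta> \<in> T" "\<delta> < norm (\<theta> - \<theta>h)" for \<theta>
  proof -
    have "norm (\<theta> - \<theta>h) \<le> norm (\<theta> - \<theta>g) + norm (\<theta>h - \<theta>g)"
      using norm_triangle_ineq4[of "\<theta> - \<theta>g" "\<theta>h - \<theta>g"] by simp
    then have "\<delta> / 2 < norm (\<theta> - \<theta>g)" using that(2) close by linarith
    from sep[OF that(1) this] have "?Q \<theta> - ?Q \<theta>g < - e * real n" using n by (simp add: pos_divide_less_eq)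
    then show ?thesis using mx(2)[OF gT] by (simp add: mult.commute)
  qed
  define d0 where "d0 = exp (- 1) * (\<pi> \<theta>g / 2) * (unit_ball_vol DIM(real ^ 'p) / sqrt (2 * K) ^ DIM(real ^ 'p))"
  have d0: "0 < d0" using prior(3) elliptic(3,4) unit_ball_vol_pos[of "DIM(real ^ 'p)"] by (simp add: d0_def)
  have "norm \<theta>h \<le> norm \<theta>g + norm (\<theta>h - \<theta>g)" by (rule norm_triangle_sub)
  then have hat: "norm \<theta>h \<le> norm \<theta>g + 1" using close U by linarith
  have "sqrt (real n) * norm (expected_R_posterior \<alpha> lam f X T \<pi> n w - \<theta>h)
    \<le> ((2 * \<pi> \<theta>g * \<eta> + \<eta>') * integral\<^sup>L lborel (gauss_weight (c / 2) :: real ^ 'p \<Rightarrow> real)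
        + sqrt (real n) ^ Suc DIM(real ^ 'p) * exp (- (real n * e))
            * ((\<integral>\<theta>. indicator T \<theta> * \<pi> \<theta> * norm \<theta> \<partial>lborel) + norm \<theta>h)) / d0"
    unfolding d0_def
    by (rule posterior_mean_laplace_bound[OF Tm prior(1,2) alpha_lik_section_measurable[OF tm pf gT w] mx(2) ballT
        local elliptic(1,2,3) \<eta>(1,2) elliptic(4) n large nb(1)[OF ball] nb(2) prior(3) far])
  also have "\<dots> \<le> ((2 * \<pi> \<theta>g * \<eta> + \<eta>') * integral\<^sup>L lborel (gauss_weight (c / 2) :: real ^ 'p \<Rightarrow> real)
        + sqrt (real n) ^ Suc DIM(real ^ 'p) * exp (- (real n * e))
            * ((\<integral>\<theta>. indicator T \<theta> * \<pi> \<theta> * norm \<theta> \<partial>lborel) + (norm \<theta>g + 1))) / d0"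
    using hat d0 by (intro divide_right_mono add_left_mono mult_left_mono) auto
  finally show ?thesis unfolding d0_def .
qed

text \<open>
  For a target accuracy \<open>\<epsilon>\<close> and probability \<open>\<rho>\<close>, the constants are chosen in the order \<open>\<eta>\<close>, \<open>\<eta>'\<close> (from
  \<open>\<epsilon>\<close>), \<open>C1\<close> (from \<open>\<rho>\<close>), \<open>\<delta>\<close>, and only then the separation constant \<open>e\<close> of (E2). The third-derivative event may
  fail with probability \<open>\<rho> / 2\<close> for every \<open>n\<close>; the other exceptional events have vanishing probability.
\<close>

lemma posterior_mean_minus_mdpde_vanishes:
  fixes f :: "nat \<Rightarrow> real ^ 'p \<Rightarrow> 'a \<Rightarrow> real" and \<theta>hat :: "nat \<Rightarrow> 'w \<Rightarrow> real ^ 'p"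
  assumes \<alpha>: "0 < \<alpha>" and tm: "true_model M lam X g" and pf: "parametric_family lam T f"
    and mdpde: "is_mdpde \<alpha> M lam f X T \<theta>hat"
    and E1: "cond_E1 \<alpha> lam g f T \<theta>g" and E2: "cond_E2 \<alpha> M lam f X T \<theta>g" and E3: "cond_E3 \<alpha> lam g f T"
    and prior: "prior_density T \<pi>" "set_integrable lborel T (\<lambda>\<theta>. \<pi> \<theta> *\<^sub>R \<theta>)" "0 < \<pi> \<theta>g" "isCont \<pi> \<theta>g"
    and \<epsilon>: "0 < \<epsilon>"
  shows "(\<lambda>n. measure M {w \<in> space M.
     \<epsilon> < norm (sqrt (real n) *\<^sub>R (expected_R_posterior \<alpha> lam f X T \<pi> n w - \<theta>hat n w))}) \<longlonglongrightarrow> 0"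
proof (rule LIMSEQ_I)
  fix \<rho> :: real assume \<rho>: "0 < \<rho>"
  interpret prob_space M by (rule true_modelD(1)[OF tm])
  obtain S where A1: "cond_A1 lam g f T S" and A2: "cond_A2 lam f T S \<theta>g" and A3: "cond_A3 \<alpha> lam g f T"
    and A4: "cond_A4 \<alpha> lam g f T \<theta>g" and A5: "cond_A5 \<alpha> lam g f T S" and A6: "cond_A6 \<alpha> lam g f T \<theta>g"
    using E1 unfolding cond_E1_def by (elim exE conjE)
  obtain \<omega> where \<omega>: "open \<omega>" "\<omega> \<subseteq> T" "\<theta>g \<in> \<omega>" using A2 unfolding cond_A2_def by (elim exE conjE)
  have gT: "\<theta>g \<in> T" using \<omega> by blast
  then have Tne: "T \<noteq> {}" by blast
  have sym: "transpose (Psi \<alpha> lam g f T n \<theta>g) = Psi \<alpha> lam g f T n \<theta>g" for n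
    by (rule Psi_symmetric[OF tm pf A1 A2 A3 \<omega>])
  obtain c K N0 where cK: "0 < c" "c \<le> K"
    and ell_lower: "\<And>n h. 1 \<le> n \<Longrightarrow> c * (norm h)^2 \<le> h \<bullet> (Psi \<alpha> lam g f T n \<theta>g *v h) / 2"
    and ell_upper: "\<And>n h. N0 \<le> n \<Longrightarrow> h \<bullet> (Psi \<alpha> lam g f T n \<theta>g *v h) / 2 \<le> K * (norm h)^2"
    by (rule Psi_uniformly_elliptic[OF sym A4 E3 gT]) (rule that)
  obtain B C and N1 :: nat where B: "\<And>i. 1 \<le> i \<Longrightarrow> B i \<in> borel_measurable lam"
    "\<And>i. 1 \<le> i \<Longrightarrow> integrable (density lam (\<lambda>x. ennreal (g i x))) (B i)"
    and Bae: "\<And>i. 1 \<le> i \<Longrightarrow> AE x in density lam (\<lambda>x. ennreal (g i x)).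
        0 \<le> B i x \<and> (\<forall>j k l. \<forall>\<theta>\<in>T. \<bar>partial3 T j k l (V \<alpha> lam f i x) \<theta>\<bar> \<le> B i x)"
    and BC: "\<And>n. N1 \<le> n \<Longrightarrow> (\<Sum>i=1..n. \<integral>x. B i x \<partial>density lam (\<lambda>x. ennreal (g i x))) \<le> C * real n" "0 \<le> C"
    by (rule third_derivative_envelope[OF tm A1 A5 Tne]) (rule that)
  have "\<exists>D'. 1 \<le> i \<longrightarrow> D' \<in> borel_measurable lam \<and>
      (AE x in density lam (\<lambda>x. ennreal (g i x)). partial2 T j k (V \<alpha> lam f i x) \<theta>g = D' x) \<and>
      integrable (density lam (\<lambda>x. ennreal (g i x))) D'" for j k i
  proof (cases "1 \<le> i")
    case True
    show ?thesis by (rule hessian_measurable_version[OF tm pf A1 A2 A3 \<omega> True, of j k]) (intro exI impI conjI)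
  qed simp
  then have "\<exists>D'. \<forall>j k i. 1 \<le> i \<longrightarrow> D' j k i \<in> borel_measurable lam \<and>
      (AE x in density lam (\<lambda>x. ennreal (g i x)). partial2 T j k (V \<alpha> lam f i x) \<theta>g = D' j k i x) \<and>
      integrable (density lam (\<lambda>x. ennreal (g i x))) (D' j k i)"
    by (intro choice allI)
  then obtain D' where D'all: "\<forall>j k i. 1 \<le> i \<longrightarrow> D' j k i \<in> borel_measurable lam \<and>
      (AE x in density lam (\<lambda>x. ennreal (g i x)). partial2 T j k (V \<alpha> lam f i x) \<theta>g = D' j k i x) \<and>
      integrable (density lam (\<lambda>x. ennreal (g i x))) (D' j k i)" by (elim exE)
  have D': "\<And>j k i. 1 \<le> i \<Longrightarrow> D' j k i \<in> borel_measurable lam"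
    "\<And>j k i. 1 \<le> i \<Longrightarrow> AE x in density lam (\<lambda>x. ennreal (g i x)). partial2 T j k (V \<alpha> lam f i x) \<theta>g = D' j k i x"
    "\<And>j k i. 1 \<le> i \<Longrightarrow> integrable (density lam (\<lambda>x. ennreal (g i x))) (D' j k i)"
    using D'all by simp_all

  \<comment> \<open>\<open>\<eta>\<close> and \<open>\<eta>'\<close> make the local error at most \<open>\<epsilon> / 4\<close> after division by the lower bound \<open>d0\<close>.\<close>
  define d0 where "d0 = exp (- 1) * (\<pi> \<theta>g / 2) * (unit_ball_vol DIM(real ^ 'p) / sqrt (2 * K) ^ DIM(real ^ 'p))"
  define J where "J = integral\<^sup>L lborel (gauss_weight (c / 2) :: real ^ 'p \<Rightarrow> real)"
  define R where "R = (\<integral>\<theta>. indicator T \<theta> * \<pi> \<theta> * norm \<theta> \<partial>lborel) + (norm \<theta>g + 1)"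
  define P where "P = real CARD('p)"
  have K: "0 < K" using cK by simp
  have d0: "0 < d0" using prior(3) K unit_ball_vol_pos[of "DIM(real ^ 'p)"] by (simp add: d0_def)
  have J: "0 \<le> J" unfolding J_def by (simp add: gauss_weight_nonneg)
  have P: "0 < P" by (simp add: P_def)
  define \<eta> where "\<eta> = min (c / 2) (\<epsilon> * d0 / (16 * \<pi> \<theta>g * (J + 1)))"
  define \<eta>' where "\<eta>' = min (\<pi> \<theta>g / 2) (\<epsilon> * d0 / (8 * (J + 1)))"
  have "0 < \<eta> \<and> 0 < \<eta>'" using cK d0 J prior(3) \<epsilon> by (simp add: \<eta>_def \<eta>'_def)
  moreover have "\<eta> \<le> c / 2" unfolding \<eta>_def by (rule min.cobounded1)
  moreover have "\<eta>' \<le> \<pi> \<theta>g / 2" unfolding \<eta>'_def by (rule min.cobounded1)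
  ultimately have \<eta>: "0 < \<eta>" "\<eta> \<le> c / 2" "0 < \<eta>'" "\<eta>' \<le> \<pi> \<theta>g / 2" by simp_all
  have local_err: "(2 * \<pi> \<theta>g * \<eta> + \<eta>') * J \<le> \<epsilon> * d0 / 4"
  proof -
    have "\<eta> \<le> \<epsilon> * d0 / (16 * \<pi> \<theta>g * (J + 1))" unfolding \<eta>_def by (rule min.cobounded2)
    then have "2 * \<pi> \<theta>g * \<eta> \<le> 2 * \<pi> \<theta>g * (\<epsilon> * d0 / (16 * \<pi> \<theta>g * (J + 1)))"
      using prior(3) by (intro mult_left_mono) simp_all
    also have "\<dots> = \<epsilon> * d0 / (8 * (J + 1))"
    proof -
      have "2 * x * (y / (16 * x * z)) = y / (8 * z)" if "x \<noteq> 0" for x y z :: real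
        using that by (cases "z = 0") (simp_all add: field_simps)
      from this[of "\<pi> \<theta>g" "\<epsilon> * d0" "J + 1"] show ?thesis using prior(3) by (metis order_less_irrefl)
    qed
    finally have e1: "2 * \<pi> \<theta>g * \<eta> \<le> \<epsilon> * d0 / (8 * (J + 1))" .
    have e2: "\<eta>' \<le> \<epsilon> * d0 / (8 * (J + 1))" unfolding \<eta>'_def by (rule min.cobounded2)
    have e3: "\<epsilon> * d0 / (8 * (J + 1)) + \<epsilon> * d0 / (8 * (J + 1)) = \<epsilon> * d0 / (4 * (J + 1))"
    proof -
      have "y / (8 * z) + y / (8 * z) = y / (4 * z)" for y z :: real by (cases "z = 0") (simp_all add: field_simps)
      then show ?thesis by blast
    qed
    have "2 * \<pi> \<theta>g * \<eta> + \<eta>' \<le> \<epsilon> * d0 / (4 * (J + 1))" using add_mono[OF e1 e2] unfolding e3 .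
    then have "(2 * \<pi> \<theta>g * \<eta> + \<eta>') * J \<le> \<epsilon> * d0 / (4 * (J + 1)) * J" using J by (rule mult_right_mono)
    also have "\<dots> = \<epsilon> * d0 / 4 * (J / (J + 1))" by simp
    also have "\<dots> \<le> \<epsilon> * d0 / 4 * 1" using J \<epsilon> d0 by (intro mult_left_mono) auto
    finally show ?thesis by simp
  qed
  \<comment> \<open>\<open>\<kappa>\<close> and \<open>\<delta>\<close> are such that the two error terms of the quadratic expansion are at most \<open>\<eta> / 2\<close> each.\<close>
  define C1 where "C1 = (C + 1) / (\<rho> / 2)"
  have C1: "0 < C1" using BC(2) \<rho> by (simp add: C1_def)
  define \<kappa> where "\<kappa> = \<eta> / P^2"
  have \<kappa>: "0 < \<kappa>" using \<eta> P by (simp add: \<kappa>_def)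
  obtain r0 where r0: "0 < r0" "ball \<theta>g r0 \<subseteq> \<omega>" using \<omega> openE by blast
  have "\<exists>d>0. \<forall>\<theta>. dist \<theta> \<theta>g < d \<longrightarrow> dist (\<pi> \<theta>) (\<pi> \<theta>g) < \<eta>'"
    using prior(4) \<eta>(3) unfolding continuous_at_eps_delta by blast
  then obtain d1 where d1: "0 < d1" "\<And>\<theta>. dist \<theta> \<theta>g < d1 \<Longrightarrow> dist (\<pi> \<theta>) (\<pi> \<theta>g) < \<eta>'" by blast
  define \<delta> where "\<delta> = min (min 1 (r0 / 2)) (min (d1 / 2) (\<eta> / (2 * P^3 * C1)))"
  have \<delta>: "0 < \<delta>" "\<delta> \<le> 1" "2 * \<delta> \<le> r0" "2 * \<delta> \<le> d1" "\<delta> \<le> \<eta> / (2 * P^3 * C1)"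
  proof -
    show "0 < \<delta>" using r0(1) d1(1) \<eta>(1) P C1 by (simp add: \<delta>_def)
    have "\<delta> \<le> 1" "\<delta> \<le> r0 / 2" "\<delta> \<le> d1 / 2" "\<delta> \<le> \<eta> / (2 * P^3 * C1)"
      unfolding \<delta>_def by linarith+
    then show "\<delta> \<le> 1" "2 * \<delta> \<le> r0" "2 * \<delta> \<le> d1" "\<delta> \<le> \<eta> / (2 * P^3 * C1)" by simp_all
  qed
  have quad_err: "P^2 * (2 * P * C1 * \<delta> + \<kappa>) / 2 \<le> \<eta>"
  proof -
    have "P^3 * C1 * \<delta> \<le> P^3 * C1 * (\<eta> / (2 * P^3 * C1))" using \<delta>(5) P C1 by (intro mult_left_mono) auto
    also have "\<dots> = \<eta> / 2" using P C1 by simp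
    finally have "P^3 * C1 * \<delta> \<le> \<eta> / 2" .
    moreover have "P^2 * (2 * P * C1 * \<delta> + \<kappa>) / 2 = P^3 * C1 * \<delta> + P^2 * \<kappa> / 2"
      by (simp add: power2_eq_square power3_eq_cube algebra_simps)
    moreover have "P^2 * \<kappa> = \<eta>" using P by (simp add: \<kappa>_def)
    ultimately show ?thesis by simp
  qed
  have ballT: "ball \<theta>g (2 * \<delta>) \<subseteq> T" using r0(2) \<omega>(2) \<delta>(3) by force
  have nb: "\<bar>\<pi> \<theta> - \<pi> \<theta>g\<bar> \<le> \<eta>'" if "norm (\<theta> - \<theta>g) < 2 * \<delta>" for \<theta>
    using d1(2)[of \<theta>] that \<delta>(4) by (simp add: dist_norm dist_real_def)
  obtain e where e: "0 < e" "with_prob_tending_to_one M (\<lambda>n w.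
        (SUP \<theta>\<in>{\<theta>\<in>T. norm (\<theta> - \<theta>g) > \<delta> / 2}.
           ereal (1 / real n * (alpha_lik \<alpha> lam f X n w \<theta> - alpha_lik \<alpha> lam f X n w \<theta>g))) < ereal (- e))"
    using E2[unfolded cond_E2_def, rule_format, of "\<delta> / 2"] \<delta>(1) by auto
  obtain Ev where Ev: "\<And>n. Ev n \<in> sets M" "(\<lambda>n. measure M (Ev n)) \<longlonglongrightarrow> 1"
    "\<And>n w. w \<in> Ev n \<Longrightarrow> (SUP \<theta>\<in>{\<theta>\<in>T. norm (\<theta> - \<theta>g) > \<delta> / 2}.
           ereal (1 / real n * (alpha_lik \<alpha> lam f X n w \<theta> - alpha_lik \<alpha> lam f X n w \<theta>g))) < ereal (- e)"
    using e(2) unfolding with_prob_tending_to_one_def by blast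
  have sep: "1 / real n * (alpha_lik \<alpha> lam f X n w \<theta> - alpha_lik \<alpha> lam f X n w \<theta>g) < - e"
    if "w \<in> Ev n" "\<theta> \<in> T" "\<delta> / 2 < norm (\<theta> - \<theta>g)" for n w \<theta>
  proof -
    have "\<theta> \<in> {\<theta>\<in>T. norm (\<theta> - \<theta>g) > \<delta> / 2}" using that by simp
    from order_le_less_trans[OF SUP_upper[OF this] Ev(3)[OF that(1)]] show ?thesis by simp
  qed
  define L where "L t n = {w \<in> space M. \<kappa> < \<bar>(\<Sum>i=1..n. D' (fst t) (snd t) i (X i w)
      - (\<integral>x. partial2 T (fst t) (snd t) (V \<alpha> lam f i x) \<theta>g \<partial>law lam (g i))) / real n\<bar>}" for t :: "'p \<times> 'p" and n
  define Mk where "Mk n = {w \<in> space M. C1 * real n \<le> (\<Sum>i=1..n. B i (X i w))}" for n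
  have gd: "is_density lam (g i)" if "1 \<le> i" for i by (rule true_modelD(4)[OF tm that])
  have Xm: "X i \<in> measurable M lam" if "1 \<le> i" for i by (rule true_modelD(5)[OF tm that])
  have DX: "(\<lambda>w. D' j k i (X i w)) \<in> borel_measurable M" if "1 \<le> i" for i j k
    by (rule measurable_compose[OF Xm[OF that] D'(1)[OF that]])
  have BX: "(\<lambda>w. B i (X i w)) \<in> borel_measurable M" if "1 \<le> i" for i
    by (rule measurable_compose[OF Xm[OF that] B(1)[OF that]])
  have Lm: "L t n \<in> sets M" for t n
  proof -
    have [measurable]: "(\<lambda>w. \<Sum>i=1..n. D' (fst t) (snd t) i (X i w)
      - (\<integral>x. partial2 T (fst t) (snd t) (V \<alpha> lam f i x) \<theta>g \<partial>law lam (g i))) \<in> borel_measurable M"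
      using DX by (intro borel_measurable_sum borel_measurable_diff borel_measurable_const) auto
    show ?thesis unfolding L_def by measurable
  qed
  have Mkm: "Mk n \<in> sets M" for n
  proof -
    have [measurable]: "(\<lambda>w. \<Sum>i=1..n. B i (X i w)) \<in> borel_measurable M"
      using BX by (intro borel_measurable_sum) auto
    show ?thesis unfolding Mk_def by measurable
  qed
  have Llim: "(\<lambda>n. measure M (L t n)) \<longlonglongrightarrow> 0" for t
    unfolding L_def
    by (rule law_of_large_numbers_law[where D="\<lambda>i x. partial2 T (fst t) (snd t) (V \<alpha> lam f i x) \<theta>g",
        OF tm D' _ \<kappa>]) (use A6 in \<open>auto simp only: cond_A6_def\<close>)
  have Mkle: "measure M (Mk n) \<le> \<rho> / 2" if "N1 \<le> n" "1 \<le> n" for n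
  proof -
    have nn: "AE x in density lam (\<lambda>x. ennreal (g i x)). 0 \<le> B i x" if "1 \<le> i" for i
      by (rule AE_mp[OF Bae[OF that] AE_I2]) blast
    show ?thesis unfolding Mk_def C1_def
      by (rule average_bounded_in_probability[OF tm B nn BC _ that]) (use \<rho> in auto)
  qed
  define regular where "regular i x \<longleftrightarrow>
      (x \<in> S \<and> (\<forall>m\<ge>1. thrice_differentiable_on (\<lambda>\<theta>. f m \<theta> x) T)) \<and>
      (\<forall>t. partial2 T (fst t) (snd t) (V \<alpha> lam f i x) \<theta>g = D' (fst t) (snd t) i x) \<and>
      (0 \<le> B i x \<and> (\<forall>j k l. \<forall>\<theta>\<in>T. \<bar>partial3 T j k l (V \<alpha> lam f i x) \<theta>\<bar> \<le> B i x))" for i x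
  define nice where "nice w \<longleftrightarrow> (\<forall>i. 1 \<le> i \<longrightarrow> regular i (X i w)) \<and>
      (\<forall>n. 1 \<le> n \<longrightarrow> \<theta>hat n w \<in> T \<and> (\<forall>\<theta>\<in>T. alpha_lik \<alpha> lam f X n w \<theta> \<le> alpha_lik \<alpha> lam f X n w (\<theta>hat n w)))" for w
  have nice: "AE w in M. nice w"
    unfolding nice_def
  proof (intro AE_conjI)
    show "AE w in M. \<forall>i. 1 \<le> i \<longrightarrow> regular i (X i w)"
      unfolding AE_all_countable
    proof (intro allI)
      fix i
      show "AE w in M. 1 \<le> i \<longrightarrow> regular i (X i w)"
      proof (cases "1 \<le> i")
        case True
        have hess: "AE w in M. \<forall>t\<in>UNIV. partial2 T (fst t) (snd t) (V \<alpha> lam f i (X i w)) \<theta>g = D' (fst t) (snd t) i (X i w)"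
          by (intro AE_finite_allI finite true_model_AE[OF tm True D'(2)[OF True]])
        have reg: "AE x in density lam (\<lambda>x. ennreal (g i x)).
            x \<in> S \<and> (\<forall>m\<ge>1. thrice_differentiable_on (\<lambda>\<theta>. f m \<theta> x) T)"
          by (rule AE_regular_points[OF _ A1 A2 True]) (rule gd)
        note ae = AE_conjI[OF true_model_AE[OF tm True reg] AE_conjI[OF hess true_model_AE[OF tm True Bae[OF True]]]]
        show ?thesis unfolding regular_def
          by (rule AE_mp[OF ae AE_I2]) (intro impI, unfold ball_UNIV, assumption)
      qed (rule AE_I2, simp)
    qed
    have "AE w in M. 1 \<le> n \<longrightarrow> \<theta>hat n w \<in> T \<and>
        (\<forall>\<theta>\<in>T. alpha_lik \<alpha> lam f X n w \<theta> \<le> alpha_lik \<alpha> lam f X n w (\<theta>hat n w))" for n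
    proof (cases "1 \<le> n")
      case True
      have "AE w in M. \<theta>hat n w \<in> T \<and>
        (\<forall>\<theta>\<in>T. alpha_lik \<alpha> lam f X n w \<theta> \<le> alpha_lik \<alpha> lam f X n w (\<theta>hat n w))"
        by (rule conjunct2[OF mdpde[unfolded is_mdpde_def, THEN spec[of _ n], THEN mp, OF True]])
      then show ?thesis by (rule AE_mp) (rule AE_I2, blast)
    qed (rule AE_I2, simp)
    then show "AE w in M. \<forall>n. 1 \<le> n \<longrightarrow> \<theta>hat n w \<in> T \<and>
        (\<forall>\<theta>\<in>T. alpha_lik \<alpha> lam f X n w \<theta> \<le> alpha_lik \<alpha> lam f X n w (\<theta>hat n w))"
      unfolding AE_all_countable by (intro allI)
  qed

  have lim1: "(\<lambda>n. 1 / (sqrt (real n) * sqrt (2 * K))) \<longlonglongrightarrow> 0" using K by real_asymp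
  have lim2: "(\<lambda>n. sqrt (real n) ^ Suc DIM(real ^ 'p) * exp (- (real n * e)) * R) \<longlonglongrightarrow> 0"
    using e(1) by real_asymp
  have "(\<lambda>n. (1 - measure M (Ev n)) + (\<Sum>t\<in>UNIV. measure M (L t n))) \<longlonglongrightarrow> (1 - 1) + (\<Sum>t\<in>(UNIV :: ('p \<times> 'p) set). 0)"
    by (intro tendsto_add tendsto_diff tendsto_const tendsto_sum Ev(2) Llim)
  then have lim3: "(\<lambda>n. (1 - measure M (Ev n)) + (\<Sum>t\<in>UNIV. measure M (L t n))) \<longlonglongrightarrow> 0" by simp
  have "eventually (\<lambda>n. 1 / (sqrt (real n) * sqrt (2 * K)) < \<delta> \<and>
      sqrt (real n) ^ Suc DIM(real ^ 'p) * exp (- (real n * e)) * R < \<epsilon> * d0 / 4 \<and>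
      (1 - measure M (Ev n)) + (\<Sum>t\<in>UNIV. measure M (L t n)) < \<rho> / 2) sequentially"
    using \<delta>(1) \<epsilon> d0 \<rho>
    by (intro eventually_conj order_tendstoD(2)[OF lim1] order_tendstoD(2)[OF lim2] order_tendstoD(2)[OF lim3]) auto
  then obtain N2 where N2: "\<And>n. N2 \<le> n \<Longrightarrow> 1 / (sqrt (real n) * sqrt (2 * K)) < \<delta> \<and>
      sqrt (real n) ^ Suc DIM(real ^ 'p) * exp (- (real n * e)) * R < \<epsilon> * d0 / 4 \<and>
      (1 - measure M (Ev n)) + (\<Sum>t\<in>UNIV. measure M (L t n)) < \<rho> / 2"
    unfolding eventually_sequentially by blast
  let ?bad = "\<lambda>n. {w \<in> space M. \<epsilon> < norm (sqrt (real n) *\<^sub>R (expected_R_posterior \<alpha> lam f X T \<pi> n w - \<theta>hat n w))}"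
  show "\<exists>no. \<forall>n\<ge>no. norm (measure M (?bad n) - 0) < \<rho>"
  proof (intro exI[of _ "max (max 1 N0) (max N1 N2)"] allI impI)
    fix n assume "max (max 1 N0) (max N1 N2) \<le> n"
    then have n: "1 \<le> n" "N0 \<le> n" "N1 \<le> n" "N2 \<le> n" by auto
    let ?cover = "((space M - Ev n) \<union> (\<Union>t\<in>UNIV. L t n)) \<union> Mk n"
    have good: "w \<notin> ?bad n" if w: "w \<in> space M" "nice w" "w \<notin> ?cover" for w
    proof -
      have ev: "w \<in> Ev n" and notL: "\<And>t. w \<notin> L t n" and notM: "w \<notin> Mk n" using w by auto
      have sum: "(\<Sum>i=1..n. B i (X i w)) \<le> C1 * real n" using notM w(1) by (simp add: Mk_def)
      have reg: "X i w \<in> S" "thrice_differentiable_on (\<lambda>\<theta>. f i \<theta> (X i w)) T"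
        "\<And>t. partial2 T (fst t) (snd t) (V \<alpha> lam f i (X i w)) \<theta>g = D' (fst t) (snd t) i (X i w)"
        "\<And>j k l \<theta>. \<theta> \<in> T \<Longrightarrow> \<bar>partial3 T j k l (V \<alpha> lam f i (X i w)) \<theta>\<bar> \<le> B i (X i w)" if "1 \<le> i" for i
        using w(2) that unfolding nice_def regular_def by blast+
      have mx: "\<theta>hat n w \<in> T" "\<And>\<theta>. \<theta> \<in> T \<Longrightarrow> alpha_lik \<alpha> lam f X n w \<theta> \<le> alpha_lik \<alpha> lam f X n w (\<theta>hat n w)"
        using w(2) n(1) unfolding nice_def by blast+
      have pos: "0 < f i \<theta> (X i w)" if "1 \<le> i" "\<theta> \<in> T" for i \<theta>
        using A1 that reg(1)[OF that(1)] unfolding cond_A1_def by blast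
      have second: "\<bar>(\<Sum>i=1..n. partial2 T j k (V \<alpha> lam f i (X i w)) \<theta>g
        - (\<integral>x. partial2 T j k (V \<alpha> lam f i x) \<theta>g \<partial>law lam (g i))) / real n\<bar> \<le> \<kappa>" for j k
      proof -
        have "(\<Sum>i=1..n. partial2 T j k (V \<alpha> lam f i (X i w)) \<theta>g - (\<integral>x. partial2 T j k (V \<alpha> lam f i x) \<theta>g \<partial>law lam (g i)))
          = (\<Sum>i=1..n. D' j k i (X i w) - (\<integral>x. partial2 T j k (V \<alpha> lam f i x) \<theta>g \<partial>law lam (g i)))"
          using reg(3)[of _ "(j, k)"] by (intro sum.cong refl) simp
        then show ?thesis using notL[of "(j, k)"] w(1) by (simp add: L_def)
      qed
      have "sqrt (real n) * norm (expected_R_posterior \<alpha> lam f X T \<pi> n w - \<theta>hat n w)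
        \<le> ((2 * \<pi> \<theta>g * \<eta> + \<eta>') * J + sqrt (real n) ^ Suc DIM(real ^ 'p) * exp (- (real n * e)) * R) / d0"
        unfolding J_def R_def d0_def
        by (rule posterior_mean_close_on_good_event[where B="\<lambda>i. B i (X i w)" and C=C1 and \<kappa>=\<kappa>,
            OF \<alpha> tm pf A3 w(1) n(1) ballT \<delta>(1,2) prior(1-3) mx pos reg(2,4) sum less_imp_le[OF C1] second
              sep[OF ev] e(1) ell_lower[OF n(1)] ell_upper[OF n(2)] cK less_imp_le[OF \<eta>(1)] \<eta>(2)
              quad_err[unfolded P_def] nb \<eta>(4)]) (use N2[OF n(4)] in auto)
      also have "\<dots> \<le> (\<epsilon> * d0 / 4 + \<epsilon> * d0 / 4) / d0"
        using local_err N2[OF n(4)] d0 by (intro divide_right_mono add_mono) auto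
      also have "\<dots> \<le> \<epsilon>" using d0 \<epsilon> by simp
      finally show ?thesis by simp
    qed
    have Un: "(\<Union>t\<in>UNIV. L t n) \<in> sets M" using Lm by (intro sets.finite_UN) auto
    have cm: "?cover \<in> sets M" using Ev(1) Un Mkm by auto
    have "measure M (?bad n) \<le> measure M ?cover"
      by (rule finite_measure_mono_AE[OF AE_mp[OF nice AE_I2] cm]) (use good in blast)
    also have "\<dots> \<le> measure M ((space M - Ev n) \<union> (\<Union>t\<in>UNIV. L t n)) + measure M (Mk n)"
      by (rule measure_Un_le) (use Ev(1) Un Mkm in auto)
    also have "\<dots> \<le> (measure M (space M - Ev n) + measure M (\<Union>t\<in>UNIV. L t n)) + measure M (Mk n)"
      by (intro add_right_mono measure_Un_le) (use Ev(1) Un in auto)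
    also have "\<dots> \<le> ((1 - measure M (Ev n)) + (\<Sum>t\<in>UNIV. measure M (L t n))) + \<rho> / 2"
      using Mkle[OF n(3,1)] Lm by (intro add_mono measure_UNION_le) (auto simp: prob_compl[OF Ev(1)])
    also have "\<dots> < \<rho>" using N2[OF n(4)] by linarith
    finally show "norm (measure M (?bad n) - 0) < \<rho>" by simp
  qed
qed

theorem theorem2p2:
  fixes M :: "'w measure" and lam :: "'a measure"
    and X :: "nat \<Rightarrow> 'w \<Rightarrow> 'a"
    and g :: "nat \<Rightarrow> 'a \<Rightarrow> real"
    and f :: "nat \<Rightarrow> real ^ 'p \<Rightarrow> 'a \<Rightarrow> real"
    and \<Theta> :: "(real ^ 'p) set" and \<theta>g :: "real ^ 'p"
    and \<theta>hat :: "nat \<Rightarrow> 'w \<Rightarrow> real ^ 'p"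
    and \<pi> :: "real ^ 'p \<Rightarrow> real" and \<alpha> :: real
  assumes "\<alpha> > 0"
    and "true_model M lam X g"
    and "parametric_family lam \<Theta> f"
    and "best_fitting \<alpha> lam g f \<Theta> \<theta>g"
    and "is_mdpde \<alpha> M lam f X \<Theta> \<theta>hat"
    and "cond_E1 \<alpha> lam g f \<Theta> \<theta>g"
    and "cond_E2 \<alpha> M lam f X \<Theta> \<theta>g"
    and "cond_E3 \<alpha> lam g f \<Theta>"
    and "prior_density \<Theta> \<pi>"
    and "\<pi> \<theta>g > 0" and "isCont \<pi> \<theta>g"
    and "set_integrable lborel \<Theta> (\<lambda>\<theta>. \<pi> \<theta> *\<^sub>R \<theta>)"
  shows "tendsto_in_prob M
           (\<lambda>n w. sqrt (real n) *\<^sub>R (expected_R_posterior \<alpha> lam f X \<Theta> \<pi> n w - \<theta>hat n w)) 0 \<and>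
         (\<forall>Sig :: nat \<Rightarrow> real ^ 'p ^ 'p.
            pos_definite_seq Sig \<and>
            tendsto_in_distr M
              (\<lambda>n w. inv_sqrt_matrix (Sig n) *v (sqrt (real n) *\<^sub>R (\<theta>hat n w - \<theta>g)))
              std_normal_vec \<longrightarrow>
            tendsto_in_distr M
              (\<lambda>n w. inv_sqrt_matrix (Sig n) *v
                       (sqrt (real n) *\<^sub>R (expected_R_posterior \<alpha> lam f X \<Theta> \<pi> n w - \<theta>g)))
              std_normal_vec)"
proof -
  let ?E = "expected_R_posterior \<alpha> lam f X \<Theta> \<pi>"
  have gT: "\<theta>g \<in> \<Theta>" using assms(4) by (simp add: best_fitting_def)
  have M: "prob_space M" by (rule true_modelD(1)[OF assms(2)])
  then interpret prob_space M .
  have Em: "?E n \<in> borel_measurable M" for n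
    by (rule expected_R_posterior_measurable[OF assms(2,3) gT assms(9)])
  have hm: "\<theta>hat n \<in> borel_measurable M" if "1 \<le> n" for n
    using assms(5) that unfolding is_mdpde_def by blast
  have small: "(\<lambda>n. measure M {w \<in> space M. \<epsilon> < norm (sqrt (real n) *\<^sub>R (?E n w - \<theta>hat n w))}) \<longlonglongrightarrow> 0"
    if "0 < \<epsilon>" for \<epsilon>
    by (rule posterior_mean_minus_mdpde_vanishes[OF assms(1-3,5-9,12,10,11) that])
  have meas: "(\<lambda>w. sqrt (real n) *\<^sub>R (?E n w - \<theta>hat n w)) \<in> borel_measurable M" for n
    \<comment> \<open>Nothing is known about \<open>\<theta>hat 0\<close>, but the factor \<open>sqrt 0\<close> removes it.\<close>
  proof (cases "n = 0")
    case False
    then show ?thesis using Em hm[of n] by (intro borel_measurable_scaleR borel_measurable_diff) auto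
  qed simp
  have a: "tendsto_in_prob M (\<lambda>n w. sqrt (real n) *\<^sub>R (?E n w - \<theta>hat n w)) 0"
    unfolding tendsto_in_prob_def dist_norm diff_0_right by (intro conjI allI impI meas small)
  have b: "tendsto_in_distr M (\<lambda>n w. inv_sqrt_matrix (Sig n) *v (sqrt (real n) *\<^sub>R (?E n w - \<theta>g))) std_normal_vec"
    if Sig: "pos_definite_seq Sig"
      and conv: "tendsto_in_distr M (\<lambda>n w. inv_sqrt_matrix (Sig n) *v (sqrt (real n) *\<^sub>R (\<theta>hat n w - \<theta>g))) std_normal_vec"
    for Sig :: "nat \<Rightarrow> real ^ 'p ^ 'p"
  proof (rule tendsto_in_distr_add_vanishing[OF M _ conv])
    show "sets (std_normal_vec :: (real ^ 'p) measure) = sets borel" by (simp add: std_normal_vec_def)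
    show "(\<lambda>w. inv_sqrt_matrix (Sig n) *v (sqrt (real n) *\<^sub>R (?E n w - \<theta>g))) \<in> borel_measurable M" for n
    proof -
      have v: "(\<lambda>w. sqrt (real n) *\<^sub>R (?E n w - \<theta>g)) \<in> borel_measurable M"
        using Em by (intro borel_measurable_scaleR borel_measurable_diff) auto
      have "(*v) (inv_sqrt_matrix (Sig n)) \<in> borel_measurable borel"
        by (intro borel_measurable_continuous_onI linear_continuous_on matrix_vector_mul_bounded_linear)
      from measurable_compose[OF v this] show ?thesis .
    qed
    obtain c where c: "0 < c" "\<And>n. 1 \<le> n \<Longrightarrow> c \<le> min_eigenvalue (Sig n)"
      using Sig INF_min_eigenvalue_lower_bound[of Sig] unfolding pos_definite_seq_def by blast
    fix \<epsilon> :: real assume \<epsilon>: "0 < \<epsilon>"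
    let ?d = "\<lambda>n w. inv_sqrt_matrix (Sig n) *v (sqrt (real n) *\<^sub>R (?E n w - \<theta>g))
       - inv_sqrt_matrix (Sig n) *v (sqrt (real n) *\<^sub>R (\<theta>hat n w - \<theta>g))"
    have bound: "norm (?d n w) \<le> norm (sqrt (real n) *\<^sub>R (?E n w - \<theta>hat n w)) / sqrt c" for n w
    proof (cases "n = 0")
      case False
      then have n: "1 \<le> n" by simp
      have eq: "?d n w = inv_sqrt_matrix (Sig n) *v (sqrt (real n) *\<^sub>R (?E n w - \<theta>hat n w))"
        by (simp add: matrix_vector_mult_diff_distrib[symmetric] scaleR_diff_right[symmetric])
      have "pos_definite (Sig n)" using Sig n unfolding pos_definite_seq_def by blast
      from norm_inv_sqrt_matrix_le[OF this c(1) c(2)[OF n]] show ?thesis unfolding eq .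
    qed simp
    have le: "measure M {w \<in> space M. \<epsilon> < norm (?d n w)}
        \<le> measure M {w \<in> space M. \<epsilon> * sqrt c < norm (sqrt (real n) *\<^sub>R (?E n w - \<theta>hat n w))}" for n
    proof (rule finite_measure_mono)
      show "{w \<in> space M. \<epsilon> < norm (?d n w)} \<subseteq> {w \<in> space M. \<epsilon> * sqrt c < norm (sqrt (real n) *\<^sub>R (?E n w - \<theta>hat n w))}"
      proof
        fix w assume "w \<in> {w \<in> space M. \<epsilon> < norm (?d n w)}"
        then have "w \<in> space M" "\<epsilon> < norm (sqrt (real n) *\<^sub>R (?E n w - \<theta>hat n w)) / sqrt c"
          using bound[of n w] by auto
        then show "w \<in> {w \<in> space M. \<epsilon> * sqrt c < norm (sqrt (real n) *\<^sub>R (?E n w - \<theta>hat n w))}"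
          using c(1) by (simp only: pos_less_divide_eq real_sqrt_gt_zero mem_Collect_eq simp_thms)
      qed
      show "{w \<in> space M. \<epsilon> * sqrt c < norm (sqrt (real n) *\<^sub>R (?E n w - \<theta>hat n w))} \<in> sets M"
        by (rule borel_measurable_less[OF borel_measurable_const measurable_compose[OF meas borel_measurable_norm]])
    qed
    have "0 < \<epsilon> * sqrt c" using \<epsilon> c(1) by simp
    from small[OF this] show "(\<lambda>n. measure M {w \<in> space M. \<epsilon> < norm (?d n w)}) \<longlonglongrightarrow> 0"
      by (rule tendsto_sandwich[OF always_eventually always_eventually tendsto_const, rotated 2]) (use le in auto)
  qed
  show ?thesis using a b by blast
qed

end
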